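(* Let $p$ be a prime, let $k=\mathbf{F}_p$, and let $G$ be a finite $p$-group. Then the cohomology ring $H^*(G,k)=\bigoplus_{i\ge 0}H^i(G,k)$ is finitely generated. Moreover, for every finitely generated $kG$-module $M$, the $H^*(G,k)$-module $H^*(G,M)=\bigoplus_{i\ge 0}H^i(G,M)$ is finitely generated.
   Context: Here $k=\mathbf{F}_p$ is the trivial $kG$-module, $H^i(G,M)=\operatorname{Ext}^i_{kG}(k,M)$ is group cohomology, $H^*(G,k)$ is a graded ring under the cup (equivalently Yoneda) product, and $H^*(G,M)$ is a module over $H^*(G,k)$ via the cup (Yoneda) product. *)

theory Defs
  imports "HOL-Algebra.Algebra" "HOL-Number_Theory.Residues"
begin

section \<open>Left modules over a ring\<close>

text \<open>
  The library locale \<open>module\<close> requires a commutative ring of scalars; the axioms below are the same,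
  over an arbitrary ring. The fields \<open>mult\<close> and \<open>one\<close> of a module record carry no information.
\<close>

locale left_module = R?: ring R + M?: abelian_group M
    for R :: "('r, 'c) ring_scheme" (structure) and M :: "('r, 'm, 'd) module_scheme" (structure) +
  assumes smult_closed [simp, intro]:
      "\<lbrakk>a \<in> carrier R; x \<in> carrier M\<rbrakk> \<Longrightarrow> a \<odot>\<^bsub>M\<^esub> x \<in> carrier M"
    and smult_l_distr:
      "\<lbrakk>a \<in> carrier R; b \<in> carrier R; x \<in> carrier M\<rbrakk> \<Longrightarrow>
        (a \<oplus>\<^bsub>R\<^esub> b) \<odot>\<^bsub>M\<^esub> x = a \<odot>\<^bsub>M\<^esub> x \<oplus>\<^bsub>M\<^esub> b \<odot>\<^bsub>M\<^esub> x"
    and smult_r_distr: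
      "\<lbrakk>a \<in> carrier R; x \<in> carrier M; y \<in> carrier M\<rbrakk> \<Longrightarrow>
        a \<odot>\<^bsub>M\<^esub> (x \<oplus>\<^bsub>M\<^esub> y) = a \<odot>\<^bsub>M\<^esub> x \<oplus>\<^bsub>M\<^esub> a \<odot>\<^bsub>M\<^esub> y"
    and smult_assoc1:
      "\<lbrakk>a \<in> carrier R; b \<in> carrier R; x \<in> carrier M\<rbrakk> \<Longrightarrow>
        (a \<otimes>\<^bsub>R\<^esub> b) \<odot>\<^bsub>M\<^esub> x = a \<odot>\<^bsub>M\<^esub> (b \<odot>\<^bsub>M\<^esub> x)"
    and smult_one [simp]:
      "x \<in> carrier M \<Longrightarrow> \<one>\<^bsub>R\<^esub> \<odot>\<^bsub>M\<^esub> x = x"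

definition module_hom ::
  "('r, 'c) ring_scheme \<Rightarrow> ('r, 'a, 'd) module_scheme \<Rightarrow> ('r, 'b, 'e) module_scheme \<Rightarrow> ('a \<Rightarrow> 'b) set"
  where "module_hom R M N = {f \<in> carrier M \<rightarrow>\<^sub>E carrier N.
    (\<forall>x\<in>carrier M. \<forall>y\<in>carrier M. f (x \<oplus>\<^bsub>M\<^esub> y) = f x \<oplus>\<^bsub>N\<^esub> f y) \<and>
    (\<forall>a\<in>carrier R. \<forall>x\<in>carrier M. f (a \<odot>\<^bsub>M\<^esub> x) = a \<odot>\<^bsub>N\<^esub> f x)}"

inductive_set generate_module ::
  "('r, 'c) ring_scheme \<Rightarrow> ('r, 'm, 'd) module_scheme \<Rightarrow> 'm set \<Rightarrow> 'm set"
  for R and M and S where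
    zero:  "\<zero>\<^bsub>M\<^esub> \<in> generate_module R M S"
  | incl:  "x \<in> S \<Longrightarrow> x \<in> generate_module R M S"
  | add:   "\<lbrakk>x \<in> generate_module R M S; y \<in> generate_module R M S\<rbrakk> \<Longrightarrow> x \<oplus>\<^bsub>M\<^esub> y \<in> generate_module R M S"
  | smult: "\<lbrakk>a \<in> carrier R; x \<in> generate_module R M S\<rbrakk> \<Longrightarrow> a \<odot>\<^bsub>M\<^esub> x \<in> generate_module R M S"

definition finitely_generated_module ::
  "('r, 'c) ring_scheme \<Rightarrow> ('r, 'm, 'd) module_scheme \<Rightarrow> bool"
  where "finitely_generated_module R M \<longleftrightarrow>
    (\<exists>S. finite S \<and> S \<subseteq> carrier M \<and> generate_module R M S = carrier M)"

text \<open>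
  Finite generation as a ring. For an algebra over a prime field \<open>\<int>/p\<close>, such as the cohomology ring
  below, this is the same as finite generation as an algebra: the scalars are multiples of \<open>1\<close>.
\<close>

definition finitely_generated_ring :: "('r, 'c) ring_scheme \<Rightarrow> bool"
  where "finitely_generated_ring R \<longleftrightarrow>
    (\<exists>S. finite S \<and> S \<subseteq> carrier R \<and> generate_ring R S = carrier R)"

definition module_basis :: "('r, 'c) ring_scheme \<Rightarrow> ('r, 'm, 'd) module_scheme \<Rightarrow> 'm set \<Rightarrow> bool"
  where "module_basis R M B \<longleftrightarrow> B \<subseteq> carrier M \<and>
    (\<forall>x\<in>carrier M. \<exists>!c. c \<in> B \<rightarrow>\<^sub>E carrier R \<and> finite {b \<in> B. c b \<noteq> \<zero>\<^bsub>R\<^esub>} \<and>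
      x = (\<Oplus>\<^bsub>M\<^esub>b\<in>{b \<in> B. c b \<noteq> \<zero>\<^bsub>R\<^esub>}. c b \<odot>\<^bsub>M\<^esub> b))"

definition free_module :: "('r, 'c) ring_scheme \<Rightarrow> ('r, 'm, 'd) module_scheme \<Rightarrow> bool"
  where "free_module R M \<longleftrightarrow> left_module R M \<and> (\<exists>B. module_basis R M B)"

section \<open>Free resolutions and Ext\<close>

text \<open>A complex \<open>\<dots> \<rightarrow> P\<^sub>1 \<rightarrow> P\<^sub>0 \<rightarrow> A\<close>; the differential \<open>res_diff P n\<close> goes from \<open>P\<^sub>n\<^sub>+\<^sub>1\<close> to \<open>P\<^sub>n\<close>.\<close>

record ('r, 'b, 'a) resolution =
  res_term :: "nat \<Rightarrow> ('r, 'b) module"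
  res_diff :: "nat \<Rightarrow> 'b \<Rightarrow> 'b"
  res_aug :: "'b \<Rightarrow> 'a"

definition free_resolution ::
  "('r, 'c) ring_scheme \<Rightarrow> ('r, 'a) module \<Rightarrow> ('r, 'b, 'a) resolution \<Rightarrow> bool"
  where "free_resolution R A P \<longleftrightarrow>
    (\<forall>n. free_module R (res_term P n)) \<and>
    (\<forall>n. res_diff P n \<in> module_hom R (res_term P (Suc n)) (res_term P n)) \<and>
    res_aug P \<in> module_hom R (res_term P 0) A \<and>
    res_aug P ` carrier (res_term P 0) = carrier A \<and>
    {x \<in> carrier (res_term P 0). res_aug P x = \<zero>\<^bsub>A\<^esub>} = res_diff P 0 ` carrier (res_term P 1) \<and>
    (\<forall>n. {x \<in> carrier (res_term P (Suc n)). res_diff P n x = \<zero>\<^bsub>res_term P n\<^esub>}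
           = res_diff P (Suc n) ` carrier (res_term P (Suc (Suc n))))"

definition ext_cocycles ::
  "('r, 'c) ring_scheme \<Rightarrow> ('r, 'b, 'a) resolution \<Rightarrow> ('r, 'm) module \<Rightarrow> nat \<Rightarrow> ('b \<Rightarrow> 'm) set"
  where "ext_cocycles R P M n = {f \<in> module_hom R (res_term P n) M.
    \<forall>x\<in>carrier (res_term P (Suc n)). f (res_diff P n x) = \<zero>\<^bsub>M\<^esub>}"

primrec ext_coboundaries ::
  "('r, 'c) ring_scheme \<Rightarrow> ('r, 'b, 'a) resolution \<Rightarrow> ('r, 'm) module \<Rightarrow> nat \<Rightarrow> ('b \<Rightarrow> 'm) set"
  where
    "ext_coboundaries R P M 0 = {\<lambda>x\<in>carrier (res_term P 0). \<zero>\<^bsub>M\<^esub>}"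
  | "ext_coboundaries R P M (Suc n) =
      (\<lambda>h. \<lambda>x\<in>carrier (res_term P (Suc n)). h (res_diff P n x)) ` module_hom R (res_term P n) M"

definition ext_cocycle_group ::
  "('r, 'c) ring_scheme \<Rightarrow> ('r, 'b, 'a) resolution \<Rightarrow> ('r, 'm) module \<Rightarrow> nat \<Rightarrow> ('b \<Rightarrow> 'm) monoid"
  where "ext_cocycle_group R P M n =
    \<lparr>carrier = ext_cocycles R P M n,
     monoid.mult = (\<lambda>f g. \<lambda>x\<in>carrier (res_term P n). f x \<oplus>\<^bsub>M\<^esub> g x),
     one = (\<lambda>x\<in>carrier (res_term P n). \<zero>\<^bsub>M\<^esub>)\<rparr>"

text \<open>
  \<open>Ext\<^sup>n\<^sub>R(A, M) = H\<^sup>n(Hom\<^sub>R(P, M))\<close>, for a free resolution \<open>P\<close> of \<open>A\<close>. It is an additive group written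
  with the multiplicative notation of quotient groups; its elements are cosets of cocycles.
\<close>

definition Ext ::
  "('r, 'c) ring_scheme \<Rightarrow> ('r, 'b, 'a) resolution \<Rightarrow> ('r, 'm) module \<Rightarrow> nat \<Rightarrow> ('b \<Rightarrow> 'm) set monoid"
  where "Ext R P M n = ext_cocycle_group R P M n Mod ext_coboundaries R P M n"

definition ext_class ::
  "('r, 'c) ring_scheme \<Rightarrow> ('r, 'b, 'a) resolution \<Rightarrow> ('r, 'm) module \<Rightarrow> nat \<Rightarrow> ('b \<Rightarrow> 'm) \<Rightarrow> ('b \<Rightarrow> 'm) set"
  where "ext_class R P M n f = ext_coboundaries R P M n #>\<^bsub>ext_cocycle_group R P M n\<^esub> f"

text \<open>
  \<open>F\<close> is a chain map \<open>P\<^sub>n\<^sub>+\<^sub>* \<rightarrow> P\<^sub>*\<close> lifting the cocycle \<open>f : P\<^sub>n \<rightarrow> A\<close>, i.e. it represents \<open>f\<close> as a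
  degree \<open>n\<close> morphism from \<open>A\<close> to itself.
\<close>

definition chain_lift ::
  "('r, 'c) ring_scheme \<Rightarrow> ('r, 'b, 'a) resolution \<Rightarrow> nat \<Rightarrow> ('b \<Rightarrow> 'a) \<Rightarrow> (nat \<Rightarrow> 'b \<Rightarrow> 'b) \<Rightarrow> bool"
  where "chain_lift R P n f F \<longleftrightarrow>
    (\<forall>i. F i \<in> module_hom R (res_term P (n + i)) (res_term P i)) \<and>
    (\<forall>x\<in>carrier (res_term P n). res_aug P (F 0 x) = f x) \<and>
    (\<forall>i. \<forall>x\<in>carrier (res_term P (Suc (n + i))). res_diff P i (F (Suc i) x) = F i (res_diff P (n + i) x))"

text \<open>
  The Yoneda product \<open>Ext\<^sup>q\<^sub>R(A, M) \<times> Ext\<^sup>n\<^sub>R(A, A) \<rightarrow> Ext\<^sup>n\<^sup>+\<^sup>q\<^sub>R(A, M)\<close>: the class of \<open>g \<circ> F\<^sub>q\<close>, where \<open>g\<close>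
  represents \<open>U\<close> and \<open>F\<close> lifts a representative of \<open>V\<close>. By the comparison theorem this class does not
  depend on the choices, so the set below is a single coset.
\<close>

definition yoneda_prod ::
  "('r, 'c) ring_scheme \<Rightarrow> ('r, 'b, 'a) resolution \<Rightarrow> ('r, 'm) module \<Rightarrow> nat \<Rightarrow> nat
    \<Rightarrow> ('b \<Rightarrow> 'm) set \<Rightarrow> ('b \<Rightarrow> 'a) set \<Rightarrow> ('b \<Rightarrow> 'm) set"
  where "yoneda_prod R P M q n U V =
    {h. \<exists>g\<in>U. \<exists>f\<in>V. \<exists>F. chain_lift R P n f F \<and>
      h \<in> ext_class R P M (n + q) (\<lambda>x\<in>carrier (res_term P (n + q)). g (F q x))}"

text \<open>The direct sum \<open>\<Oplus>\<^sub>n Ext\<^sup>n\<^sub>R(A, M)\<close>: families with finitely many non-zero components.\<close>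

definition ext_sum_carrier ::
  "('r, 'c) ring_scheme \<Rightarrow> ('r, 'b, 'a) resolution \<Rightarrow> ('r, 'm) module \<Rightarrow> (nat \<Rightarrow> ('b \<Rightarrow> 'm) set) set"
  where "ext_sum_carrier R P M =
    {x. (\<forall>n. x n \<in> carrier (Ext R P M n)) \<and> finite {n. x n \<noteq> \<one>\<^bsub>Ext R P M n\<^esub>}}"

definition ext_sum_prod ::
  "('r, 'c) ring_scheme \<Rightarrow> ('r, 'b, 'a) resolution \<Rightarrow> ('r, 'm) module
    \<Rightarrow> (nat \<Rightarrow> ('b \<Rightarrow> 'm) set) \<Rightarrow> (nat \<Rightarrow> ('b \<Rightarrow> 'a) set) \<Rightarrow> (nat \<Rightarrow> ('b \<Rightarrow> 'm) set)"
  where "ext_sum_prod R P M x y =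
    (\<lambda>m. \<Otimes>\<^bsub>Ext R P M m\<^esub>q\<in>{..m}. yoneda_prod R P M q (m - q) (x q) (y (m - q)))"

definition Ext_ring ::
  "('r, 'c) ring_scheme \<Rightarrow> ('r, 'b, 'a) resolution \<Rightarrow> ('r, 'a) module \<Rightarrow> (nat \<Rightarrow> ('b \<Rightarrow> 'a) set) ring"
  where "Ext_ring R P A =
    \<lparr>carrier = ext_sum_carrier R P A,
     monoid.mult = ext_sum_prod R P A,
     one = (\<lambda>n. if n = 0 then ext_class R P A 0 (res_aug P) else \<one>\<^bsub>Ext R P A n\<^esub>),
     ring.zero = (\<lambda>n. \<one>\<^bsub>Ext R P A n\<^esub>),
     ring.add = (\<lambda>x y n. x n \<otimes>\<^bsub>Ext R P A n\<^esub> y n)\<rparr>"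

text \<open>
  The Yoneda product makes \<open>Ext\<^sub>R(A, M)\<close> a right module over the ring \<open>Ext\<^sub>R(A, A)\<close>; hence
  \<open>y \<odot> x\<close> stands for \<open>x \<cdot> y\<close>. In group cohomology the ring is graded commutative and the right and
  left actions of homogeneous elements differ by a sign only.
\<close>

definition Ext_module ::
  "('r, 'c) ring_scheme \<Rightarrow> ('r, 'b, 'a) resolution \<Rightarrow> ('r, 'm) module
    \<Rightarrow> (nat \<Rightarrow> ('b \<Rightarrow> 'a) set, nat \<Rightarrow> ('b \<Rightarrow> 'm) set) module"
  where "Ext_module R P M =
    \<lparr>carrier = ext_sum_carrier R P M,
     monoid.mult = undefined,
     one = undefined,
     ring.zero = (\<lambda>n. \<one>\<^bsub>Ext R P M n\<^esub>),
     ring.add = (\<lambda>x y n. x n \<otimes>\<^bsub>Ext R P M n\<^esub> y n),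
     module.smult = (\<lambda>y x. ext_sum_prod R P M x y)\<rparr>"

section \<open>Group algebras and group cohomology\<close>

text \<open>The group algebra of a \<^emph>\<open>finite\<close> group: all functions from the group to the coefficients.\<close>

definition group_algebra :: "('k, 'c) ring_scheme \<Rightarrow> ('g, 'd) monoid_scheme \<Rightarrow> ('g \<Rightarrow> 'k) ring"
  where "group_algebra K G =
    \<lparr>carrier = carrier G \<rightarrow>\<^sub>E carrier K,
     monoid.mult = (\<lambda>a b. \<lambda>g\<in>carrier G. \<Oplus>\<^bsub>K\<^esub>h\<in>carrier G. a h \<otimes>\<^bsub>K\<^esub> b (inv\<^bsub>G\<^esub> h \<otimes>\<^bsub>G\<^esub> g)),
     one = (\<lambda>g\<in>carrier G. if g = \<one>\<^bsub>G\<^esub> then \<one>\<^bsub>K\<^esub> else \<zero>\<^bsub>K\<^esub>),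
     ring.zero = (\<lambda>g\<in>carrier G. \<zero>\<^bsub>K\<^esub>),
     ring.add = (\<lambda>a b. \<lambda>g\<in>carrier G. a g \<oplus>\<^bsub>K\<^esub> b g)\<rparr>"

text \<open>Every group element acts as the identity, so \<open>\<Sum> a\<^sub>g g\<close> acts as multiplication by \<open>\<Sum> a\<^sub>g\<close>.\<close>

definition trivial_module :: "('k, 'c) ring_scheme \<Rightarrow> ('g, 'd) monoid_scheme \<Rightarrow> ('g \<Rightarrow> 'k, 'k) module"
  where "trivial_module K G =
    \<lparr>carrier = carrier K, monoid.mult = undefined, one = undefined,
     ring.zero = \<zero>\<^bsub>K\<^esub>, ring.add = ring.add K,
     module.smult = (\<lambda>a x. (\<Oplus>\<^bsub>K\<^esub>g\<in>carrier G. a g) \<otimes>\<^bsub>K\<^esub> x)\<rparr>"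

abbreviation F_p :: "nat \<Rightarrow> int ring"
  where "F_p p \<equiv> residue_ring (int p)"

text \<open>
  \<open>H\<^sup>*(G, K) = Ext\<^sub>K\<^sub>G(K, K)\<close> and \<open>H\<^sup>*(G, M) = Ext\<^sub>K\<^sub>G(K, M)\<close>, computed from a free resolution \<open>P\<close> of the
  trivial module.
\<close>

definition cohomology_ring ::
  "('k, 'c) ring_scheme \<Rightarrow> ('g, 'd) monoid_scheme \<Rightarrow> ('g \<Rightarrow> 'k, 'b, 'k) resolution
    \<Rightarrow> (nat \<Rightarrow> ('b \<Rightarrow> 'k) set) ring"
  where "cohomology_ring K G P = Ext_ring (group_algebra K G) P (trivial_module K G)"

definition cohomology_module ::
  "('k, 'c) ring_scheme \<Rightarrow> ('g, 'd) monoid_scheme \<Rightarrow> ('g \<Rightarrow> 'k, 'b, 'k) resolution \<Rightarrow> ('g \<Rightarrow> 'k, 'm) module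
    \<Rightarrow> (nat \<Rightarrow> ('b \<Rightarrow> 'k) set, nat \<Rightarrow> ('b \<Rightarrow> 'm) set) module"
  where "cohomology_module K G P M = Ext_module (group_algebra K G) P M"

end

theory Submission
  imports Defs
begin

text \<open>
  The proof uses an explicit free resolution, a tensor product of periodic resolutions of cyclic groups.
  For \<open>h \<in> G\<close> and each coset of \<open>\<langle>h\<rangle>\<close> take a copy of the periodic resolution of the cyclic group \<open>\<langle>h\<rangle>\<close>.
  The group \<open>G\<close> permutes the cosets, hence acts (with Koszul signs) on the tensor product of all these
  complexes; it permutes the basis up to signs, and it does so freely, since \<open>h \<noteq> 1\<close> fixes the coset
  \<open>\<langle>h\<rangle>\<close> and translates it without fixed points. So the tensor product is a free resolution of the
  trivial module.

  Each factor of the tensor product has a periodicity operator of degree \<open>-2\<close>. These operators \<open>s\<^sub>1, \<dots>, s\<^sub>r\<close> commute and are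
  permuted by \<open>G\<close>, so that their elementary symmetric polynomials are equivariant chain maps. They act on
  cohomology as multiplication by classes \<open>\<zeta>\<^sub>1, \<dots>, \<zeta>\<^sub>r\<close>. All cochains with values in \<open>M\<close>, equivariant or not,
  form a finitely generated module over \<open>k[s\<^sub>1, \<dots>, s\<^sub>r]\<close>, hence over the symmetric polynomials, and by
  Hilbert's basis theorem the equivariant cocycles are finitely generated as well. Therefore \<open>H\<^sup>*(G, M)\<close> is finitely generated over
  \<open>k[\<zeta>\<^sub>1, \<dots>, \<zeta>\<^sub>r]\<close>.
\<close>

section \<open>A Hilbert basis theorem for groups with commuting operators\<close>

text \<open>A single shift \<open>s_j\<close> is not equivariant, so only symmetric polynomials in
  the shifts act on equivariant cochains. Finiteness is therefore proved first for all additive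
  cochains, where each shift acts, and reaches the equivariant cocycles as a submodule over a
  Noetherian ring. The argument runs on cocycles, before coboundaries are divided out: finitely many
  cocycles generate, hence so do their classes. Two facts make the additive cochains finitely
  generated over the symmetric polynomials. The power \<open>s_j^r\<close> lies in the ideal of the
  elementary symmetric polynomials, because \<open>s_j\<close> is a root of the monic polynomial
  with roots \<open>s_1, ..., s_r\<close>. And a cell of degree above \<open>2 * r * r\<close> has a
  coordinate of degree at least \<open>2 * r\<close>, so above that degree every cochain is a sum of
  multiples of the \<open>s_j^r\<close>. Up to that degree there are only finitely many cochains,
  since \<open>M\<close> and the set of cells in each degree are finite. The given resolution
  \<open>P\<close> is arbitrary; it is tied to the explicit one by comparison maps in both
  directions.\<close>

locale operator_group = comm_group \<Gamma> for \<Gamma> (structure) +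
  fixes E :: "nat \<Rightarrow> 'a \<Rightarrow> 'a" and r N :: nat
  assumes E_hom: "i < r \<Longrightarrow> E i \<in> hom \<Gamma> \<Gamma>"
    and E_comm: "\<lbrakk>i < r; j < r; x \<in> carrier \<Gamma>\<rbrakk> \<Longrightarrow> E i (E j x) = E j (E i x)"
    and N_pos: "N > 0"
    and torsion: "x \<in> carrier \<Gamma> \<Longrightarrow> x [^] N = \<one>"
begin

text \<open>The submodule generated by \<open>S\<close> over the polynomials in the first
  \<open>s\<close> operators; the bound \<open>s\<close> allows the operators to be adjoined one at
  a time. Inverses come for free: by \<open>torsion\<close> the inverse of \<open>x\<close> is the
  power \<open>x [^] (N - 1)\<close>.\<close>

inductive_set op_closure :: "nat \<Rightarrow> 'a set \<Rightarrow> 'a set" for s and S where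
    one: "\<one> \<in> op_closure s S"
  | incl: "x \<in> S \<Longrightarrow> x \<in> op_closure s S"
  | mult: "\<lbrakk>x \<in> op_closure s S; y \<in> op_closure s S\<rbrakk> \<Longrightarrow> x \<otimes> y \<in> op_closure s S"
  | op: "\<lbrakk>i < s; x \<in> op_closure s S\<rbrakk> \<Longrightarrow> E i x \<in> op_closure s S"

lemma E_closed [intro, simp]: "\<lbrakk>i < r; x \<in> carrier \<Gamma>\<rbrakk> \<Longrightarrow> E i x \<in> carrier \<Gamma>"
  by (rule hom_in_carrier[OF E_hom])

lemma E_mult: "\<lbrakk>i < r; x \<in> carrier \<Gamma>; y \<in> carrier \<Gamma>\<rbrakk> \<Longrightarrow> E i (x \<otimes> y) = E i x \<otimes> E i y"
  by (rule hom_mult[OF E_hom])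

lemma E_one [simp]: "i < r \<Longrightarrow> E i \<one> = \<one>"
  using hom_one[OF E_hom] by (simp add: is_group)

lemma op_closure_carrier:
  assumes "S \<subseteq> carrier \<Gamma>" "s \<le> r" "x \<in> op_closure s S"
  shows "x \<in> carrier \<Gamma>"
  using assms(3) by (induction rule: op_closure.induct) (use assms(1,2) in auto)

lemma inv_eq_pow: "x \<in> carrier \<Gamma> \<Longrightarrow> inv x = x [^] (N - 1)"
proof -
  assume x: "x \<in> carrier \<Gamma>"
  have "x [^] (N - 1) \<otimes> x = x [^] N"
    using N_pos by (metis Suc_diff_1 nat_pow_Suc)
  then show ?thesis using x torsion by (metis inv_equality nat_pow_closed)
qed

text \<open>For \<open>s = 0\<close> these are exactly the subgroups, inverses being powers; for
  larger \<open>s\<close>, the submodules over the first \<open>s\<close> operators.\<close>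

definition op_stable :: "nat \<Rightarrow> 'a set \<Rightarrow> bool" where
  "op_stable s U \<longleftrightarrow> U \<subseteq> carrier \<Gamma> \<and> \<one> \<in> U \<and> (\<forall>x\<in>U. \<forall>y\<in>U. x \<otimes> y \<in> U) \<and> (\<forall>i<s. \<forall>x\<in>U. E i x \<in> U)"

lemma stable_op_closure: "S \<subseteq> carrier \<Gamma> \<Longrightarrow> s \<le> r \<Longrightarrow> op_stable s (op_closure s S)"
  unfolding op_stable_def using op_closure_carrier by (auto intro: op_closure.intros)

lemma op_closure_stable: "op_stable s U \<Longrightarrow> S \<subseteq> U \<Longrightarrow> op_closure s S \<subseteq> U"
proof
  fix x assume U: "op_stable s U" "S \<subseteq> U" and x: "x \<in> op_closure s S"
  show "x \<in> U" using x by induction (use U in \<open>auto simp: op_stable_def\<close>)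
qed

lemma stable_inv: assumes "op_stable s U" "x \<in> U" shows "inv x \<in> U"
proof -
  have "x [^] (n::nat) \<in> U" for n
    using assms by (induction n) (auto simp: op_stable_def)
  then show ?thesis using assms inv_eq_pow by (auto simp: op_stable_def)
qed

text \<open>Sums of terms \<open>(E s ^^ i) x\<close> with \<open>x\<close> in \<open>F\<close> and
  \<open>i < n\<close>. These are elements of the group and not formal polynomials: one element may
  have several such expressions, and membership says that one of them has degree below
  \<open>n\<close>.\<close>

primrec bounded_degree :: "nat \<Rightarrow> 'a set \<Rightarrow> nat \<Rightarrow> 'a set" where
  "bounded_degree s F 0 = {\<one>}"
| "bounded_degree s F (Suc n) = {w \<otimes> (E s ^^ n) x | w x. w \<in> bounded_degree s F n \<and> x \<in> F}"

lemma funpow_closed [simp]: "\<lbrakk>s < r; x \<in> carrier \<Gamma>\<rbrakk> \<Longrightarrow> (E s ^^ n) x \<in> carrier \<Gamma>"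
  by (induction n) auto

lemma funpow_mult: "\<lbrakk>s < r; x \<in> carrier \<Gamma>; y \<in> carrier \<Gamma>\<rbrakk> \<Longrightarrow> (E s ^^ n) (x \<otimes> y) = (E s ^^ n) x \<otimes> (E s ^^ n) y"
  by (induction n) (auto simp: E_mult)

lemma funpow_one: "s < r \<Longrightarrow> (E s ^^ n) \<one> = \<one>"
  by (induction n) auto

lemma funpow_comm: "\<lbrakk>s < r; i < r; x \<in> carrier \<Gamma>\<rbrakk> \<Longrightarrow> E i ((E s ^^ n) x) = (E s ^^ n) (E i x)"
  by (induction n) (auto simp: E_comm[of i s])

context
  fixes s F assumes s: "s < r" and F: "op_stable s F"
begin

lemma F_carrier: "x \<in> F \<Longrightarrow> x \<in> carrier \<Gamma>"
  using F by (auto simp: op_stable_def)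

lemma bounded_degree_carrier: "w \<in> bounded_degree s F n \<Longrightarrow> w \<in> carrier \<Gamma>"
  by (induction n arbitrary: w) (use s F_carrier in auto)

lemma bounded_degree_one: "\<one> \<in> bounded_degree s F n"
proof (induction n)
  case (Suc n)
  have "\<one> = \<one> \<otimes> (E s ^^ n) \<one>" using s by (simp add: funpow_one)
  then show ?case using Suc F by (auto simp: op_stable_def)
qed simp

lemma bounded_degree_mult: "\<lbrakk>v \<in> bounded_degree s F n; w \<in> bounded_degree s F n\<rbrakk> \<Longrightarrow> v \<otimes> w \<in> bounded_degree s F n"
proof (induction n arbitrary: v w)
  case (Suc n)
  then obtain v' x w' y where *: "v = v' \<otimes> (E s ^^ n) x" "w = w' \<otimes> (E s ^^ n) y"
    "v' \<in> bounded_degree s F n" "w' \<in> bounded_degree s F n" "x \<in> F" "y \<in> F" by auto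
  then have "v \<otimes> w = (v' \<otimes> w') \<otimes> (E s ^^ n) (x \<otimes> y)"
    using s by (simp add: funpow_mult bounded_degree_carrier F_carrier m_ac)
  moreover have "v' \<otimes> w' \<in> bounded_degree s F n" "x \<otimes> y \<in> F" using * Suc F by (auto simp: op_stable_def)
  ultimately show ?case by auto
qed simp

lemma bounded_degree_low: "\<lbrakk>i < s; w \<in> bounded_degree s F n\<rbrakk> \<Longrightarrow> E i w \<in> bounded_degree s F n"
proof (induction n arbitrary: w)
  case (Suc n)
  then obtain w' y where *: "w = w' \<otimes> (E s ^^ n) y" "w' \<in> bounded_degree s F n" "y \<in> F" by auto
  then have "E i w = E i w' \<otimes> (E s ^^ n) (E i y)"
    using s Suc by (simp add: E_mult funpow_comm bounded_degree_carrier F_carrier)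
  moreover have "E i w' \<in> bounded_degree s F n" "E i y \<in> F" using * Suc F by (auto simp: op_stable_def)
  ultimately show ?case by auto
qed (use s in auto)

lemma bounded_degree_top: "w \<in> bounded_degree s F n \<Longrightarrow> E s w \<in> bounded_degree s F (Suc n)"
proof (induction n arbitrary: w)
  case 0
  have "\<one> \<in> F" using F by (auto simp: op_stable_def)
  then show ?case using 0 s by auto (metis l_one one_closed)
next
  case (Suc n)
  then obtain w' y where *: "w = w' \<otimes> (E s ^^ n) y" "w' \<in> bounded_degree s F n" "y \<in> F" by auto
  then have "E s w = E s w' \<otimes> (E s ^^ Suc n) y"
    using s Suc by (simp add: E_mult bounded_degree_carrier F_carrier)
  then show ?case using Suc.IH[OF *(2)] *(3) by (subst bounded_degree.simps(2)) blast
qed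

lemma bounded_degree_mono: "w \<in> bounded_degree s F n \<Longrightarrow> w \<in> bounded_degree s F (Suc n)"
proof -
  assume w: "w \<in> bounded_degree s F n"
  have "w = w \<otimes> (E s ^^ n) \<one>" using w s by (simp add: funpow_one bounded_degree_carrier)
  then show ?thesis using w F by (auto simp: op_stable_def)
qed

lemma bounded_degree_le: "w \<in> bounded_degree s F n \<Longrightarrow> n \<le> k \<Longrightarrow> w \<in> bounded_degree s F k"
  using bounded_degree_mono by (induction k rule: nat_induct) (auto simp: le_Suc_eq)

lemma stable_filt: "op_stable (Suc s) (\<Union>n. bounded_degree s F n)"
proof -
  have "x \<otimes> y \<in> (\<Union>n. bounded_degree s F n)" if xy: "x \<in> bounded_degree s F n" "y \<in> bounded_degree s F k" for x y n k
  proof -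
    have "x \<in> bounded_degree s F (max n k)" "y \<in> bounded_degree s F (max n k)" using xy bounded_degree_le by auto
    then show ?thesis using bounded_degree_mult by blast
  qed
  moreover have "E i x \<in> (\<Union>n. bounded_degree s F n)" if "x \<in> bounded_degree s F n" "i < Suc s" for x n i
  proof (cases "i = s")
    case True
    then show ?thesis using bounded_degree_top[OF that(1)] by blast
  next
    case False
    then have "i < s" using that(2) by simp
    then show ?thesis using bounded_degree_low[OF _ that(1)] by blast
  qed
  ultimately show ?thesis
    unfolding op_stable_def using bounded_degree_carrier bounded_degree_one by (auto simp del: bounded_degree.simps)
qed

lemma F_filt: "F \<subseteq> bounded_degree s F 1"
proof
  fix x assume "x \<in> F"
  then show "x \<in> bounded_degree s F 1" using F_carrier by (auto intro!: exI[of _ x])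
qed

text \<open>The coefficients of \<open>E s ^^ n\<close> in those elements of \<open>U\<close> that have degree at most \<open>n\<close> in \<open>E s\<close>.\<close>

definition lead_coeffs :: "'a set \<Rightarrow> nat \<Rightarrow> 'a set" where
  "lead_coeffs U n = {x \<in> F. \<exists>w\<in>bounded_degree s F n. w \<otimes> (E s ^^ n) x \<in> U}"

lemma stable_lead: assumes U: "op_stable (Suc s) U" shows "op_stable s (lead_coeffs U n)"
  unfolding op_stable_def
proof (intro conjI ballI allI impI)
  show "lead_coeffs U n \<subseteq> carrier \<Gamma>" using F_carrier by (auto simp: lead_coeffs_def)
  show "\<one> \<in> lead_coeffs U n"
    using F U bounded_degree_one s by (auto simp: lead_coeffs_def op_stable_def funpow_one intro!: bexI[of _ \<one>])
next
  fix x y assume "x \<in> lead_coeffs U n" "y \<in> lead_coeffs U n"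
  then obtain v w where *: "v \<in> bounded_degree s F n" "w \<in> bounded_degree s F n" "v \<otimes> (E s ^^ n) x \<in> U" "w \<otimes> (E s ^^ n) y \<in> U" "x \<in> F" "y \<in> F"
    by (auto simp: lead_coeffs_def)
  have "(v \<otimes> w) \<otimes> (E s ^^ n) (x \<otimes> y) = (v \<otimes> (E s ^^ n) x) \<otimes> (w \<otimes> (E s ^^ n) y)"
    using * s by (simp add: funpow_mult bounded_degree_carrier F_carrier m_ac)
  also have "\<dots> \<in> U" using * U by (auto simp: op_stable_def)
  finally show "x \<otimes> y \<in> lead_coeffs U n"
    using * F bounded_degree_mult by (auto simp: lead_coeffs_def op_stable_def)
next
  fix i x assume i: "i < s" and "x \<in> lead_coeffs U n"
  then obtain v where *: "v \<in> bounded_degree s F n" "v \<otimes> (E s ^^ n) x \<in> U" "x \<in> F" by (auto simp: lead_coeffs_def)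
  have "E i v \<otimes> (E s ^^ n) (E i x) = E i (v \<otimes> (E s ^^ n) x)"
    using * i s by (simp add: E_mult funpow_comm bounded_degree_carrier F_carrier)
  also have "\<dots> \<in> U" using * i U by (auto simp: op_stable_def)
  finally show "E i x \<in> lead_coeffs U n"
    using * F i bounded_degree_low by (auto simp: lead_coeffs_def op_stable_def)
qed

text \<open>Applying \<open>E s\<close> to a witness raises its degree and keeps its leading
  coefficient.\<close>

lemma lead_coeffs_mono: assumes U: "op_stable (Suc s) U" shows "lead_coeffs U n \<subseteq> lead_coeffs U (Suc n)"
proof
  fix x assume "x \<in> lead_coeffs U n"
  then obtain v where *: "v \<in> bounded_degree s F n" "v \<otimes> (E s ^^ n) x \<in> U" "x \<in> F" by (auto simp: lead_coeffs_def)
  have "E s v \<otimes> (E s ^^ Suc n) x = E s (v \<otimes> (E s ^^ n) x)"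
    using * s by (simp add: E_mult bounded_degree_carrier F_carrier)
  also have "\<dots> \<in> U" using * U by (auto simp: op_stable_def)
  finally show "x \<in> lead_coeffs U (Suc n)"
    unfolding lead_coeffs_def using *(3) bounded_degree_top[OF *(1)] by blast
qed

lemma lead_coeffs_le: "op_stable (Suc s) U \<Longrightarrow> n \<le> k \<Longrightarrow> lead_coeffs U n \<subseteq> lead_coeffs U k"
  using lead_coeffs_mono lift_Suc_mono_le[of "lead_coeffs U"] by blast

text \<open>The leading coefficients form an ascending chain of submodules for the first
  \<open>s\<close> operators, so \<open>IH\<close> makes their union finitely generated and the
  chain stationary. Lifts of generators of its members up to that stage generate \<open>U\<close>:
  subtracting a combination of lifts with the same leading coefficient lowers the degree.\<close>

lemma hilbert_step:
  assumes IH: "\<And>U. op_stable s U \<Longrightarrow> U \<subseteq> F \<Longrightarrow> \<exists>S. finite S \<and> S \<subseteq> U \<and> U \<subseteq> op_closure s S"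
    and U: "op_stable (Suc s) U" "U \<subseteq> (\<Union>n. bounded_degree s F n)"
  shows "\<exists>S. finite S \<and> S \<subseteq> U \<and> U \<subseteq> op_closure (Suc s) S"
proof -
  have L: "op_stable s (lead_coeffs U n)" for n by (rule stable_lead[OF U(1)])
  have st: "op_stable s (\<Union>n. lead_coeffs U n)"
    unfolding op_stable_def
  proof (intro conjI ballI allI impI)
    show "(\<Union>n. lead_coeffs U n) \<subseteq> carrier \<Gamma>" using L by (simp add: op_stable_def UN_subset_iff)
    show "\<one> \<in> (\<Union>n. lead_coeffs U n)" using L[of 0] by (auto simp add: op_stable_def)
  next
    fix x y assume "x \<in> (\<Union>n. lead_coeffs U n)" "y \<in> (\<Union>n. lead_coeffs U n)"
    then obtain n k where "x \<in> lead_coeffs U n" "y \<in> lead_coeffs U k" by blast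
    then have "x \<in> lead_coeffs U (max n k)" "y \<in> lead_coeffs U (max n k)"
      using lead_coeffs_le[OF U(1), of n "max n k"] lead_coeffs_le[OF U(1), of k "max n k"] by auto
    then have "x \<otimes> y \<in> lead_coeffs U (max n k)" using L[of "max n k"] by (simp add: op_stable_def)
    then show "x \<otimes> y \<in> (\<Union>n. lead_coeffs U n)" by (rule UN_I[OF UNIV_I])
  next
    fix i x assume i: "i < s" "x \<in> (\<Union>n. lead_coeffs U n)"
    then obtain n where "x \<in> lead_coeffs U n" by blast
    then have "E i x \<in> lead_coeffs U n" using i(1) L[of n] by (simp add: op_stable_def)
    then show "E i x \<in> (\<Union>n. lead_coeffs U n)" by (rule UN_I[OF UNIV_I])
  qed
  have "(\<Union>n. lead_coeffs U n) \<subseteq> F" by (auto simp: lead_coeffs_def)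
  from IH[OF st this] obtain S0 where S0: "finite S0" "S0 \<subseteq> (\<Union>n. lead_coeffs U n)" "(\<Union>n. lead_coeffs U n) \<subseteq> op_closure s S0"
    by blast
  \<comment> \<open>Each of the finitely many generators of the union occurs at some stage, and the
    stages ascend, so one stage contains them all.\<close>
  have "\<exists>M. S0 \<subseteq> lead_coeffs U M"
    using S0(1,2)
  proof (induction S0)
    case (insert x T)
    then obtain M k where "T \<subseteq> lead_coeffs U M" "x \<in> lead_coeffs U k" by auto
    then have "insert x T \<subseteq> lead_coeffs U (max M k)"
      using lead_coeffs_le[OF U(1), of M "max M k"] lead_coeffs_le[OF U(1), of k "max M k"] by auto
    then show ?case by blast
  qed simp
  then obtain M where "S0 \<subseteq> lead_coeffs U M" by blast
  then have M: "lead_coeffs U n \<subseteq> lead_coeffs U M" for n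
    using S0(3) op_closure_stable[OF stable_lead[OF U(1)]] by blast
  have "\<forall>n. \<exists>S. finite S \<and> S \<subseteq> lead_coeffs U n \<and> lead_coeffs U n \<subseteq> op_closure s S"
    by (intro allI IH stable_lead[OF U(1)]) (auto simp: lead_coeffs_def)
  from choice[OF this] obtain T where T: "\<And>n. finite (T n)" "\<And>n. T n \<subseteq> lead_coeffs U n" "\<And>n. lead_coeffs U n \<subseteq> op_closure s (T n)"
    by blast
  have "\<forall>n. \<forall>x\<in>T n. \<exists>w. w \<in> bounded_degree s F n \<and> w \<otimes> (E s ^^ n) x \<in> U"
    using T(2) by (auto simp: lead_coeffs_def)
  then obtain w where w: "\<And>n x. x \<in> T n \<Longrightarrow> w n x \<in> bounded_degree s F n \<and> w n x \<otimes> (E s ^^ n) x \<in> U"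
    by metis
  define S where "S = (\<Union>n\<le>M. (\<lambda>x. w n x \<otimes> (E s ^^ n) x) ` T n)"
  have S: "finite S" "S \<subseteq> U" using T(1) w by (auto simp: S_def)
  \<comment> \<open>Beyond \<open>M\<close> no new leading coefficients occur, so the generators at
    stage \<open>min n M\<close> serve for degree \<open>n\<close>: a lift at the lower stage is
    moved up by \<open>n - min n M\<close> applications of \<open>E s\<close>.\<close>
  have lift: "\<exists>v. v \<in> op_closure (Suc s) S \<and> (\<exists>w\<in>bounded_degree s F n. v = w \<otimes> (E s ^^ n) x)"
    if x: "x \<in> op_closure s (T (min n M))" for n x
    using x
  proof induction
    case one
    then show ?case using s bounded_degree_one by (auto intro!: exI[of _ \<one>] bexI[of _ \<one>] op_closure.one simp: funpow_one)
  next
    case (incl x)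
    define k where "k = min n M"
    have kn: "k \<le> n" by (simp add: k_def)
    have x: "x \<in> T k" using incl by (simp add: k_def)
    then have xF: "x \<in> F" using T(2) by (auto simp: lead_coeffs_def)
    have *: "w k x \<otimes> (E s ^^ k) x \<in> op_closure (Suc s) S"
    proof (rule op_closure.incl)
      have "k \<le> M" by (simp add: k_def)
      then show "w k x \<otimes> (E s ^^ k) x \<in> S" unfolding S_def using x by blast
    qed
    have "\<exists>v. v \<in> op_closure (Suc s) S \<and> (\<exists>w\<in>bounded_degree s F (k + i). v = w \<otimes> (E s ^^ (k + i)) x)" for i
    proof (induction i)
      case 0
      then show ?case using * w x by auto
    next
      case (Suc i)
      then obtain u where u: "u \<in> bounded_degree s F (k + i)" "u \<otimes> (E s ^^ (k + i)) x \<in> op_closure (Suc s) S" by blast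
      have "E s (u \<otimes> (E s ^^ (k + i)) x) = E s u \<otimes> (E s ^^ (k + Suc i)) x"
        using u s xF by (simp add: E_mult bounded_degree_carrier F_carrier)
      moreover have "E s (u \<otimes> (E s ^^ (k + i)) x) \<in> op_closure (Suc s) S"
        using u by (auto intro: op_closure.op)
      moreover have "E s u \<in> bounded_degree s F (k + Suc i)" using bounded_degree_top[OF u(1)] by simp
      ultimately show ?case by blast
    qed
    from this[of "n - k"] show ?case using kn by simp
  next
    case (mult x y)
    then obtain a b where *: "a \<in> bounded_degree s F n" "b \<in> bounded_degree s F n"
      "a \<otimes> (E s ^^ n) x \<in> op_closure (Suc s) S" "b \<otimes> (E s ^^ n) y \<in> op_closure (Suc s) S" by blast
    have "T (min n M) \<subseteq> carrier \<Gamma>" using T(2) F_carrier by (auto simp: lead_coeffs_def)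
    then have "x \<in> carrier \<Gamma>" "y \<in> carrier \<Gamma>"
      using op_closure_carrier[OF _ less_imp_le[OF s]] mult.hyps by blast+
    then have "(a \<otimes> b) \<otimes> (E s ^^ n) (x \<otimes> y) = (a \<otimes> (E s ^^ n) x) \<otimes> (b \<otimes> (E s ^^ n) y)"
      using * s by (simp add: funpow_mult bounded_degree_carrier m_ac)
    moreover have "(a \<otimes> (E s ^^ n) x) \<otimes> (b \<otimes> (E s ^^ n) y) \<in> op_closure (Suc s) S"
      using *(3,4) by (rule op_closure.mult)
    ultimately show ?case using bounded_degree_mult[OF *(1,2)] by metis
  next
    case (op i x)
    then obtain a where *: "a \<in> bounded_degree s F n" "a \<otimes> (E s ^^ n) x \<in> op_closure (Suc s) S" by blast
    have "T (min n M) \<subseteq> carrier \<Gamma>" using T(2) F_carrier by (auto simp: lead_coeffs_def)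
    then have "x \<in> carrier \<Gamma>"
      using op_closure_carrier[OF _ less_imp_le[OF s]] op.hyps by blast
    then have "E i a \<otimes> (E s ^^ n) (E i x) = E i (a \<otimes> (E s ^^ n) x)"
      using * s op by (simp add: E_mult funpow_comm bounded_degree_carrier)
    moreover have "E i (a \<otimes> (E s ^^ n) x) \<in> op_closure (Suc s) S"
      using *(2) op by (intro op_closure.op) auto
    ultimately show ?case using bounded_degree_low[OF op(1) *(1)] by metis
  qed
  have fin: "u \<in> op_closure (Suc s) S" if "u \<in> U" "u \<in> bounded_degree s F n" for u n
    using that
  proof (induction n arbitrary: u)
    case 0
    then show ?case by (auto intro: op_closure.one)
  next
    case (Suc n)
    then obtain a x where ax: "u = a \<otimes> (E s ^^ n) x" "a \<in> bounded_degree s F n" "x \<in> F" by auto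
    then have "x \<in> lead_coeffs U n" using Suc by (auto simp: lead_coeffs_def)
    then have "x \<in> lead_coeffs U (min n M)" using M[of n] by (auto simp: min_def)
    then obtain b where b: "b \<in> bounded_degree s F n" "b \<otimes> (E s ^^ n) x \<in> op_closure (Suc s) S"
      using lift T(3) by blast
    let ?v = "b \<otimes> (E s ^^ n) x"
    have vU: "?v \<in> U" using b(2) op_closure_stable[OF U(1) S(2)] by blast
    have nb: "inv b \<in> bounded_degree s F n"
    proof -
      have "op_stable 0 (bounded_degree s F n)" using bounded_degree_carrier bounded_degree_one bounded_degree_mult by (auto simp: op_stable_def)
      then show ?thesis using stable_inv b(1) by blast
    qed
    have car: "a \<in> carrier \<Gamma>" "b \<in> carrier \<Gamma>" "(E s ^^ n) x \<in> carrier \<Gamma>"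
      using ax b(1) s by (auto simp: bounded_degree_carrier F_carrier)
    \<comment> \<open>\<open>u\<close> and \<open>?v\<close> share the leading term
      \<open>(E s ^^ n) x\<close>, so their quotient has an expression of degree below
      \<open>n\<close>.\<close>
    have "u \<otimes> inv ?v = (a \<otimes> (E s ^^ n) x) \<otimes> (inv ((E s ^^ n) x) \<otimes> inv b)"
      using car by (simp add: ax(1) inv_mult_group)
    also have "\<dots> = a \<otimes> (((E s ^^ n) x \<otimes> inv ((E s ^^ n) x)) \<otimes> inv b)"
      using car by (simp only: m_assoc inv_closed m_closed)
    also have "\<dots> = a \<otimes> inv b" using car by simp
    finally have eq: "u \<otimes> inv ?v = a \<otimes> inv b" .
    have "u \<otimes> inv ?v \<in> U" using Suc.prems vU U(1) stable_inv by (auto simp: op_stable_def)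
    moreover have "a \<otimes> inv b \<in> bounded_degree s F n" using ax nb bounded_degree_mult by blast
    ultimately have "u \<otimes> inv ?v \<in> op_closure (Suc s) S" using Suc.IH eq by simp
    then have "(u \<otimes> inv ?v) \<otimes> ?v \<in> op_closure (Suc s) S" using b(2) by (rule op_closure.mult)
    moreover have "(u \<otimes> inv ?v) \<otimes> ?v = u"
      using Suc.prems vU U(1) by (auto simp: op_stable_def m_assoc subset_iff)
    ultimately show ?case by simp
  qed
  have "U \<subseteq> op_closure (Suc s) S"
  proof
    fix u assume u: "u \<in> U"
    then obtain n where "u \<in> bounded_degree s F n" using U(2) by blast
    then show "u \<in> op_closure (Suc s) S" by (rule fin[OF u])
  qed
  then show ?thesis using S by (intro exI[of _ S]) simp
qed

end

text \<open>Induction on the number of operators, starting from the finite group \<open>W\<close>,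
  all of whose subgroups are finite. A step takes the closure of \<open>W\<close> under
  \<open>s\<close> operators as the coefficient module \<open>F\<close> and adjoins
  \<open>E s\<close>; the closure under one more operator consists of polynomials in
  \<open>E s\<close> over \<open>F\<close>.\<close>

theorem hilbert_basis:
  assumes W: "finite W" "op_stable 0 W" and s: "s \<le> r"
    and U: "op_stable s U" "U \<subseteq> op_closure s W"
  shows "\<exists>S. finite S \<and> S \<subseteq> U \<and> U \<subseteq> op_closure s S"
  using s U
proof (induction s arbitrary: U)
  case 0
  have "op_closure 0 W \<subseteq> W" using op_closure_stable[OF W(2)] by simp
  then have "finite U" using 0 W(1) by (meson finite_subset)
  then show ?case by (auto intro!: exI[of _ U] op_closure.incl)
next
  case (Suc s)
  define F where "F = op_closure s W"
  have s: "s < r" using Suc by simp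
  have F: "op_stable s F" unfolding F_def using stable_op_closure W Suc by (simp add: op_stable_def)
  have WF: "W \<subseteq> F" by (auto simp: F_def intro: op_closure.incl)
  have "U \<subseteq> (\<Union>n. bounded_degree s F n)"
    using Suc.prems(3) op_closure_stable[OF stable_filt[OF s F], of W] F_filt[OF s F] WF by blast
  from hilbert_step[OF s F _ Suc.prems(2) this] show ?case
    using Suc by (simp add: F_def)
qed

end

section \<open>Tensor products of periodic resolutions of cyclic groups\<close>

text \<open>The arguments are the multidegree and the positions of a cell. Coefficients are integers
  and chains are total functions, so that sign identities hold exactly; reduction modulo
  \<open>p\<close> and restriction to the cells of one degree are imposed later by
  \<open>eqv\<close>.\<close>

type_synonym chain = "(nat \<Rightarrow> nat) \<Rightarrow> (nat \<Rightarrow> nat) \<Rightarrow> int"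

locale cyclic_complex =
  fixes r :: nat and q :: "nat \<Rightarrow> nat"
  assumes q_pos: "q j > 0"
begin

text \<open>Koszul sign of differentiating at coordinate \<open>j\<close>: one factor for each other coordinate of odd degree.\<close>

definition ksign :: "(nat \<Rightarrow> nat) \<Rightarrow> nat \<Rightarrow> int" where
  "ksign m j = (\<Prod>i\<in>{i. i < r \<and> odd (m i)} - {j}. sgn (int j - int i))"

text \<open>
  Coordinate \<open>j\<close> of a cell \<open>(m, c)\<close> is the basis element \<open>c j\<close> in degree \<open>m j\<close> of the periodic
  resolution of a cyclic group of order \<open>q j\<close>; \<open>pdiff j\<close> is its differential, acting on
  coefficient functions, and \<open>phtp j\<close> is a contracting homotopy.
\<close>

definition pdiff :: "nat \<Rightarrow> chain \<Rightarrow> chain" where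
  "pdiff j f m c = (if even (m j)
     then f (m(j := Suc (m j))) (c(j := Suc (c j) mod q j)) - f (m(j := Suc (m j))) c
     else (\<Sum>t<q j. f (m(j := Suc (m j))) (c(j := t))))"

definition phtp :: "nat \<Rightarrow> chain \<Rightarrow> chain" where
  "phtp j f m c = (if m j = 0 then 0
     else if odd (m j) then (\<Sum>t<c j. f (m(j := m j - 1)) (c(j := t)))
     else if c j = q j - 1 then f (m(j := m j - 1)) (c(j := 0)) else 0)"

text \<open>The augmentation of factor \<open>j\<close> followed by the inclusion of the position
  \<open>q j - 1\<close> in degree 0. This position is dictated by \<open>phtp\<close>: its defect
  shows where the cyclic difference wraps around.\<close>

definition pproj :: "nat \<Rightarrow> chain \<Rightarrow> chain" where
  "pproj j f m c = (if m j = 0 \<and> c j = q j - 1 then \<Sum>t<q j. f m (c(j := t)) else 0)"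

definition diff :: "chain \<Rightarrow> chain" where
  "diff f m c = (\<Sum>j<r. ksign m j * pdiff j f m c)"

definition htp :: "nat \<Rightarrow> chain \<Rightarrow> chain" where
  "htp j f m c = ksign m j * phtp j f m c"

lemma ksign_same: "ksign (m(j := k)) j = ksign m j"
  unfolding ksign_def by (rule prod.cong) auto

lemma ksign_toggle:
  assumes "i \<noteq> j" "i < r" "even k \<noteq> even (m i)"
  shows "ksign (m(i := k)) j = ksign m j * sgn (int j - int i)"
proof -
  define A where "A = {l. l < r \<and> odd (m l)} - {i, j}"
  have A: "finite A" "i \<notin> A" by (auto simp: A_def)
  have sq: "sgn (int j - int i) * sgn (int j - int i) = 1" using assms(1) by (auto simp: sgn_if)
  show ?thesis
  proof (cases "odd (m i)")
    case True
    have "{l. l < r \<and> odd ((m(i := k)) l)} - {j} = A" "{l. l < r \<and> odd (m l)} - {j} = insert i A"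
      using True assms by (auto simp: A_def)
    then show ?thesis unfolding ksign_def using A sq by (simp add: mult.commute mult.left_commute)
  next
    case False
    have "{l. l < r \<and> odd ((m(i := k)) l)} - {j} = insert i A" "{l. l < r \<and> odd (m l)} - {j} = A"
      using False assms by (auto simp: A_def)
    then show ?thesis unfolding ksign_def using A by (simp add: mult.commute)
  qed
qed

lemma ksign_sq: "ksign m j * ksign m j = 1"
proof -
  have "ksign m j * ksign m j = (\<Prod>i\<in>{i. i < r \<and> odd (m i)} - {j}. sgn (int j - int i) * sgn (int j - int i))"
    by (simp add: ksign_def flip: prod.distrib)
  also have "\<dots> = 1" by (rule prod.neutral) (auto simp: sgn_if)
  finally show ?thesis .
qed

text \<open>Changing the parity of one coordinate multiplies the sign at the other by
  \<open>sgn (int j - int i)\<close> or by its negative, according to which of the two is changed.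
  This asymmetry makes differentials in different directions anticommute.\<close>

lemma ksign_anti:
  assumes "i \<noteq> j" "i < r" "j < r" "even k \<noteq> even (m i)" "even l \<noteq> even (m j)"
  shows "ksign m i * ksign (m(i := k)) j = - (ksign m j * ksign (m(j := l)) i)"
  using assms by (simp add: ksign_toggle sgn_if)

text \<open>The maps of the periodic resolution alternate between the cyclic difference and the
  norm. The norm is invariant under rotation, so both composites vanish.\<close>

lemma pdiff_pdiff_same: "c j < q j \<Longrightarrow> pdiff j (pdiff j f) m c = 0"
proof -
  assume c: "c j < q j"
  show ?thesis
  proof (cases "even (m j)")
    case True
    then show ?thesis by (simp add: pdiff_def)
  next
    case False
    have "(\<Sum>t<q j. g (Suc t mod q j)) = (\<Sum>t<q j. g t)" for g :: "nat \<Rightarrow> int"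
    proof -
      obtain n where n: "q j = Suc n" using q_pos[of j] gr0_implies_Suc by blast
      have "(\<Sum>t<Suc n. g (Suc t mod Suc n)) = (\<Sum>t<n. g (Suc t)) + g 0" by simp
      also have "\<dots> = (\<Sum>t<Suc n. g t)" by (simp only: sum.lessThan_Suc_shift)
      finally show ?thesis by (simp only: n)
    qed
    from this[of "\<lambda>t. f (m(j := Suc (Suc (m j)))) (c(j := t))"] False
    show ?thesis by (simp add: pdiff_def sum_subtractf)
  qed
qed

lemma pdiff_comm: "i \<noteq> j \<Longrightarrow> pdiff i (pdiff j f) m c = pdiff j (pdiff i f) m c"
  by (auto simp: pdiff_def fun_upd_twist[of i j] sum_subtractf intro: sum.swap)

lemma pdiff_sum: "pdiff i (\<lambda>m c. \<Sum>j\<in>A. f j m c) m c = (\<Sum>j\<in>A. pdiff i (f j) m c)"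
  by (auto simp: pdiff_def sum_subtractf intro: sum.swap)

text \<open>The terms \<open>W i j\<close> are antisymmetric in the two directions, so the double
  sum is its own negative; an integer with that property is 0, and the case \<open>p = 2\<close> is
  not special.\<close>

lemma diff_diff:
  assumes c: "\<And>j. j < r \<Longrightarrow> c j < q j"
  shows "diff (diff f) m c = 0"
proof -
  define W where "W i j = ksign m i * (ksign (m(i := Suc (m i))) j * pdiff i (pdiff j f) m c)" for i j
  have "diff (diff f) m c = (\<Sum>i<r. ksign m i * (\<Sum>j<r. pdiff i (\<lambda>m c. ksign m j * pdiff j f m c) m c))"
    by (simp add: diff_def[abs_def] pdiff_sum)
  also have "\<dots> = (\<Sum>i<r. \<Sum>j<r. W i j)"
    unfolding sum_distrib_left W_def
    by (intro sum.cong refl arg_cong2[where f = times]) (simp add: pdiff_def right_diff_distrib sum_distrib_left)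
  finally have 1: "diff (diff f) m c = (\<Sum>i<r. \<Sum>j<r. W i j)" .
  have anti: "W i j = - W j i" if "i < r" "j < r" for i j
  proof (cases "i = j")
    case True
    then show ?thesis using c[OF that(1)] by (simp add: W_def pdiff_pdiff_same)
  next
    case False
    then show ?thesis
      using ksign_anti[OF False that, of "Suc (m i)" m "Suc (m j)"] pdiff_comm[OF False, of f m c]
      by (simp add: W_def flip: mult.assoc)
  qed
  have "(\<Sum>i<r. \<Sum>j<r. W i j) = (\<Sum>i<r. \<Sum>j<r. - W j i)"
    by (intro sum.cong refl anti) auto
  also have "\<dots> = - (\<Sum>i<r. \<Sum>j<r. W i j)" by (subst sum.swap) (simp add: sum_negf)
  finally show ?thesis using 1 by simp
qed

text \<open>In odd degree the partial sums of differences telescope down to position 0. In even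
  degree \<open>pdiff j (phtp j f)\<close> is correct except at the last position, where the
  wrap-around produces the total sum; \<open>phtp j (pdiff j f)\<close> compensates for it, except
  in degree 0, where it stays as \<open>pproj\<close>.\<close>

lemma phtp_pdiff_same:
  assumes "c j < q j"
  shows "pdiff j (phtp j f) m c + phtp j (pdiff j f) m c = f m c - pproj j f m c"
proof -
  obtain n where n: "q j = Suc n" using q_pos[of j] gr0_implies_Suc by blast
  have last: "(\<Sum>t<Suc n. g t) = (\<Sum>t<n. g t) + g n" for g :: "nat \<Rightarrow> int" by simp
  show ?thesis
  proof (cases "odd (m j)")
    case True
    then have m: "m j > 0" "even (m j - 1)" "Suc (m j - 1) = m j" by (auto elim: oddE)
    have 1: "pdiff j (phtp j f) m c = f m (c(j := 0))"
    proof -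
      have "pdiff j (phtp j f) m c = (\<Sum>t<q j. if t = q j - 1 then f m (c(j := 0)) else 0)"
        using True by (simp add: pdiff_def phtp_def)
      then show ?thesis using q_pos[of j] by simp
    qed
    have "phtp j (pdiff j f) m c = (\<Sum>t<c j. f m (c(j := Suc t mod q j)) - f m (c(j := t)))"
    proof -
      obtain k where "m j = Suc k" "even k" using True by (auto elim: oddE)
      moreover from this have "m(j := Suc k) = m" by auto
      ultimately show ?thesis by (simp add: pdiff_def phtp_def)
    qed
    also have "\<dots> = (\<Sum>t<c j. f m (c(j := Suc t)) - f m (c(j := t)))"
      by (rule sum.cong) (use assms in auto)
    also have "\<dots> = f m c - f m (c(j := 0))"
      by (simp add: sum_lessThan_telescope[of "\<lambda>t. f m (c(j := t))"])
    finally show ?thesis using 1 m(1) by (simp add: pproj_def)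
  next
    case False
    have 1: "pdiff j (phtp j f) m c = f m c - (if c j = q j - 1 then \<Sum>t<q j. f m (c(j := t)) else 0)"
    proof (cases "c j = n")
      case True
      then have "c = c(j := n)" by auto
      then show ?thesis using False n True last[of "\<lambda>t. f m (c(j := t))"]
        by (simp add: pdiff_def phtp_def)
    next
      case False
      then have "Suc (c j) mod q j = Suc (c j)" using assms n by simp
      then show ?thesis using False \<open>\<not> odd (m j)\<close> n by (simp add: pdiff_def phtp_def)
    qed
    have 2: "phtp j (pdiff j f) m c = (if m j \<noteq> 0 \<and> c j = q j - 1 then \<Sum>t<q j. f m (c(j := t)) else 0)"
    proof (cases "m j = 0")
      case True
      then show ?thesis by (simp add: phtp_def)
    next
      case m: False
      then have "odd (m j - 1)" "Suc (m j - 1) = m j" using False by auto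
      then show ?thesis using False m by (simp add: pdiff_def phtp_def)
    qed
    show ?thesis unfolding 1 2 by (simp add: pproj_def)
  qed
qed

lemma phtp_pdiff_comm: "i \<noteq> j \<Longrightarrow> pdiff i (phtp j f) m c = phtp j (pdiff i f) m c"
  by (auto simp: pdiff_def phtp_def fun_upd_twist[of i j] sum_subtractf intro: sum.swap)

lemma phtp_ksign:
  "m j \<noteq> 0 \<Longrightarrow> phtp j (\<lambda>m c. ksign m i * f m c) m c = ksign (m(j := m j - 1)) i * phtp j f m c"
  by (simp add: phtp_def sum_distrib_left)

lemma phtp_sum: "phtp j (\<lambda>m c. \<Sum>i\<in>A. f i m c) m c = (\<Sum>i\<in>A. phtp j (f i) m c)"
  by (auto simp: phtp_def intro: sum.swap)

text \<open>In direction \<open>j\<close> the homotopy of one factor applies and the signs square to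
  1. In every other direction the two terms cancel by \<open>ksign_anti\<close>.\<close>

lemma htp_diff:
  assumes c: "\<And>j. j < r \<Longrightarrow> c j < q j" and j: "j < r"
  shows "diff (htp j f) m c + htp j (diff f) m c = f m c - pproj j f m c"
proof -
  have pk: "pdiff i (\<lambda>m c. ksign m j * g m c) m c = ksign (m(i := Suc (m i))) j * pdiff i g m c" for i g
    by (simp add: pdiff_def right_diff_distrib sum_distrib_left)
  have 1: "diff (htp j f) m c = (\<Sum>i<r. ksign m i * (ksign (m(i := Suc (m i))) j * pdiff i (phtp j f) m c))"
    by (simp add: diff_def htp_def[abs_def] pk)
  have 2: "htp j (diff f) m c = (\<Sum>i<r. ksign m j * phtp j (\<lambda>m c. ksign m i * pdiff i f m c) m c)"
    by (simp add: htp_def diff_def[abs_def] phtp_sum sum_distrib_left)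
  have "ksign m i * (ksign (m(i := Suc (m i))) j * pdiff i (phtp j f) m c)
      + ksign m j * phtp j (\<lambda>m c. ksign m i * pdiff i f m c) m c
      = (if i = j then f m c - pproj j f m c else 0)" if i: "i < r" for i
  proof (cases "i = j")
    case True
    have "phtp j (\<lambda>m c. ksign m j * pdiff j f m c) m c = ksign m j * phtp j (pdiff j f) m c"
      by (cases "m j = 0") (simp_all add: phtp_ksign ksign_same, simp add: phtp_def)
    then show ?thesis
      using True ksign_sq[of m j] phtp_pdiff_same[of c j f m] c[OF j]
      by (simp add: ksign_same flip: mult.assoc)
  next
    case False
    show ?thesis
    proof (cases "m j = 0")
      case True
      then have "phtp j g m c = 0" for g by (simp add: phtp_def)
      then show ?thesis using False by (simp add: phtp_pdiff_comm)
    next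
      case m: False
      have "ksign m i * ksign (m(i := Suc (m i))) j = - (ksign m j * ksign (m(j := m j - 1)) i)"
        by (rule ksign_anti) (use False i j m in auto)
      then show ?thesis using False m by (simp add: phtp_ksign phtp_pdiff_comm flip: mult.assoc)
    qed
  qed
  then have "diff (htp j f) m c + htp j (diff f) m c = (\<Sum>i<r. if i = j then f m c - pproj j f m c else 0)"
    unfolding 1 2 by (simp add: sum.distrib[symmetric])
  then show ?thesis using j by simp
qed

end

section \<open>The action on cosets of cyclic subgroups\<close>

context group
begin

text \<open>The left coset of the subgroup generated by \<open>h\<close>: in a finite group natural
  exponents reach the whole subgroup. Left cosets are the ones permuted by left translation.\<close>

definition pow_coset :: "'a \<Rightarrow> 'a \<Rightarrow> 'a set" where
  "pow_coset h x = range (\<lambda>i::nat. x \<otimes> h [^] i)"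

lemma pow_coset_self: "h \<in> carrier G \<Longrightarrow> x \<in> carrier G \<Longrightarrow> x \<in> pow_coset h x"
  unfolding pow_coset_def by (rule image_eqI[of _ _ 0]) auto

lemma pow_coset_carrier: "h \<in> carrier G \<Longrightarrow> x \<in> carrier G \<Longrightarrow> pow_coset h x \<subseteq> carrier G"
  by (auto simp: pow_coset_def)

lemma pow_coset_subset:
  assumes "h \<in> carrier G" "x \<in> carrier G" "y \<in> pow_coset h x"
  shows "pow_coset h y \<subseteq> pow_coset h x"
  using assms by (auto simp: pow_coset_def m_assoc nat_pow_mult)

lemma pow_coset_eq:
  assumes "finite (carrier G)" "h \<in> carrier G" "x \<in> carrier G" "y \<in> pow_coset h x"
  shows "pow_coset h y = pow_coset h x"
proof -
  obtain i :: nat where i: "y = x \<otimes> h [^] i" using assms(4) by (auto simp: pow_coset_def)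
  have o: "ord h \<ge> 1" by (rule ord_ge_1[OF assms(1,2)])
  \<comment> \<open>The exponent \<open>(ord h - 1) * i\<close> serves as that of the inverse of
    \<open>h [^] i\<close>.\<close>
  have "i + (ord h - 1) * i = ord h * i" using o by (cases "ord h") auto
  then have "h [^] (i + (ord h - 1) * i) = \<one>" using assms(2) by (simp add: pow_eq_id)
  then have "x = y \<otimes> h [^] ((ord h - 1) * i)"
    using assms i by (simp add: m_assoc nat_pow_mult)
  then have "x \<in> pow_coset h y" by (auto simp: pow_coset_def)
  then show ?thesis
    using pow_coset_subset[of h x y] pow_coset_subset[of h y x] assms pow_coset_carrier by blast
qed

lemma pow_coset_translate:
  "\<lbrakk>g \<in> carrier G; h \<in> carrier G; x \<in> carrier G\<rbrakk> \<Longrightarrow> (\<lambda>y. g \<otimes> y) ` pow_coset h x = pow_coset h (g \<otimes> x)"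
  by (auto simp: pow_coset_def image_image m_assoc)

lemma pow_eq_cong:
  fixes a b :: nat
  assumes "h \<in> carrier G" "h [^] a = h [^] b" shows "[a = b] (mod ord h)"
proof -
  have "h [^] int a = h [^] int b" using assms by (simp add: int_pow_int)
  then have "int (ord h) dvd int b - int a" using assms(1) by (simp add: int_pow_eq)
  then have "[int b = int a] (mod int (ord h))" by (simp add: cong_iff_dvd_diff)
  then show ?thesis by (simp add: cong_int_iff cong_sym_eq)
qed

text \<open>
  The indices enumerate the cosets of all cyclic subgroups. With representatives \<open>x\<close> of the cosets of
  \<open>\<langle>h\<rangle>\<close>, the numbers \<open>\<alpha>\<close> are defined by \<open>g x = x' h\<^sup>\<alpha>\<close>. An element \<open>g \<noteq> 1\<close> fixes the coset \<open>\<langle>g\<rangle>\<close> and acts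
  on it as a non-trivial translation.
\<close>

lemma cyclic_coset_data:
  assumes fin: "finite (carrier G)"
  obtains r :: nat and q :: "nat \<Rightarrow> nat" and \<pi> \<alpha> :: "'a \<Rightarrow> nat \<Rightarrow> nat"
  where "\<And>j. q j > 0"
    and "\<And>g j. g \<in> carrier G \<Longrightarrow> j < r \<Longrightarrow> \<pi> g j < r"
    and "\<And>g j. g \<in> carrier G \<Longrightarrow> \<not> j < r \<Longrightarrow> \<pi> g j = j"
    and "\<And>g h j. g \<in> carrier G \<Longrightarrow> h \<in> carrier G \<Longrightarrow> \<pi> (g \<otimes> h) j = \<pi> g (\<pi> h j)"
    and "\<And>j. \<pi> \<one> j = j"
    and "\<And>g j. g \<in> carrier G \<Longrightarrow> q (\<pi> g j) = q j"
    and "\<And>g h j. g \<in> carrier G \<Longrightarrow> h \<in> carrier G \<Longrightarrow> j < r \<Longrightarrow> [\<alpha> (g \<otimes> h) j = \<alpha> g (\<pi> h j) + \<alpha> h j] (mod q j)"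
    and "\<And>g. g \<in> carrier G \<Longrightarrow> g \<noteq> \<one> \<Longrightarrow> \<exists>j<r. \<pi> g j = j \<and> \<not> q j dvd \<alpha> g j"
proof -
  \<comment> \<open>The generator \<open>h\<close> is kept beside its coset, because exponents are
    taken with respect to it; one coset with two different generators gives two indices.\<close>
  define I where "I = (\<lambda>(h, x). (h, pow_coset h x)) ` (carrier G \<times> carrier G)"
  have "finite I" using fin by (simp add: I_def)
  then obtain e where e: "bij_betw e {0..<card I} I" using ex_bij_betw_nat_finite by blast
  define r where "r = card I"
  have e: "bij_betw e {..<r} I" using e by (simp add: r_def atLeast0LessThan)
  define e' where "e' = inv_into {..<r} e"
  have e': "e' i < r" "e (e' i) = i" if "i \<in> I" for i
    using that e unfolding e'_def by (metis bij_betw_def inv_into_into lessThan_iff, metis bij_betw_inv_into_right)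
  have e'e: "e' (e j) = j" if "j < r" for j
    using that e unfolding e'_def by (simp add: bij_betw_inv_into_left)
  have eI: "e j \<in> I" if "j < r" for j using that e by (auto simp: bij_betw_def)
  define T where "T g = (\<lambda>(h::'a, K). (h, (\<lambda>y. g \<otimes> y) ` K))" for g :: 'a
  define rep where "rep = (\<lambda>(h::'a, K). SOME y::'a. y \<in> K)"
  have I: "\<exists>h x. h \<in> carrier G \<and> x \<in> carrier G \<and> i = (h, pow_coset h x)" if "i \<in> I" for i
    using that by (auto simp: I_def)
  have rep: "fst i \<in> carrier G" "rep i \<in> carrier G" "i = (fst i, pow_coset (fst i) (rep i))" if iI: "i \<in> I" for i
  proof -
    obtain h x where i: "h \<in> carrier G" "x \<in> carrier G" "i = (h, pow_coset h x)" using I[OF iI] by blast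
    have "rep i \<in> pow_coset h x"
      unfolding rep_def i(3) using someI[of "\<lambda>y. y \<in> pow_coset h x" x] pow_coset_self i by simp
    then show "fst i \<in> carrier G" "rep i \<in> carrier G" "i = (fst i, pow_coset (fst i) (rep i))"
      using i pow_coset_carrier[OF i(1,2)] pow_coset_eq[OF fin i(1,2)] by auto
  qed
  have Tp: "T g (h, pow_coset h x) = (h, pow_coset h (g \<otimes> x))" 
    if "g \<in> carrier G" "h \<in> carrier G" "x \<in> carrier G" for g h x
    using that by (simp add: T_def pow_coset_translate)
  have II: "(h, pow_coset h x) \<in> I" if "h \<in> carrier G" "x \<in> carrier G" for h x
    unfolding I_def by (rule image_eqI[of _ _ "(h, x)"]) (use that in auto)
  have TI: "T g i \<in> I" "fst (T g i) = fst i" if "g \<in> carrier G" "i \<in> I" for g i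
    using I[OF that(2)] Tp[OF that(1)] that(1) II by auto
  have Tm: "T (g \<otimes> h) i = T g (T h i)" if "g \<in> carrier G" "h \<in> carrier G" "i \<in> I" for g h i
    using I[OF that(3)] Tp that by (auto simp: m_assoc)
  have T1: "T \<one> i = i" if "i \<in> I" for i
    using I[OF that] Tp by auto
  have ex: "\<exists>k::nat. g \<otimes> rep i = rep (T g i) \<otimes> fst i [^] k" if "g \<in> carrier G" "i \<in> I" for g i
  proof -
    have "T g i = (fst i, pow_coset (fst i) (g \<otimes> rep i))"
      using rep[OF that(2)] Tp[OF that(1), of "fst i" "rep i"] by metis
    moreover have "T g i = (fst i, pow_coset (fst i) (rep (T g i)))"
      using rep(3)[OF TI(1)[OF that]] TI(2)[OF that] by simp
    ultimately have "g \<otimes> rep i \<in> pow_coset (fst i) (rep (T g i))"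
      using pow_coset_self[of "fst i" "g \<otimes> rep i"] rep[OF that(2)] that(1) by simp
    then show ?thesis by (auto simp: pow_coset_def)
  qed
  define a where "a g i = (SOME k::nat. g \<otimes> rep i = rep (T g i) \<otimes> fst i [^] k)" for g i
  have a: "g \<otimes> rep i = rep (T g i) \<otimes> fst i [^] a g i" if "g \<in> carrier G" "i \<in> I" for g i
    unfolding a_def by (rule someI_ex[OF ex[OF that]])
  \<comment> \<open>The element \<open>(g \<otimes> h) \<otimes> rep i\<close> is computed directly
    and by way of \<open>T h i\<close>. The exponents are chosen arbitrarily, so they agree only
    modulo the order.\<close>
  have ac: "[a (g \<otimes> h) i = a g (T h i) + a h i] (mod ord (fst i))"
    if g: "g \<in> carrier G" and h: "h \<in> carrier G" and i: "i \<in> I" for g h i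
  proof (rule pow_eq_cong)
    note Th = TI[OF h i] and r1 = rep(1,2)[OF i] and r2 = rep(1,2)[OF TI(1)[OF h i]]
      and r3 = rep(1,2)[OF TI(1)[OF g TI(1)[OF h i]]]
    have "rep (T g (T h i)) \<otimes> fst i [^] a (g \<otimes> h) i = g \<otimes> (h \<otimes> rep i)"
      using a[of "g \<otimes> h" i] g h i r1 by (simp add: Tm m_assoc)
    also have "\<dots> = (g \<otimes> rep (T h i)) \<otimes> fst i [^] a h i"
      using a[OF h i] g r1 r2 by (simp add: m_assoc)
    also have "\<dots> = rep (T g (T h i)) \<otimes> (fst i [^] a g (T h i) \<otimes> fst i [^] a h i)"
      using a[OF g Th(1)] Th(2) r1 r3 by (simp add: m_assoc)
    finally show "fst i [^] a (g \<otimes> h) i = fst i [^] (a g (T h i) + a h i)"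
      using r1 r3 by (simp add: nat_pow_mult)
  qed (use rep(1)[OF i] in simp)
  \<comment> \<open>At the subgroup generated by \<open>g\<close> itself the representative is a
    power of \<open>g\<close> and commutes with \<open>g\<close>. Hence the translation exponent
    satisfies \<open>g [^] a g i = g\<close>, and the order of \<open>g\<close> does not divide
    it.\<close>
  have af: "\<exists>i\<in>I. T g i = i \<and> \<not> ord (fst i) dvd a g i" if g: "g \<in> carrier G" "g \<noteq> \<one>" for g
  proof -
    define i where "i = (g, pow_coset g \<one>)"
    have i: "i \<in> I" using g II by (simp add: i_def)
    have "g \<in> pow_coset g \<one>" using g by (auto simp: pow_coset_def intro!: image_eqI[of _ _ 1])
    then have Ti: "T g i = i" using Tp[OF g(1) g(1) one_closed] pow_coset_eq[OF fin g(1) one_closed] g by (simp add: i_def)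
    have "rep i \<in> pow_coset g \<one>"
      using rep[OF i] pow_coset_self[of g "rep i"] g by (metis fst_conv i_def snd_conv)
    then obtain k :: nat where k: "rep i = g [^] k" using g by (auto simp: pow_coset_def)
    have "g [^] k \<otimes> g [^] a g i = g \<otimes> g [^] k" using a[OF g(1) i] Ti k by (simp add: i_def)
    also have "\<dots> = g [^] k \<otimes> g" using g by (metis nat_pow_Suc nat_pow_Suc2)
    finally have "g [^] a g i = g" using g by simp
    then have "\<not> ord g dvd a g i" using g by (metis pow_eq_id)
    then show ?thesis using i Ti by (auto simp: i_def)
  qed
  \<comment> \<open>The value 1 outside the range makes \<open>q j > 0\<close> hold for every
    \<open>j\<close>.\<close>
  define q where "q j = (if j < r then ord (fst (e j)) else 1)" for j
  define \<pi> where "\<pi> g j = (if j < r then e' (T g (e j)) else j)" for g j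
  define \<alpha> where "\<alpha> g j = a g (e j)" for g j
  show thesis
  proof (rule that[of q r \<pi> \<alpha>])
    show "q j > 0" for j
      using ord_ge_1[OF fin rep(1)[OF eI]] by (cases "j < r") (auto simp: q_def less_eq_Suc_le)
    show "g \<in> carrier G \<Longrightarrow> j < r \<Longrightarrow> \<pi> g j < r" for g j
      using e'(1)[OF TI(1)[OF _ eI]] by (simp add: \<pi>_def)
    show "\<not> j < r \<Longrightarrow> \<pi> g j = j" for g j by (simp add: \<pi>_def)
    show "g \<in> carrier G \<Longrightarrow> h \<in> carrier G \<Longrightarrow> \<pi> (g \<otimes> h) j = \<pi> g (\<pi> h j)" for g h j
      using e'[OF TI(1)[OF _ eI], of h j] Tm[OF _ _ eI, of g h j] by (simp add: \<pi>_def)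
    show "\<pi> \<one> j = j" for j using T1[OF eI] e'e by (simp add: \<pi>_def)
    show "g \<in> carrier G \<Longrightarrow> q (\<pi> g j) = q j" for g j
      using e'[OF TI(1)[OF _ eI], of g j] TI(2)[OF _ eI, of g j] by (simp add: \<pi>_def q_def)
    show "g \<in> carrier G \<Longrightarrow> h \<in> carrier G \<Longrightarrow> j < r \<Longrightarrow> [\<alpha> (g \<otimes> h) j = \<alpha> g (\<pi> h j) + \<alpha> h j] (mod q j)" for g h j
      using ac[OF _ _ eI, of g h j] e'(2)[OF TI(1)[OF _ eI], of h j] by (simp add: \<pi>_def q_def \<alpha>_def)
    show "\<exists>j<r. \<pi> g j = j \<and> \<not> q j dvd \<alpha> g j" if g: "g \<in> carrier G" "g \<noteq> \<one>" for g
    proof -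
      obtain i where i: "i \<in> I" "T g i = i" "\<not> ord (fst i) dvd a g i" using af[OF g] by blast
      then show ?thesis using e'[OF i(1)] by (intro exI[of _ "e' i"]) (simp add: \<pi>_def q_def \<alpha>_def)
    qed
  qed
qed

end

section \<open>Free modules and the comparison theorem\<close>

text \<open>\<open>module_hom\<close> without extensionality: composites, sums and differences of
  homomorphisms stay in this class as plain lambda terms, and are cut off to the carrier only at the
  end.\<close>

definition mhom ::
  "('r, 'c) ring_scheme \<Rightarrow> ('r, 'a, 'd) module_scheme \<Rightarrow> ('r, 'b, 'e) module_scheme \<Rightarrow> ('a \<Rightarrow> 'b) \<Rightarrow> bool"
  where "mhom R M N f \<longleftrightarrow> f \<in> carrier M \<rightarrow> carrier N \<and>
    (\<forall>x\<in>carrier M. \<forall>y\<in>carrier M. f (x \<oplus>\<^bsub>M\<^esub> y) = f x \<oplus>\<^bsub>N\<^esub> f y) \<and>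
    (\<forall>a\<in>carrier R. \<forall>x\<in>carrier M. f (a \<odot>\<^bsub>M\<^esub> x) = a \<odot>\<^bsub>N\<^esub> f x)"

lemma module_hom_iff: "f \<in> module_hom R M N \<longleftrightarrow> mhom R M N f \<and> f \<in> extensional (carrier M)"
  by (auto simp: module_hom_def mhom_def PiE_def)

lemma module_homD: "f \<in> module_hom R M N \<Longrightarrow> mhom R M N f"
  by (simp add: module_hom_iff)

lemma mhom_closed: "mhom R M N f \<Longrightarrow> x \<in> carrier M \<Longrightarrow> f x \<in> carrier N"
  by (auto simp: mhom_def)

lemma mhom_add: "mhom R M N f \<Longrightarrow> x \<in> carrier M \<Longrightarrow> y \<in> carrier M \<Longrightarrow> f (x \<oplus>\<^bsub>M\<^esub> y) = f x \<oplus>\<^bsub>N\<^esub> f y"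
  by (auto simp: mhom_def)

lemma mhom_smult: "mhom R M N f \<Longrightarrow> a \<in> carrier R \<Longrightarrow> x \<in> carrier M \<Longrightarrow> f (a \<odot>\<^bsub>M\<^esub> x) = a \<odot>\<^bsub>N\<^esub> f x"
  by (auto simp: mhom_def)

lemma mhom_comp: "mhom R M N f \<Longrightarrow> mhom R N K g \<Longrightarrow> mhom R M K (\<lambda>x. g (f x))"
  by (auto simp: mhom_def Pi_iff)

lemma (in left_module) mhom_cong:
  "mhom R M N f \<Longrightarrow> (\<And>x. x \<in> carrier M \<Longrightarrow> f x = g x) \<Longrightarrow> mhom R M N g"
  unfolding mhom_def by (auto simp: Pi_iff)

lemma (in left_module) mhom_restrict:
  "mhom R M N f \<Longrightarrow> restrict f (carrier M) \<in> module_hom R M N"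
  by (auto simp: module_hom_iff intro: mhom_cong)

lemma mhom_zero:
  assumes "left_module R M" "left_module R N" "mhom R M N f"
  shows "f \<zero>\<^bsub>M\<^esub> = \<zero>\<^bsub>N\<^esub>"
proof -
  interpret M: left_module R M by fact
  interpret N: left_module R N by fact
  have "f \<zero>\<^bsub>M\<^esub> \<oplus>\<^bsub>N\<^esub> f \<zero>\<^bsub>M\<^esub> = f \<zero>\<^bsub>M\<^esub>"
    using mhom_add[OF assms(3), of "\<zero>\<^bsub>M\<^esub>" "\<zero>\<^bsub>M\<^esub>"] by simp
  then show ?thesis using mhom_closed[OF assms(3)] N.M.add.l_cancel_one by auto
qed

lemma mhom_neg:
  assumes "left_module R M" "left_module R N" "mhom R M N f" "x \<in> carrier M"
  shows "f (\<ominus>\<^bsub>M\<^esub> x) = \<ominus>\<^bsub>N\<^esub> f x"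
proof -
  interpret M: left_module R M by fact
  interpret N: left_module R N by fact
  have "f (\<ominus>\<^bsub>M\<^esub> x) \<oplus>\<^bsub>N\<^esub> f x = \<zero>\<^bsub>N\<^esub>"
    using mhom_add[OF assms(3), of "\<ominus>\<^bsub>M\<^esub> x" x] assms by (simp add: mhom_zero M.M.l_neg)
  then show ?thesis using mhom_closed[OF assms(3)] assms(4) by (metis M.M.a_inv_closed N.M.minus_equality)
qed

lemma mhom_minus:
  assumes "left_module R M" "left_module R N" "mhom R M N f" "x \<in> carrier M" "y \<in> carrier M"
  shows "f (x \<ominus>\<^bsub>M\<^esub> y) = f x \<ominus>\<^bsub>N\<^esub> f y"
proof -
  interpret M: left_module R M by fact
  interpret N: left_module R N by fact
  show ?thesis using assms by (simp add: a_minus_def mhom_add mhom_neg)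
qed

lemma mhom_finsum:
  assumes "left_module R M" "left_module R N" "mhom R M N f" "finite I" "g \<in> I \<rightarrow> carrier M"
  shows "f (\<Oplus>\<^bsub>M\<^esub>i\<in>I. g i) = (\<Oplus>\<^bsub>N\<^esub>i\<in>I. f (g i))"
  using assms(4,5)
proof induction
  interpret M: left_module R M by fact
  interpret N: left_module R N by fact
  {
    case empty
    show ?case using mhom_zero[OF assms(1-3)] by simp
  next
    case (insert i I)
    then have "(\<lambda>i. f (g i)) \<in> I \<rightarrow> carrier N" "f (g i) \<in> carrier N" "g \<in> I \<rightarrow> carrier M" "g i \<in> carrier M"
      using mhom_closed[OF assms(3)] by auto
    then show ?case using insert by (simp add: mhom_add[OF assms(3)])
  }
qed

context left_module
begin

lemma smult_r_null [simp]: assumes "a \<in> carrier R" shows "a \<odot>\<^bsub>M\<^esub> \<zero>\<^bsub>M\<^esub> = \<zero>\<^bsub>M\<^esub>"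
proof -
  have "a \<odot>\<^bsub>M\<^esub> \<zero>\<^bsub>M\<^esub> \<oplus>\<^bsub>M\<^esub> a \<odot>\<^bsub>M\<^esub> \<zero>\<^bsub>M\<^esub> = a \<odot>\<^bsub>M\<^esub> \<zero>\<^bsub>M\<^esub>"
    using assms smult_r_distr[of a "\<zero>\<^bsub>M\<^esub>" "\<zero>\<^bsub>M\<^esub>"] by simp
  then show ?thesis using assms by (metis M.add.l_cancel_one M.zero_closed smult_closed)
qed

lemma smult_l_null [simp]: assumes "x \<in> carrier M" shows "\<zero>\<^bsub>R\<^esub> \<odot>\<^bsub>M\<^esub> x = \<zero>\<^bsub>M\<^esub>"
proof -
  have "\<zero>\<^bsub>R\<^esub> \<odot>\<^bsub>M\<^esub> x \<oplus>\<^bsub>M\<^esub> \<zero>\<^bsub>R\<^esub> \<odot>\<^bsub>M\<^esub> x = \<zero>\<^bsub>R\<^esub> \<odot>\<^bsub>M\<^esub> x"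
    using assms smult_l_distr[of "\<zero>\<^bsub>R\<^esub>" "\<zero>\<^bsub>R\<^esub>" x] by simp
  then show ?thesis using assms by (metis M.add.l_cancel_one R.zero_closed smult_closed)
qed

lemma smult_r_neg: assumes "a \<in> carrier R" "x \<in> carrier M" shows "a \<odot>\<^bsub>M\<^esub> (\<ominus>\<^bsub>M\<^esub> x) = \<ominus>\<^bsub>M\<^esub> (a \<odot>\<^bsub>M\<^esub> x)"
proof -
  have "a \<odot>\<^bsub>M\<^esub> (\<ominus>\<^bsub>M\<^esub> x) \<oplus>\<^bsub>M\<^esub> a \<odot>\<^bsub>M\<^esub> x = \<zero>\<^bsub>M\<^esub>"
    using assms smult_r_distr[of a "\<ominus>\<^bsub>M\<^esub> x" x] by (simp add: M.l_neg)
  then show ?thesis using assms by (metis M.a_inv_closed M.minus_equality smult_closed)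
qed

lemma finsum_smult_r:
  assumes "finite I" "g \<in> I \<rightarrow> carrier M" "a \<in> carrier R"
  shows "a \<odot>\<^bsub>M\<^esub> (\<Oplus>\<^bsub>M\<^esub>i\<in>I. g i) = (\<Oplus>\<^bsub>M\<^esub>i\<in>I. a \<odot>\<^bsub>M\<^esub> g i)"
  using assms(1,2)
proof induction
  case (insert i I)
  then have "(\<lambda>i. a \<odot>\<^bsub>M\<^esub> g i) \<in> I \<rightarrow> carrier M" "a \<odot>\<^bsub>M\<^esub> g i \<in> carrier M" "g \<in> I \<rightarrow> carrier M" "g i \<in> carrier M"
    using assms by auto
  then show ?case using insert assms by (simp add: smult_r_distr)
qed (use assms in simp)

text \<open>The sum that occurs in \<open>module_basis\<close>, with the vectors given by a family
  \<open>n\<close> in place of the basis itself; a homomorphism then acts by changing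
  \<open>n\<close> and keeping the coefficients.\<close>

definition lin_comb :: "'e set \<Rightarrow> ('e \<Rightarrow> 'm) \<Rightarrow> ('e \<Rightarrow> 'r) \<Rightarrow> 'm" where
  "lin_comb B n c = (\<Oplus>\<^bsub>M\<^esub>b\<in>{b \<in> B. c b \<noteq> \<zero>\<^bsub>R\<^esub>}. c b \<odot>\<^bsub>M\<^esub> n b)"

lemma lin_comb_superset:
  assumes "finite F" "{b \<in> B. c b \<noteq> \<zero>\<^bsub>R\<^esub>} \<subseteq> F" "F \<subseteq> B" "c \<in> B \<rightarrow> carrier R" "n \<in> B \<rightarrow> carrier M"
  shows "lin_comb B n c = (\<Oplus>\<^bsub>M\<^esub>b\<in>F. c b \<odot>\<^bsub>M\<^esub> n b)"
  unfolding lin_comb_def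
  by (rule M.add.finprod_mono_neutral_cong_left) (use assms in \<open>auto simp: Pi_iff subset_iff\<close>)

lemma lin_comb_closed:
  assumes "c \<in> B \<rightarrow> carrier R" "n \<in> B \<rightarrow> carrier M"
  shows "lin_comb B n c \<in> carrier M"
  unfolding lin_comb_def using assms by (intro M.finsum_closed) auto

lemma lin_comb_cong:
  assumes "\<And>b. b \<in> B \<Longrightarrow> c b = c' b" "\<And>b. b \<in> B \<Longrightarrow> n b = n' b"
    and "c' \<in> B \<rightarrow> carrier R" "n' \<in> B \<rightarrow> carrier M"
  shows "lin_comb B n c = lin_comb B n' c'"
  unfolding lin_comb_def using assms by (intro M.finsum_cong') (auto simp: Pi_iff)

lemma lin_comb_add:
  assumes "c \<in> B \<rightarrow> carrier R" "n \<in> B \<rightarrow> carrier M" "c' \<in> B \<rightarrow> carrier R"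
    and fin: "finite {b \<in> B. c b \<noteq> \<zero>\<^bsub>R\<^esub>}" "finite {b \<in> B. c' b \<noteq> \<zero>\<^bsub>R\<^esub>}"
  shows "lin_comb B n (\<lambda>b. c b \<oplus>\<^bsub>R\<^esub> c' b) = lin_comb B n c \<oplus>\<^bsub>M\<^esub> lin_comb B n c'"
proof -
  define F where "F = {b \<in> B. c b \<noteq> \<zero>\<^bsub>R\<^esub>} \<union> {b \<in> B. c' b \<noteq> \<zero>\<^bsub>R\<^esub>}"
  have F: "finite F" "F \<subseteq> B" using fin by (auto simp: F_def)
  have "lin_comb B n (\<lambda>b. c b \<oplus>\<^bsub>R\<^esub> c' b) = (\<Oplus>\<^bsub>M\<^esub>b\<in>F. (c b \<oplus>\<^bsub>R\<^esub> c' b) \<odot>\<^bsub>M\<^esub> n b)"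
    by (rule lin_comb_superset) (use F assms in \<open>auto simp: F_def\<close>)
  also have "\<dots> = (\<Oplus>\<^bsub>M\<^esub>b\<in>F. c b \<odot>\<^bsub>M\<^esub> n b \<oplus>\<^bsub>M\<^esub> c' b \<odot>\<^bsub>M\<^esub> n b)"
    by (rule M.finsum_cong') (use F assms in \<open>auto simp: Pi_iff smult_l_distr subset_iff\<close>)
  also have "\<dots> = (\<Oplus>\<^bsub>M\<^esub>b\<in>F. c b \<odot>\<^bsub>M\<^esub> n b) \<oplus>\<^bsub>M\<^esub> (\<Oplus>\<^bsub>M\<^esub>b\<in>F. c' b \<odot>\<^bsub>M\<^esub> n b)"
    by (rule M.finsum_addf) (use F assms in \<open>auto simp: Pi_iff subset_iff\<close>)
  also have "(\<Oplus>\<^bsub>M\<^esub>b\<in>F. c b \<odot>\<^bsub>M\<^esub> n b) = lin_comb B n c"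
    by (rule lin_comb_superset[symmetric]) (use F assms in \<open>auto simp: F_def\<close>)
  also have "(\<Oplus>\<^bsub>M\<^esub>b\<in>F. c' b \<odot>\<^bsub>M\<^esub> n b) = lin_comb B n c'"
    by (rule lin_comb_superset[symmetric]) (use F assms in \<open>auto simp: F_def\<close>)
  finally show ?thesis .
qed

lemma lin_comb_smult:
  assumes "c \<in> B \<rightarrow> carrier R" "n \<in> B \<rightarrow> carrier M" "a \<in> carrier R"
    and fin: "finite {b \<in> B. c b \<noteq> \<zero>\<^bsub>R\<^esub>}"
  shows "lin_comb B n (\<lambda>b. a \<otimes>\<^bsub>R\<^esub> c b) = a \<odot>\<^bsub>M\<^esub> lin_comb B n c"
proof -
  define F where "F = {b \<in> B. c b \<noteq> \<zero>\<^bsub>R\<^esub>}"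
  have F: "finite F" "F \<subseteq> B" using fin by (auto simp: F_def)
  have "lin_comb B n (\<lambda>b. a \<otimes>\<^bsub>R\<^esub> c b) = (\<Oplus>\<^bsub>M\<^esub>b\<in>F. (a \<otimes>\<^bsub>R\<^esub> c b) \<odot>\<^bsub>M\<^esub> n b)"
    by (rule lin_comb_superset) (use F assms in \<open>auto simp: F_def\<close>)
  also have "\<dots> = (\<Oplus>\<^bsub>M\<^esub>b\<in>F. a \<odot>\<^bsub>M\<^esub> (c b \<odot>\<^bsub>M\<^esub> n b))"
    by (rule M.finsum_cong') (use F assms in \<open>auto simp: Pi_iff smult_assoc1 subset_iff\<close>)
  also have "\<dots> = a \<odot>\<^bsub>M\<^esub> (\<Oplus>\<^bsub>M\<^esub>b\<in>F. c b \<odot>\<^bsub>M\<^esub> n b)"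
    by (rule finsum_smult_r[symmetric]) (use F assms in \<open>auto simp: Pi_iff subset_iff\<close>)
  finally show ?thesis by (simp add: F_def lin_comb_def)
qed

end

lemma mhom_lin_comb:
  assumes "left_module R M" "left_module R N" "mhom R M N f"
    and "c \<in> B \<rightarrow> carrier R" "n \<in> B \<rightarrow> carrier M" "finite {b \<in> B. c b \<noteq> \<zero>\<^bsub>R\<^esub>}"
  shows "f (left_module.lin_comb R M B n c) = left_module.lin_comb R N B (\<lambda>b. f (n b)) c"
proof -
  interpret M: left_module R M by fact
  interpret N: left_module R N by fact
  have "f (M.lin_comb B n c) = (\<Oplus>\<^bsub>N\<^esub>b\<in>{b \<in> B. c b \<noteq> \<zero>\<^bsub>R\<^esub>}. f (c b \<odot>\<^bsub>M\<^esub> n b))"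
    unfolding M.lin_comb_def by (rule mhom_finsum) (use assms in auto)
  also have "\<dots> = N.lin_comb B (\<lambda>b. f (n b)) c"
    unfolding N.lin_comb_def
    by (rule N.M.finsum_cong') (use assms mhom_closed[OF assms(3)] in \<open>auto simp: Pi_iff mhom_smult[OF assms(3)]\<close>)
  finally show ?thesis .
qed

text \<open>Free modules are projective: preimages of the images of the basis are chosen and
  extended by coordinates, and the coordinates are linear because they are unique. The hypothesis on
  images takes the place of surjectivity of \<open>\<alpha>\<close>, so that the lemma applies to
  differentials at every place of an exact complex.\<close>

lemma free_lift:
  assumes "free_module R Q" "left_module R N1" "left_module R N2"
    and \<alpha>: "mhom R N1 N2 \<alpha>" and f: "mhom R Q N2 f"
    and sub: "f ` carrier Q \<subseteq> \<alpha> ` carrier N1"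
  shows "\<exists>g\<in>module_hom R Q N1. \<forall>x\<in>carrier Q. \<alpha> (g x) = f x"
proof -
  interpret Q: left_module R Q using assms(1) by (simp add: free_module_def)
  interpret N1: left_module R N1 by fact
  interpret N2: left_module R N2 by fact
  obtain B where B: "module_basis R Q B" using assms(1) by (auto simp: free_module_def)
  then have BQ: "B \<subseteq> carrier Q" by (simp add: module_basis_def)
  define fs where "fs c \<longleftrightarrow> c \<in> B \<rightarrow>\<^sub>E carrier R \<and> finite {b \<in> B. c b \<noteq> \<zero>\<^bsub>R\<^esub>}" for c
  have ex1: "\<exists>!c. fs c \<and> x = Q.lin_comb B id c" if "x \<in> carrier Q" for x
    using B that unfolding module_basis_def fs_def Q.lin_comb_def by (simp add: conj_assoc)
  define C where "C x = (THE c. fs c \<and> x = Q.lin_comb B id c)" for x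
  have C: "fs (C x)" "x = Q.lin_comb B id (C x)" if "x \<in> carrier Q" for x
    using theI'[OF ex1[OF that]] by (auto simp: C_def)
  have uniq: "C x = c" if "x \<in> carrier Q" "fs c" "x = Q.lin_comb B id c" for x c
    using ex1[OF that(1)] C[OF that(1)] that by blast
  have "\<forall>b\<in>B. \<exists>y. y \<in> carrier N1 \<and> \<alpha> y = f b" using sub BQ by (fastforce simp: subset_iff image_iff)
  then obtain n where n: "\<And>b. b \<in> B \<Longrightarrow> n b \<in> carrier N1 \<and> \<alpha> (n b) = f b" by metis
  then have nB: "n \<in> B \<rightarrow> carrier N1" by auto
  have idB: "id \<in> B \<rightarrow> carrier Q" using BQ by auto
  have fsD: "c \<in> B \<rightarrow> carrier R" "finite {b \<in> B. c b \<noteq> \<zero>\<^bsub>R\<^esub>}" if "fs c" for c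
    using that by (auto simp: fs_def)
  define g where "g x = N1.lin_comb B n (C x)" for x
  have hom: "mhom R Q N1 g"
    unfolding mhom_def
  proof (intro conjI ballI)
    show "g \<in> carrier Q \<rightarrow> carrier N1"
      unfolding g_def using C fsD nB by (auto intro!: N1.lin_comb_closed)
  next
    fix x y assume xy: "x \<in> carrier Q" "y \<in> carrier Q"
    note cx = fsD[OF C(1)[OF xy(1)]] and cy = fsD[OF C(1)[OF xy(2)]]
    \<comment> \<open>Cut off outside \<open>B\<close>, since coordinates are unique only among
      extensional families.\<close>
    let ?c = "\<lambda>b\<in>B. C x b \<oplus>\<^bsub>R\<^esub> C y b"
    have "finite {b \<in> B. ?c b \<noteq> \<zero>\<^bsub>R\<^esub>}"
      by (rule finite_subset[OF _ finite_UnI[OF cx(2) cy(2)]]) auto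
    then have fc: "fs ?c" using cx cy by (auto simp: fs_def)
    have cong: "Q.lin_comb B id ?c = Q.lin_comb B id (\<lambda>b. C x b \<oplus>\<^bsub>R\<^esub> C y b)"
      "N1.lin_comb B n ?c = N1.lin_comb B n (\<lambda>b. C x b \<oplus>\<^bsub>R\<^esub> C y b)"
      by (intro Q.lin_comb_cong N1.lin_comb_cong; use cx cy nB idB in \<open>auto simp: Pi_iff\<close>)+
    have "x \<oplus>\<^bsub>Q\<^esub> y = Q.lin_comb B id ?c"
      unfolding cong(1) Q.lin_comb_add[OF cx(1) idB cy(1) cx(2) cy(2)]
      by (simp only: C(2)[OF xy(1), symmetric] C(2)[OF xy(2), symmetric])
    then have "C (x \<oplus>\<^bsub>Q\<^esub> y) = ?c" by (rule uniq[OF Q.M.a_closed[OF xy] fc])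
    then show "g (x \<oplus>\<^bsub>Q\<^esub> y) = g x \<oplus>\<^bsub>N1\<^esub> g y"
      unfolding g_def using N1.lin_comb_add[OF cx(1) nB cy(1) cx(2) cy(2)] cong by simp
  next
    fix a x assume ax: "a \<in> carrier R" "x \<in> carrier Q"
    note cx = fsD[OF C(1)[OF ax(2)]]
    let ?c = "\<lambda>b\<in>B. a \<otimes>\<^bsub>R\<^esub> C x b"
    have "finite {b \<in> B. ?c b \<noteq> \<zero>\<^bsub>R\<^esub>}"
      by (rule finite_subset[OF _ cx(2)]) (use ax in auto)
    then have fc: "fs ?c" using cx ax by (auto simp: fs_def)
    have cong: "Q.lin_comb B id ?c = Q.lin_comb B id (\<lambda>b. a \<otimes>\<^bsub>R\<^esub> C x b)"
      "N1.lin_comb B n ?c = N1.lin_comb B n (\<lambda>b. a \<otimes>\<^bsub>R\<^esub> C x b)"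
      by (intro Q.lin_comb_cong N1.lin_comb_cong; use cx ax nB idB in \<open>auto simp: Pi_iff\<close>)+
    have "a \<odot>\<^bsub>Q\<^esub> x = Q.lin_comb B id ?c"
      unfolding cong(1) Q.lin_comb_smult[OF cx(1) idB ax(1) cx(2)]
      by (simp only: C(2)[OF ax(2), symmetric])
    then have "C (a \<odot>\<^bsub>Q\<^esub> x) = ?c" by (rule uniq[OF Q.smult_closed[OF ax] fc])
    then show "g (a \<odot>\<^bsub>Q\<^esub> x) = a \<odot>\<^bsub>N1\<^esub> g x"
      unfolding g_def using N1.lin_comb_smult[OF cx(1) nB ax(1) cx(2)] cong by simp
  qed
  have "\<alpha> (g x) = f x" if x: "x \<in> carrier Q" for x
  proof -
    note cx = fsD[OF C(1)[OF x]]
    have "\<alpha> (g x) = N2.lin_comb B (\<lambda>b. \<alpha> (n b)) (C x)"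
      unfolding g_def by (rule mhom_lin_comb[OF assms(2,3) \<alpha> cx(1) nB cx(2)])
    also have "\<dots> = N2.lin_comb B (\<lambda>b. f (id b)) (C x)"
      by (rule N2.lin_comb_cong) (use n cx BQ mhom_closed[OF f] in auto)
    also have "\<dots> = f (Q.lin_comb B id (C x))"
      by (rule mhom_lin_comb[OF Q.left_module_axioms assms(3) f cx(1) idB cx(2), symmetric])
    finally show ?thesis by (simp only: C(2)[OF x, symmetric])
  qed
  then show ?thesis using Q.mhom_restrict[OF hom] by (intro bexI[of _ "restrict g (carrier Q)"]) auto
qed

section \<open>Chain maps over a cocycle and the comparison theorem\<close>

definition chain_map_over ::
  "('r, 'c) ring_scheme \<Rightarrow> ('r, 'b, 'a) resolution \<Rightarrow> ('r, 'e, 'a) resolution \<Rightarrow> nat \<Rightarrow> ('b \<Rightarrow> 'a) \<Rightarrow>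
    (nat \<Rightarrow> 'b \<Rightarrow> 'e) \<Rightarrow> bool"
  where "chain_map_over R P Q n f F \<longleftrightarrow>
    (\<forall>i. F i \<in> module_hom R (res_term P (n + i)) (res_term Q i)) \<and>
    (\<forall>x\<in>carrier (res_term P n). res_aug Q (F 0 x) = f x) \<and>
    (\<forall>i. \<forall>x\<in>carrier (res_term P (Suc (n + i))). res_diff Q i (F (Suc i) x) = F i (res_diff P (n + i) x))"

lemma chain_lift_iff: "chain_lift R P n f F \<longleftrightarrow> chain_map_over R P P n f F"
  by (simp add: chain_lift_def chain_map_over_def)

context left_module
begin

lemma minus_closed [simp]: "x \<in> carrier M \<Longrightarrow> y \<in> carrier M \<Longrightarrow> x \<ominus>\<^bsub>M\<^esub> y \<in> carrier M"
  by (simp add: a_minus_def)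

lemma minus_self [simp]: "x \<in> carrier M \<Longrightarrow> x \<ominus>\<^bsub>M\<^esub> x = \<zero>\<^bsub>M\<^esub>"
  by (simp add: a_minus_def M.r_neg)

lemma minus_zero [simp]: "x \<in> carrier M \<Longrightarrow> x \<ominus>\<^bsub>M\<^esub> \<zero>\<^bsub>M\<^esub> = x"
  by (simp add: a_minus_def)

lemma minus_eq_zero: "x \<in> carrier M \<Longrightarrow> y \<in> carrier M \<Longrightarrow> x \<ominus>\<^bsub>M\<^esub> y = \<zero>\<^bsub>M\<^esub> \<longleftrightarrow> x = y"
  by (metis M.r_neg a_minus_def M.a_inv_closed M.minus_equality M.minus_minus)

lemma add_minus_add:
  "\<lbrakk>a \<in> carrier M; b \<in> carrier M; c \<in> carrier M; d \<in> carrier M\<rbrakk> \<Longrightarrow>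
    (a \<oplus>\<^bsub>M\<^esub> b) \<ominus>\<^bsub>M\<^esub> (c \<oplus>\<^bsub>M\<^esub> d) = (a \<ominus>\<^bsub>M\<^esub> c) \<oplus>\<^bsub>M\<^esub> (b \<ominus>\<^bsub>M\<^esub> d)"
  by (simp add: a_minus_def M.minus_add M.a_ac)

lemma minus_add_cancel: "\<lbrakk>x \<in> carrier M; y \<in> carrier M\<rbrakk> \<Longrightarrow> (x \<ominus>\<^bsub>M\<^esub> y) \<oplus>\<^bsub>M\<^esub> y = x"
  by (simp add: a_minus_def M.a_assoc M.l_neg)

lemma smult_minus:
  "\<lbrakk>a \<in> carrier R; x \<in> carrier M; y \<in> carrier M\<rbrakk> \<Longrightarrow> a \<odot>\<^bsub>M\<^esub> (x \<ominus>\<^bsub>M\<^esub> y) = a \<odot>\<^bsub>M\<^esub> x \<ominus>\<^bsub>M\<^esub> a \<odot>\<^bsub>M\<^esub> y"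
  by (simp add: a_minus_def smult_r_distr smult_r_neg)

end

lemma mhom_diff:
  assumes "left_module R M" "left_module R N" "mhom R M N f" "mhom R M N g"
  shows "mhom R M N (\<lambda>x. f x \<ominus>\<^bsub>N\<^esub> g x)"
proof -
  interpret N: left_module R N by fact
  show ?thesis using assms
    unfolding mhom_def by (auto simp: Pi_iff N.add_minus_add N.smult_minus)
qed

lemma mhom_plus:
  assumes "left_module R M" "left_module R N" "mhom R M N f" "mhom R M N g"
  shows "mhom R M N (\<lambda>x. f x \<oplus>\<^bsub>N\<^esub> g x)"
proof -
  interpret N: left_module R N by fact
  show ?thesis using assms
    unfolding mhom_def by (auto simp: Pi_iff N.M.a_ac N.smult_r_distr)
qed

lemma mhom_const_zero:
  assumes "left_module R N" shows "mhom R M N (\<lambda>x. \<zero>\<^bsub>N\<^esub>)"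
proof -
  interpret N: left_module R N by fact
  show ?thesis by (auto simp: mhom_def)
qed

lemma free_resolutionD:
  assumes "free_resolution R A P"
  shows "free_module R (res_term P n)" "left_module R (res_term P n)"
    and "mhom R (res_term P (Suc n)) (res_term P n) (res_diff P n)"
    and "mhom R (res_term P 0) A (res_aug P)"
    and "res_aug P ` carrier (res_term P 0) = carrier A"
    and "x \<in> carrier (res_term P 0) \<Longrightarrow> res_aug P x = \<zero>\<^bsub>A\<^esub> \<Longrightarrow> x \<in> res_diff P 0 ` carrier (res_term P 1)"
    and "y \<in> carrier (res_term P (Suc 0)) \<Longrightarrow> res_aug P (res_diff P 0 y) = \<zero>\<^bsub>A\<^esub>"
    and "z \<in> carrier (res_term P (Suc n)) \<Longrightarrow> res_diff P n z = \<zero>\<^bsub>res_term P n\<^esub> \<Longrightarrow>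
      z \<in> res_diff P (Suc n) ` carrier (res_term P (Suc (Suc n)))"
    and "w \<in> carrier (res_term P (Suc (Suc n))) \<Longrightarrow> res_diff P n (res_diff P (Suc n) w) = \<zero>\<^bsub>res_term P n\<^esub>"
proof -
  show "free_module R (res_term P n)" "left_module R (res_term P n)"
    using assms by (auto simp: free_resolution_def free_module_def)
  show "mhom R (res_term P (Suc n)) (res_term P n) (res_diff P n)" "mhom R (res_term P 0) A (res_aug P)"
    using assms by (auto simp: free_resolution_def module_hom_iff)
  show "res_aug P ` carrier (res_term P 0) = carrier A"
    using assms by (auto simp: free_resolution_def)
  have 0: "{x \<in> carrier (res_term P 0). res_aug P x = \<zero>\<^bsub>A\<^esub>} = res_diff P 0 ` carrier (res_term P 1)"
    and 1: "{x \<in> carrier (res_term P (Suc n)). res_diff P n x = \<zero>\<^bsub>res_term P n\<^esub>}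
           = res_diff P (Suc n) ` carrier (res_term P (Suc (Suc n)))"
    using assms by (simp_all add: free_resolution_def)
  show "x \<in> carrier (res_term P 0) \<Longrightarrow> res_aug P x = \<zero>\<^bsub>A\<^esub> \<Longrightarrow> x \<in> res_diff P 0 ` carrier (res_term P 1)"
    using 0 by blast
  show "y \<in> carrier (res_term P (Suc 0)) \<Longrightarrow> res_aug P (res_diff P 0 y) = \<zero>\<^bsub>A\<^esub>"
    using 0 by (simp add: set_eq_iff image_iff) blast
  show "z \<in> carrier (res_term P (Suc n)) \<Longrightarrow> res_diff P n z = \<zero>\<^bsub>res_term P n\<^esub> \<Longrightarrow>
      z \<in> res_diff P (Suc n) ` carrier (res_term P (Suc (Suc n)))" using 1 by blast
  show "w \<in> carrier (res_term P (Suc (Suc n))) \<Longrightarrow> res_diff P n (res_diff P (Suc n) w) = \<zero>\<^bsub>res_term P n\<^esub>"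
    using 1 by blast
qed

text \<open>Dependent choice, one degree at a time. The invariant \<open>Pr\<close> keeps the
  composite of \<open>F\<close> with the differential of \<open>P\<close> inside the image of the
  next differential of \<open>Q\<close>, which is what \<open>free_lift\<close> requires at the next
  stage. With \<open>n = 0\<close> and the augmentation for \<open>f\<close> this gives comparison
  maps; with \<open>Q = P\<close>, lifts in the sense of \<open>chain_lift\<close>.\<close>

lemma chain_map_exists:
  assumes A: "left_module R A" and P: "free_resolution R A P" and Q: "free_resolution R A Q"
    and f: "f \<in> ext_cocycles R P A n"
  shows "\<exists>F. chain_map_over R P Q n f F"
proof -
  note PD = free_resolutionD[OF P] and QD = free_resolutionD[OF Q]
  define Pr where "Pr i F \<longleftrightarrow> F \<in> module_hom R (res_term P (n + i)) (res_term Q i) \<and>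
    (\<forall>x\<in>carrier (res_term P (Suc (n + i))). F (res_diff P (n + i) x) \<in> res_diff Q i ` carrier (res_term Q (Suc i))) \<and>
    (i = 0 \<longrightarrow> (\<forall>x\<in>carrier (res_term P n). res_aug Q (F x) = f x))" for i F
  define S where "S i F F' \<longleftrightarrow> (\<forall>x\<in>carrier (res_term P (Suc (n + i))). res_diff Q i (F' x) = F (res_diff P (n + i) x))" for i F F'
  have fh: "mhom R (res_term P n) A f" and fd: "\<And>x. x \<in> carrier (res_term P (Suc n)) \<Longrightarrow> f (res_diff P n x) = \<zero>\<^bsub>A\<^esub>"
    using f by (auto simp: ext_cocycles_def module_hom_iff)
  have start: "\<exists>F. Pr 0 F"
  proof -
    have "f ` carrier (res_term P n) \<subseteq> res_aug Q ` carrier (res_term Q 0)"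
      using mhom_closed[OF fh] QD(5) by auto
    then obtain F where F: "F \<in> module_hom R (res_term P n) (res_term Q 0)"
      "\<And>x. x \<in> carrier (res_term P n) \<Longrightarrow> res_aug Q (F x) = f x"
      using free_lift[OF PD(1) QD(2) A QD(4) fh] by blast
    have "F (res_diff P n x) \<in> res_diff Q 0 ` carrier (res_term Q (Suc 0))" if x: "x \<in> carrier (res_term P (Suc n))" for x
      using QD(6)[of "F (res_diff P n x)"] F(2) fd[OF x] mhom_closed[OF PD(3) x] mhom_closed[OF module_homD[OF F(1)]]
      by simp
    then show ?thesis using F by (auto simp: Pr_def)
  qed
  have step: "\<exists>F'. Pr (Suc i) F' \<and> S i F F'" if "Pr i F" for i F
  proof -
    have F: "mhom R (res_term P (n + i)) (res_term Q i) F" using that by (simp add: Pr_def module_hom_iff)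
    have "(\<lambda>x. F (res_diff P (n + i) x)) ` carrier (res_term P (Suc (n + i))) \<subseteq> res_diff Q i ` carrier (res_term Q (Suc i))"
      using that by (auto simp: Pr_def)
    from free_lift[OF PD(1) QD(2) QD(2) QD(3) mhom_comp[OF PD(3) F] this]
    obtain F' where F': "F' \<in> module_hom R (res_term P (Suc (n + i))) (res_term Q (Suc i))"
      "\<And>x. x \<in> carrier (res_term P (Suc (n + i))) \<Longrightarrow> res_diff Q i (F' x) = F (res_diff P (n + i) x)"
      by blast
    have "F' (res_diff P (Suc (n + i)) x) \<in> res_diff Q (Suc i) ` carrier (res_term Q (Suc (Suc i)))"
      if x: "x \<in> carrier (res_term P (Suc (Suc (n + i))))" for x
    proof (rule QD(8))
      have dx: "res_diff P (Suc (n + i)) x \<in> carrier (res_term P (Suc (n + i)))" by (rule mhom_closed[OF PD(3) x])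
      show "F' (res_diff P (Suc (n + i)) x) \<in> carrier (res_term Q (Suc i))"
        by (rule mhom_closed[OF module_homD[OF F'(1)] dx])
      show "res_diff Q i (F' (res_diff P (Suc (n + i)) x)) = \<zero>\<^bsub>res_term Q i\<^esub>"
        using F'(2)[OF dx] PD(9)[OF x] mhom_zero[OF PD(2) QD(2) F] by simp
    qed
    then show ?thesis using F' by (auto simp: Pr_def S_def)
  qed
  obtain F where "\<forall>i. Pr i (F i) \<and> S i (F i) (F (Suc i))"
    using dependent_nat_choice[of Pr S] start step by blast
  then show ?thesis unfolding chain_map_over_def Pr_def S_def by (intro exI[of _ F]) auto
qed

text \<open>The invariant \<open>Pr\<close> records \<open>d T d = K d\<close>. It shows that
  \<open>K - T d\<close> in the next degree takes values in cycles, hence in boundaries by exactness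
  of \<open>Q\<close>, and \<open>free_lift\<close> provides the next \<open>T\<close>.\<close>

lemma chain_null_homotopy:
  assumes A: "left_module R A" and P: "free_resolution R A P" and Q: "free_resolution R A Q"
    and K: "\<And>i. mhom R (res_term P (n + i)) (res_term Q i) (K i)"
    and K0: "\<And>x. x \<in> carrier (res_term P n) \<Longrightarrow> res_aug Q (K 0 x) = \<zero>\<^bsub>A\<^esub>"
    and Kd: "\<And>i x. x \<in> carrier (res_term P (Suc (n + i))) \<Longrightarrow> res_diff Q i (K (Suc i) x) = K i (res_diff P (n + i) x)"
  shows "\<exists>T. (\<forall>i. mhom R (res_term P (n + i)) (res_term Q (Suc i)) (T i)) \<and>
    (\<forall>x\<in>carrier (res_term P n). res_diff Q 0 (T 0 x) = K 0 x) \<and>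
    (\<forall>i. \<forall>x\<in>carrier (res_term P (Suc (n + i))).
      res_diff Q (Suc i) (T (Suc i) x) = K (Suc i) x \<ominus>\<^bsub>res_term Q (Suc i)\<^esub> T i (res_diff P (n + i) x))"
proof -
  note PD = free_resolutionD[OF P] and QD = free_resolutionD[OF Q]
  define Pr where "Pr i T \<longleftrightarrow> mhom R (res_term P (n + i)) (res_term Q (Suc i)) T \<and>
    (\<forall>x\<in>carrier (res_term P (Suc (n + i))). res_diff Q i (T (res_diff P (n + i) x)) = K i (res_diff P (n + i) x)) \<and>
    (i = 0 \<longrightarrow> (\<forall>x\<in>carrier (res_term P n). res_diff Q 0 (T x) = K 0 x))" for i T
  define S where "S i T T' \<longleftrightarrow> (\<forall>x\<in>carrier (res_term P (Suc (n + i))).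
    res_diff Q (Suc i) (T' x) = K (Suc i) x \<ominus>\<^bsub>res_term Q (Suc i)\<^esub> T (res_diff P (n + i) x))" for i T T'
  have start: "\<exists>T. Pr 0 T"
  proof -
    have K0h: "mhom R (res_term P n) (res_term Q 0) (K 0)" using K[of 0] by simp
    have sub: "K 0 ` carrier (res_term P n) \<subseteq> res_diff Q 0 ` carrier (res_term Q (Suc 0))"
      using QD(6) K0 mhom_closed[OF K[of 0]] by auto
    then obtain T where T: "T \<in> module_hom R (res_term P n) (res_term Q (Suc 0))"
      "\<And>x. x \<in> carrier (res_term P n) \<Longrightarrow> res_diff Q 0 (T x) = K 0 x"
      using free_lift[OF PD(1) QD(2) QD(2) QD(3) K0h sub] by blast
    then show ?thesis using mhom_closed[OF PD(3)] by (auto simp: Pr_def module_hom_iff intro!: exI[of _ T])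
  qed
  have step: "\<exists>T'. Pr (Suc i) T' \<and> S i T T'" if "Pr i T" for i T
  proof -
    have T: "mhom R (res_term P (n + i)) (res_term Q (Suc i)) T" 
      and Td: "\<And>x. x \<in> carrier (res_term P (Suc (n + i))) \<Longrightarrow> res_diff Q i (T (res_diff P (n + i) x)) = K i (res_diff P (n + i) x)"
      using that by (auto simp: Pr_def)
    interpret Qi: left_module R "res_term Q i" by (rule QD(2))
    interpret Qi1: left_module R "res_term Q (Suc i)" by (rule QD(2))
    let ?g = "\<lambda>x. K (Suc i) x \<ominus>\<^bsub>res_term Q (Suc i)\<^esub> T (res_diff P (n + i) x)"
    have K1: "mhom R (res_term P (Suc (n + i))) (res_term Q (Suc i)) (K (Suc i))" using K[of "Suc i"] by simp
    have Tdh: "mhom R (res_term P (Suc (n + i))) (res_term Q (Suc i)) (\<lambda>x. T (res_diff P (n + i) x))"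
      by (rule mhom_comp[OF PD(3) T])
    have g: "mhom R (res_term P (Suc (n + i))) (res_term Q (Suc i)) ?g"
      by (rule mhom_diff[OF PD(2) QD(2) K1 Tdh])
    have "?g ` carrier (res_term P (Suc (n + i))) \<subseteq> res_diff Q (Suc i) ` carrier (res_term Q (Suc (Suc i)))"
    proof safe
      fix x assume x: "x \<in> carrier (res_term P (Suc (n + i)))"
      show "?g x \<in> res_diff Q (Suc i) ` carrier (res_term Q (Suc (Suc i)))"
      proof (rule QD(8)[OF mhom_closed[OF g x]])
        have "K i (res_diff P (n + i) x) \<in> carrier (res_term Q i)"
          by (rule mhom_closed[OF K mhom_closed[OF PD(3) x]])
        then show "res_diff Q i (?g x) = \<zero>\<^bsub>res_term Q i\<^esub>"
          using mhom_minus[OF QD(2) QD(2) QD(3) mhom_closed[OF K1 x] mhom_closed[OF Tdh x]] Kd[OF x] Td[OF x]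
          by simp
      qed
    qed
    from free_lift[OF PD(1) QD(2) QD(2) QD(3) g this]
    obtain T' where T': "mhom R (res_term P (Suc (n + i))) (res_term Q (Suc (Suc i))) T'"
      "\<And>x. x \<in> carrier (res_term P (Suc (n + i))) \<Longrightarrow> res_diff Q (Suc i) (T' x) = ?g x"
      by (auto simp: module_hom_iff)
    have "res_diff Q (Suc i) (T' (res_diff P (Suc (n + i)) x)) = K (Suc i) (res_diff P (Suc (n + i)) x)"
      if x: "x \<in> carrier (res_term P (Suc (Suc (n + i))))" for x
      using T'(2)[OF mhom_closed[OF PD(3) x]] PD(9)[OF x] mhom_zero[OF PD(2) QD(2) T]
        mhom_closed[OF K1 mhom_closed[OF PD(3) x]] by simp
    then show ?thesis using T' by (auto simp: Pr_def S_def)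
  qed
  obtain T where "\<forall>i. Pr i (T i) \<and> S i (T i) (T (Suc i))"
    using dependent_nat_choice[of Pr S] start step by blast
  then show ?thesis unfolding Pr_def S_def by (intro exI[of _ T]) auto
qed

text \<open>The difference \<open>D\<close> of the chain maps covers \<open>f - f'\<close>, which
  need not vanish. A map \<open>H\<close> covering it as well is subtracted in degree 0; the result
  covers zero and is null homotopic. Composing with \<open>g\<close>, which kills boundaries, leaves
  \<open>g T d\<close>, a coboundary, if \<open>q > 0\<close>, and \<open>g H\<close> if
  \<open>q = 0\<close>.\<close>

lemma chain_map_unique:
  assumes A: "left_module R A" and M: "left_module R M"
    and P: "free_resolution R A P" and Q: "free_resolution R A Q"
    and F: "chain_map_over R P Q n f F" and F': "chain_map_over R P Q n f' F'"
    and f: "mhom R (res_term P n) A f" "mhom R (res_term P n) A f'"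
    and ff': "(\<lambda>x\<in>carrier (res_term P n). f x \<ominus>\<^bsub>A\<^esub> f' x) \<in> ext_coboundaries R P A n"
    and g: "g \<in> ext_cocycles R Q M q"
  shows "(\<lambda>x\<in>carrier (res_term P (n + q)). g (F q x) \<ominus>\<^bsub>M\<^esub> g (F' q x)) \<in> ext_coboundaries R P M (n + q)"
proof -
  note PD = free_resolutionD[OF P] and QD = free_resolutionD[OF Q]
  interpret A: left_module R A by fact
  interpret M: left_module R M by fact
  interpret Qi: left_module R "res_term Q i" for i by (rule QD(2))
  interpret Pi: left_module R "res_term P i" for i by (rule PD(2))
  have gh: "mhom R (res_term Q q) M g" and gd: "\<And>x. x \<in> carrier (res_term Q (Suc q)) \<Longrightarrow> g (res_diff Q q x) = \<zero>\<^bsub>M\<^esub>"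
    using g by (auto simp: ext_cocycles_def module_hom_iff)
  have Fh: "mhom R (res_term P (n + i)) (res_term Q i) (F i)" "mhom R (res_term P (n + i)) (res_term Q i) (F' i)" for i
    using F F' by (auto simp: chain_map_over_def module_hom_iff)
  have Fa: "res_aug Q (F 0 x) = f x" "res_aug Q (F' 0 x) = f' x" if "x \<in> carrier (res_term P n)" for x
    using F F' that by (auto simp: chain_map_over_def)
  have Fd: "res_diff Q i (F (Suc i) x) = F i (res_diff P (n + i) x)"
    "res_diff Q i (F' (Suc i) x) = F' i (res_diff P (n + i) x)"
    if "x \<in> carrier (res_term P (Suc (n + i)))" for i x
    using F F' that by (auto simp: chain_map_over_def)
  define D where "D i x = F i x \<ominus>\<^bsub>res_term Q i\<^esub> F' i x" for i x
  have Dh: "mhom R (res_term P (n + i)) (res_term Q i) (D i)" for i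
    unfolding D_def by (rule mhom_diff[OF PD(2) QD(2) Fh])
  have D0h: "mhom R (res_term P n) (res_term Q 0) (D 0)" using Dh[of 0] by simp
  have Dd: "res_diff Q i (D (Suc i) x) = D i (res_diff P (n + i) x)" if x: "x \<in> carrier (res_term P (Suc (n + i)))" for i x
    using mhom_minus[OF QD(2) QD(2) QD(3), of "F (Suc i) x" i "F' (Suc i) x"] Fd[OF x] x
      mhom_closed[OF Fh(1)[of "Suc i"]] mhom_closed[OF Fh(2)[of "Suc i"]]
    by (simp add: D_def)
  have Da: "res_aug Q (D 0 x) = f x \<ominus>\<^bsub>A\<^esub> f' x" if x: "x \<in> carrier (res_term P n)" for x
    using mhom_minus[OF QD(2) A QD(4), of "F 0 x" "F' 0 x"] Fa[OF x] x
      mhom_closed[OF Fh(1)[of 0]] mhom_closed[OF Fh(2)[of 0]]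
    by (simp add: D_def)
  have gD: "g (F q x) \<ominus>\<^bsub>M\<^esub> g (F' q x) = g (D q x)" if "x \<in> carrier (res_term P (n + q))" for x
    unfolding D_def using mhom_minus[OF QD(2) M gh] mhom_closed[OF Fh(1) that] mhom_closed[OF Fh(2) that] by simp
  have "\<exists>h. (\<forall>x\<in>carrier (res_term P (n + q)). g (D q x) = h x) \<and> restrict h (carrier (res_term P (n + q))) \<in> ext_coboundaries R P M (n + q)"
  proof -
    \<comment> \<open>\<open>H\<close> is extended by zero to positive degrees. Since
      \<open>H\<close> vanishes on boundaries, subtracting it leaves a chain map.\<close>
    define H' where "H' H i x = (if i = 0 then D i x \<ominus>\<^bsub>res_term Q i\<^esub> H x else D i x)" for H i x
    have main: ?thesis if H: "mhom R (res_term P n) (res_term Q 0) H"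
      "\<And>x. x \<in> carrier (res_term P n) \<Longrightarrow> res_aug Q (H x) = f x \<ominus>\<^bsub>A\<^esub> f' x"
      "\<And>x. x \<in> carrier (res_term P (Suc n)) \<Longrightarrow> H (res_diff P n x) = \<zero>\<^bsub>res_term Q 0\<^esub>"
      "q = 0 \<Longrightarrow> (\<lambda>x\<in>carrier (res_term P n). g (H x)) \<in> ext_coboundaries R P M n" for H
    proof -
      have 1: "mhom R (res_term P (n + i)) (res_term Q i) (H' H i)" for i
        using Dh[of i] mhom_diff[OF PD(2) QD(2) _ H(1), of "D 0"] Dh[of 0] by (cases i) (simp_all add: H'_def[abs_def])
      have 2: "res_aug Q (H' H 0 x) = \<zero>\<^bsub>A\<^esub>" if x: "x \<in> carrier (res_term P n)" for x
        using mhom_minus[OF QD(2) A QD(4), of "D 0 x" "H x"] Da[OF x] H(2)[OF x] x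
          mhom_closed[OF D0h] mhom_closed[OF H(1)] mhom_closed[OF f(1)] mhom_closed[OF f(2)]
        by (simp add: H'_def)
      have 3: "res_diff Q i (H' H (Suc i) x) = H' H i (res_diff P (n + i) x)"
        if x: "x \<in> carrier (res_term P (Suc (n + i)))" for i x
        using Dd[OF x] H(3)[of x] mhom_closed[OF D0h mhom_closed[OF PD(3)], of x] x
        by (cases i) (simp_all add: H'_def)
      from chain_null_homotopy[OF A P Q 1 2 3]
      obtain T where T: "\<And>i. mhom R (res_term P (n + i)) (res_term Q (Suc i)) (T i)"
        "\<And>x. x \<in> carrier (res_term P n) \<Longrightarrow> res_diff Q 0 (T 0 x) = H' H 0 x"
        "\<And>i x. x \<in> carrier (res_term P (Suc (n + i))) \<Longrightarrow>
          res_diff Q (Suc i) (T (Suc i) x) = H' H (Suc i) x \<ominus>\<^bsub>res_term Q (Suc i)\<^esub> T i (res_diff P (n + i) x)"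
        by blast
      show ?thesis
      proof (cases q)
        case 0
        have "g (D q x) = g (H x)" if x: "x \<in> carrier (res_term P n)" for x
        proof -
          have c: "D 0 x \<in> carrier (res_term Q 0)" "H x \<in> carrier (res_term Q 0)"
            using mhom_closed[OF D0h] mhom_closed[OF H(1)] x by auto
          have "g (H' H 0 x) = \<zero>\<^bsub>M\<^esub>"
            using gd[of "T 0 x"] T(2)[OF x] mhom_closed[OF T(1)[of 0]] x 0 by simp
          then have "g (D 0 x) \<ominus>\<^bsub>M\<^esub> g (H x) = \<zero>\<^bsub>M\<^esub>"
            using mhom_minus[OF QD(2) M gh, of "D 0 x" "H x"] c 0 by (simp add: H'_def)
          then show ?thesis using c mhom_closed[OF gh] 0 M.minus_eq_zero by simp
        qed
        then show ?thesis using H(4) 0 by (intro exI[of _ "\<lambda>x. g (H x)"]) simp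
      next
        case (Suc q')
        have gT: "mhom R (res_term P (n + q')) M (\<lambda>x. g (T q' x))"
          using mhom_comp[OF T(1)[of q']] gh Suc by simp
        have "g (D q x) = g (T q' (res_diff P (n + q') x))" if x: "x \<in> carrier (res_term P (Suc (n + q')))" for x
        proof -
          have c: "D q x \<in> carrier (res_term Q q)" "T q' (res_diff P (n + q') x) \<in> carrier (res_term Q q)"
            using mhom_closed[OF Dh[of q]] mhom_closed[OF T(1)[of q'] mhom_closed[OF PD(3)]] x Suc by auto
          have "g (res_diff Q q (T q x)) = \<zero>\<^bsub>M\<^esub>"
            using gd[of "T q x"] mhom_closed[OF T(1)[of q]] x Suc by simp
          then have "g (D q x) \<ominus>\<^bsub>M\<^esub> g (T q' (res_diff P (n + q') x)) = \<zero>\<^bsub>M\<^esub>"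
            using mhom_minus[OF QD(2) M gh c] T(3)[OF x] Suc by (simp add: H'_def)
          then show ?thesis using c mhom_closed[OF gh] M.minus_eq_zero by simp
        qed
        moreover have "(\<lambda>x\<in>carrier (res_term P (Suc (n + q'))). g (T q' (res_diff P (n + q') x))) \<in> ext_coboundaries R P M (Suc (n + q'))"
          using Pi.mhom_restrict[OF gT] mhom_closed[OF PD(3)]
          by (auto intro!: image_eqI[of _ _ "restrict (\<lambda>x. g (T q' x)) (carrier (res_term P (n + q')))"] restrict_ext)
        ultimately show ?thesis using Suc by (intro exI[of _ "\<lambda>x. g (T q' (res_diff P (n + q') x))"]) simp
      qed
    qed
    show ?thesis
    \<comment> \<open>For \<open>n = 0\<close> the only coboundary is zero, so \<open>f\<close> and
      \<open>f'\<close> agree and \<open>H = 0\<close> serves. Otherwise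
      \<open>f - f' = h d\<close>, and a lift of \<open>h\<close> through the augmentation, composed
      with the differential, serves.\<close>
    proof (cases n)
      case 0
      have "f x \<ominus>\<^bsub>A\<^esub> f' x = \<zero>\<^bsub>A\<^esub>" if "x \<in> carrier (res_term P n)" for x
        using ff' that 0 by (auto dest: fun_cong[of _ _ x])
      then show ?thesis
        using 0 mhom_zero[OF QD(2) A QD(4)] mhom_zero[OF QD(2) M gh]
        by (intro main[of "\<lambda>x. \<zero>\<^bsub>res_term Q 0\<^esub>"] mhom_const_zero QD(2)) (auto cong: restrict_cong)
    next
      case (Suc n')
      then obtain h where h: "h \<in> module_hom R (res_term P n') A"
        "(\<lambda>x\<in>carrier (res_term P n). f x \<ominus>\<^bsub>A\<^esub> f' x) = (\<lambda>x\<in>carrier (res_term P n). h (res_diff P n' x))"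
        using ff' by auto
      have "h ` carrier (res_term P n') \<subseteq> res_aug Q ` carrier (res_term Q 0)"
        using mhom_closed[OF module_homD[OF h(1)]] QD(5) by auto
      then obtain H where H: "H \<in> module_hom R (res_term P n') (res_term Q 0)"
        "\<And>x. x \<in> carrier (res_term P n') \<Longrightarrow> res_aug Q (H x) = h x"
        using free_lift[OF PD(1) QD(2) A QD(4) module_homD[OF h(1)]] by blast
      note Hh = module_homD[OF H(1)]
      show ?thesis
      proof (rule main[of "\<lambda>x. H (res_diff P n' x)"])
        show "mhom R (res_term P n) (res_term Q 0) (\<lambda>x. H (res_diff P n' x))"
          using mhom_comp[OF PD(3) Hh] Suc by simp
        show "res_aug Q (H (res_diff P n' x)) = f x \<ominus>\<^bsub>A\<^esub> f' x" if x: "x \<in> carrier (res_term P n)" for x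
          using H(2)[OF mhom_closed[OF PD(3)], of x] fun_cong[OF h(2), of x] x Suc by simp
        show "H (res_diff P n' (res_diff P n x)) = \<zero>\<^bsub>res_term Q 0\<^esub>" if "x \<in> carrier (res_term P (Suc n))" for x
          using PD(9)[of x n'] mhom_zero[OF PD(2) QD(2) Hh] that Suc by simp
        assume q: "q = 0"
        have "mhom R (res_term P n') M (\<lambda>x. g (H x))" using mhom_comp[OF Hh] gh q by simp
        then show "(\<lambda>x\<in>carrier (res_term P n). g (H (res_diff P n' x))) \<in> ext_coboundaries R P M n"
          using Suc Pi.mhom_restrict[of n' "M" "\<lambda>x. g (H x)"] mhom_closed[OF PD(3)]
          by (auto intro!: image_eqI[of _ _ "restrict (\<lambda>x. g (H x)) (carrier (res_term P n'))"] restrict_ext)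
      qed
    qed
  qed
  then obtain h where "\<And>x. x \<in> carrier (res_term P (n + q)) \<Longrightarrow> g (D q x) = h x"
    "restrict h (carrier (res_term P (n + q))) \<in> ext_coboundaries R P M (n + q)" by blast
  moreover from this have "(\<lambda>x\<in>carrier (res_term P (n + q)). g (F q x) \<ominus>\<^bsub>M\<^esub> g (F' q x)) = restrict h (carrier (res_term P (n + q)))"
    using gD by (auto intro!: restrict_ext)
  ultimately show ?thesis by simp
qed

section \<open>Ext groups and Yoneda products\<close>

lemma mem_ext_cocycles:
  "f \<in> ext_cocycles R P M n \<longleftrightarrow> mhom R (res_term P n) M f \<and> f \<in> extensional (carrier (res_term P n)) \<and>
    (\<forall>x\<in>carrier (res_term P (Suc n)). f (res_diff P n x) = \<zero>\<^bsub>M\<^esub>)"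
  by (auto simp: ext_cocycles_def module_hom_iff)

lemma cocycle_closed: "f \<in> ext_cocycles R P M n \<Longrightarrow> x \<in> carrier (res_term P n) \<Longrightarrow> f x \<in> carrier M"
  using mhom_closed by (auto simp: mem_ext_cocycles)

locale ext_setting =
  fixes R :: "('r, 'c) ring_scheme" and A :: "('r, 'a) module" and P :: "('r, 'b, 'a) resolution"
  assumes A: "left_module R A" and P: "free_resolution R A P"
begin

lemmas PD = free_resolutionD[OF P]

lemma cocycle_restrictI:
  assumes M: "left_module R M" and f: "mhom R (res_term P n) M f"
    and d: "\<And>x. x \<in> carrier (res_term P (Suc n)) \<Longrightarrow> f (res_diff P n x) = \<zero>\<^bsub>M\<^esub>"
  shows "restrict f (carrier (res_term P n)) \<in> ext_cocycles R P M n"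
  using left_module.mhom_restrict[OF PD(2) f] d mhom_closed[OF PD(3)]
  by (simp add: mem_ext_cocycles module_hom_iff)

lemma zero_cocycle:
  assumes M: "left_module R M"
  shows "(\<lambda>x\<in>carrier (res_term P n). \<zero>\<^bsub>M\<^esub>) \<in> ext_cocycles R P M n"
  by (rule cocycle_restrictI[OF M mhom_const_zero[OF M]]) simp

lemma diff_cocycle:
  assumes M: "left_module R M" and "f \<in> ext_cocycles R P M n" "g \<in> ext_cocycles R P M n"
  shows "(\<lambda>x\<in>carrier (res_term P n). f x \<ominus>\<^bsub>M\<^esub> g x) \<in> ext_cocycles R P M n"
proof -
  interpret M: left_module R M by fact
  show ?thesis
    by (rule cocycle_restrictI[OF M mhom_diff[OF PD(2) M]]) (use assms in \<open>auto simp: mem_ext_cocycles\<close>)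
qed

lemma cocycle_group:
  assumes M: "left_module R M"
  shows "comm_group (ext_cocycle_group R P M n)"
proof -
  interpret M: left_module R M by fact
  let ?X = "carrier (res_term P n)"
  have cl: "f x \<in> carrier M" if "f \<in> ext_cocycles R P M n" "x \<in> carrier (res_term P n)" for f x
    by (rule cocycle_closed[OF that])
  have ext: "f = restrict g ?X" if "f \<in> ext_cocycles R P M n" "\<And>x. x \<in> ?X \<Longrightarrow> f x = g x" for f g
    using that by (auto simp: mem_ext_cocycles intro!: extensionalityI[of f ?X])
  have add: "(\<lambda>x\<in>?X. f x \<oplus>\<^bsub>M\<^esub> g x) \<in> ext_cocycles R P M n"
    if "f \<in> ext_cocycles R P M n" "g \<in> ext_cocycles R P M n" for f g
    by (rule cocycle_restrictI[OF M mhom_plus[OF PD(2) M]]) (use that in \<open>auto simp: mem_ext_cocycles\<close>)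
  show ?thesis
  proof (rule comm_groupI, simp_all add: ext_cocycle_group_def add zero_cocycle[OF M])
    fix f g h assume fgh: "f \<in> ext_cocycles R P M n" "g \<in> ext_cocycles R P M n" "h \<in> ext_cocycles R P M n"
    show "(\<lambda>x\<in>?X. (if x \<in> ?X then f x \<oplus>\<^bsub>M\<^esub> g x else undefined) \<oplus>\<^bsub>M\<^esub> h x) = 
      (\<lambda>x\<in>?X. f x \<oplus>\<^bsub>M\<^esub> (if x \<in> ?X then g x \<oplus>\<^bsub>M\<^esub> h x else undefined))"
      using cl fgh by (intro restrict_ext) (simp add: M.M.a_assoc)
  next
    fix f g assume "f \<in> ext_cocycles R P M n" "g \<in> ext_cocycles R P M n"
    then show "(\<lambda>x\<in>?X. f x \<oplus>\<^bsub>M\<^esub> g x) = (\<lambda>x\<in>?X. g x \<oplus>\<^bsub>M\<^esub> f x)"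
      using cl by (intro restrict_ext) (simp add: M.M.a_comm)
  next
    fix f assume f: "f \<in> ext_cocycles R P M n"
    then show "(\<lambda>x\<in>?X. (if x \<in> ?X then \<zero>\<^bsub>M\<^esub> else undefined) \<oplus>\<^bsub>M\<^esub> f x) = f"
      using cl by (intro ext[symmetric]) auto
    have "(\<lambda>x\<in>?X. \<zero>\<^bsub>M\<^esub> \<ominus>\<^bsub>M\<^esub> f x) \<in> ext_cocycles R P M n"
      using diff_cocycle[OF M zero_cocycle[OF M] f] by (simp cong: restrict_cong)
    then show "\<exists>g\<in>ext_cocycles R P M n. (\<lambda>x\<in>?X. g x \<oplus>\<^bsub>M\<^esub> f x) = (\<lambda>x\<in>?X. \<zero>\<^bsub>M\<^esub>)"
      using cl f by (intro bexI[of _ "\<lambda>x\<in>?X. \<zero>\<^bsub>M\<^esub> \<ominus>\<^bsub>M\<^esub> f x"]) (auto simp: M.minus_add_cancel intro!: restrict_ext)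
  qed
qed

lemma coboundary_cocycle:
  assumes M: "left_module R M" and f: "f \<in> ext_coboundaries R P M n"
  shows "f \<in> ext_cocycles R P M n"
proof (cases n)
  case 0
  then show ?thesis using f zero_cocycle[OF M] by simp
next
  case (Suc m)
  then obtain h where h: "h \<in> module_hom R (res_term P m) M" "f = (\<lambda>x\<in>carrier (res_term P n). h (res_diff P m x))"
    using f by auto
  show ?thesis
    unfolding h(2)
  proof (rule cocycle_restrictI[OF M])
    show "mhom R (res_term P n) M (\<lambda>x. h (res_diff P m x))"
      using mhom_comp[OF PD(3) module_homD[OF h(1)]] Suc by simp
    show "h (res_diff P m (res_diff P n x)) = \<zero>\<^bsub>M\<^esub>" if "x \<in> carrier (res_term P (Suc n))" for x
      using that PD(9)[of x m] mhom_zero[OF PD(2) M module_homD[OF h(1)]] Suc by simp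
  qed
qed

lemma coboundary_add_diff:
  assumes M: "left_module R M" and "f \<in> ext_coboundaries R P M n" "g \<in> ext_coboundaries R P M n"
  shows "(\<lambda>x\<in>carrier (res_term P n). f x \<oplus>\<^bsub>M\<^esub> g x) \<in> ext_coboundaries R P M n"
    and "(\<lambda>x\<in>carrier (res_term P n). f x \<ominus>\<^bsub>M\<^esub> g x) \<in> ext_coboundaries R P M n"
proof -
  interpret M: left_module R M by fact
  have "(\<lambda>x\<in>carrier (res_term P n). f x \<oplus>\<^bsub>M\<^esub> g x) \<in> ext_coboundaries R P M n \<and>
    (\<lambda>x\<in>carrier (res_term P n). f x \<ominus>\<^bsub>M\<^esub> g x) \<in> ext_coboundaries R P M n"
  proof (cases n)
    case 0
    then show ?thesis using assms by (auto cong: restrict_cong)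
  next
    case (Suc m)
    interpret Pm: left_module R "res_term P m" by (rule PD(2))
    let ?X = "carrier (res_term P m)"
    obtain h k where hk: "h \<in> module_hom R (res_term P m) M" "f = (\<lambda>x\<in>carrier (res_term P n). h (res_diff P m x))"
      "k \<in> module_hom R (res_term P m) M" "g = (\<lambda>x\<in>carrier (res_term P n). k (res_diff P m x))"
      using assms Suc by auto
    note hk' = module_homD[OF hk(1)] module_homD[OF hk(3)]
    have cb: "(\<lambda>x\<in>carrier (res_term P n). u (res_diff P m x)) \<in> ext_coboundaries R P M n" if "mhom R (res_term P m) M u" for u
      using Pm.mhom_restrict[OF that] mhom_closed[OF PD(3)] Suc
      by (auto intro!: image_eqI[of _ _ "restrict u ?X"] restrict_ext)
    show ?thesis
      using cb[OF mhom_plus[OF PD(2) M hk']] cb[OF mhom_diff[OF PD(2) M hk']] hk(2,4)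
      by (auto cong: restrict_cong)
  qed
  then show "(\<lambda>x\<in>carrier (res_term P n). f x \<oplus>\<^bsub>M\<^esub> g x) \<in> ext_coboundaries R P M n"
    "(\<lambda>x\<in>carrier (res_term P n). f x \<ominus>\<^bsub>M\<^esub> g x) \<in> ext_coboundaries R P M n" by blast+
qed

lemma zero_coboundary:
  assumes M: "left_module R M"
  shows "(\<lambda>x\<in>carrier (res_term P n). \<zero>\<^bsub>M\<^esub>) \<in> ext_coboundaries R P M n"
proof (cases n)
  case (Suc m)
  have "(\<lambda>x\<in>carrier (res_term P m). \<zero>\<^bsub>M\<^esub>) \<in> module_hom R (res_term P m) M"
    by (rule left_module.mhom_restrict[OF PD(2) mhom_const_zero[OF M]])
  then show ?thesis using Suc mhom_closed[OF PD(3)]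
    by (auto intro!: image_eqI[of _ _ "\<lambda>x\<in>carrier (res_term P m). \<zero>\<^bsub>M\<^esub>"] restrict_ext)
qed simp

lemma coboundary_subgroup:
  assumes M: "left_module R M"
  shows "subgroup (ext_coboundaries R P M n) (ext_cocycle_group R P M n)"
proof -
  interpret M: left_module R M by fact
  interpret Z: comm_group "ext_cocycle_group R P M n" by (rule cocycle_group[OF M])
  show ?thesis
  proof (rule Z.subgroupI)
    show "ext_coboundaries R P M n \<subseteq> carrier (ext_cocycle_group R P M n)"
      using coboundary_cocycle[OF M] by (auto simp: ext_cocycle_group_def)
    show "ext_coboundaries R P M n \<noteq> {}" using zero_coboundary[OF M] by blast
    fix f assume f: "f \<in> ext_coboundaries R P M n"
    have fc: "f \<in> ext_cocycles R P M n" by (rule coboundary_cocycle[OF M f])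
    have n: "(\<lambda>x\<in>carrier (res_term P n). \<zero>\<^bsub>M\<^esub> \<ominus>\<^bsub>M\<^esub> f x) \<in> ext_coboundaries R P M n"
      using coboundary_add_diff(2)[OF M zero_coboundary[OF M] f] by (simp cong: restrict_cong)
    have "inv\<^bsub>ext_cocycle_group R P M n\<^esub> f = (\<lambda>x\<in>carrier (res_term P n). \<zero>\<^bsub>M\<^esub> \<ominus>\<^bsub>M\<^esub> f x)"
      using fc coboundary_cocycle[OF M n] cocycle_closed[OF fc]
      by (intro Z.inv_equality) (auto simp: ext_cocycle_group_def M.minus_add_cancel intro!: restrict_ext)
    then show "inv\<^bsub>ext_cocycle_group R P M n\<^esub> f \<in> ext_coboundaries R P M n" using n by simp
    fix g assume "g \<in> ext_coboundaries R P M n"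
    then show "f \<otimes>\<^bsub>ext_cocycle_group R P M n\<^esub> g \<in> ext_coboundaries R P M n"
      using coboundary_add_diff(1)[OF M f] by (simp add: ext_cocycle_group_def)
  qed
qed

lemma Ext_comm_group: "left_module R M \<Longrightarrow> comm_group (Ext R P M n)"
  unfolding Ext_def by (intro comm_group.abelian_FactGroup cocycle_group coboundary_subgroup)

lemma Ext_carrier: "carrier (Ext R P M n) = ext_class R P M n ` ext_cocycles R P M n"
  by (simp add: Ext_def carrier_FactGroup ext_class_def ext_cocycle_group_def image_def)

lemma Ext_one: "\<one>\<^bsub>Ext R P M n\<^esub> = ext_coboundaries R P M n"
  by (simp add: Ext_def)

text \<open>Membership in a coset, translated into the pointwise difference of two cocycles, the
  form in which the comparison theorem speaks of coboundaries.\<close>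

lemma mem_ext_class:
  assumes M: "left_module R M" and f: "f \<in> ext_cocycles R P M n"
  shows "h \<in> ext_class R P M n f \<longleftrightarrow> h \<in> ext_cocycles R P M n \<and>
    (\<lambda>x\<in>carrier (res_term P n). h x \<ominus>\<^bsub>M\<^esub> f x) \<in> ext_coboundaries R P M n"
proof -
  interpret M: left_module R M by fact
  have cl: "f x \<in> carrier M" if "f \<in> ext_cocycles R P M n" "x \<in> carrier (res_term P n)" for f x
    by (rule cocycle_closed[OF that])
  show ?thesis
  proof
    assume "h \<in> ext_class R P M n f"
    then obtain b where b: "b \<in> ext_coboundaries R P M n" "h = b \<otimes>\<^bsub>ext_cocycle_group R P M n\<^esub> f"
      by (auto simp: ext_class_def r_coset_def)
    note bc = coboundary_cocycle[OF M b(1)]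
    have "h \<in> carrier (ext_cocycle_group R P M n)"
      unfolding b(2) using cocycle_group[OF M] bc f
      by (intro monoid.m_closed) (auto simp: ext_cocycle_group_def comm_group_def comm_monoid_def)
    moreover have "(\<lambda>x\<in>carrier (res_term P n). h x \<ominus>\<^bsub>M\<^esub> f x) = b"
    proof (rule extensionalityI[of _ "carrier (res_term P n)"])
      show "b \<in> extensional (carrier (res_term P n))" using bc by (simp add: mem_ext_cocycles)
      fix x assume x: "x \<in> carrier (res_term P n)"
      then show "(\<lambda>x\<in>carrier (res_term P n). h x \<ominus>\<^bsub>M\<^esub> f x) x = b x"
        using cl[OF bc x] cl[OF f x] M.add_minus_add[of "b x" "f x" "\<zero>\<^bsub>M\<^esub>" "f x"]
        by (simp add: b(2) ext_cocycle_group_def)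
    qed simp
    ultimately show "h \<in> ext_cocycles R P M n \<and> (\<lambda>x\<in>carrier (res_term P n). h x \<ominus>\<^bsub>M\<^esub> f x) \<in> ext_coboundaries R P M n"
      using b(1) by (simp add: ext_cocycle_group_def)
  next
    assume h: "h \<in> ext_cocycles R P M n \<and> (\<lambda>x\<in>carrier (res_term P n). h x \<ominus>\<^bsub>M\<^esub> f x) \<in> ext_coboundaries R P M n"
    have "h = (\<lambda>x\<in>carrier (res_term P n). (h x \<ominus>\<^bsub>M\<^esub> f x) \<oplus>\<^bsub>M\<^esub> f x)"
      using h cl f by (intro extensionalityI[of h "carrier (res_term P n)"]) (auto simp: mem_ext_cocycles M.minus_add_cancel)
    also have "\<dots> = (\<lambda>x\<in>carrier (res_term P n). h x \<ominus>\<^bsub>M\<^esub> f x) \<otimes>\<^bsub>ext_cocycle_group R P M n\<^esub> f"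
      by (auto simp: ext_cocycle_group_def intro!: restrict_ext)
    finally show "h \<in> ext_class R P M n f"
      using h by (auto simp: ext_class_def r_coset_def)
  qed
qed

lemma ext_class_self:
  assumes M: "left_module R M" and f: "f \<in> ext_cocycles R P M n"
  shows "f \<in> ext_class R P M n f"
proof -
  interpret M: left_module R M by fact
  have "(\<lambda>x\<in>carrier (res_term P n). f x \<ominus>\<^bsub>M\<^esub> f x) = (\<lambda>x\<in>carrier (res_term P n). \<zero>\<^bsub>M\<^esub>)"
    using cocycle_closed[OF f] by (intro restrict_ext) simp
  then show ?thesis using f zero_coboundary[OF M] by (simp add: mem_ext_class[OF M f])
qed

lemma ext_class_eqI:
  assumes M: "left_module R M" and f: "f \<in> ext_cocycles R P M n" "h \<in> ext_cocycles R P M n"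
    and "(\<lambda>x\<in>carrier (res_term P n). h x \<ominus>\<^bsub>M\<^esub> f x) \<in> ext_coboundaries R P M n"
  shows "ext_class R P M n h = ext_class R P M n f"
proof -
  interpret Z: comm_group "ext_cocycle_group R P M n" by (rule cocycle_group[OF M])
  have "h \<in> ext_class R P M n f" using assms mem_ext_class[OF M f(1)] by blast
  then show ?thesis
    unfolding ext_class_def using f coboundary_subgroup[OF M]
    by (intro Z.repr_independence[symmetric]) (auto simp: ext_cocycle_group_def)
qed

lemma ext_class_zero:
  assumes M: "left_module R M"
  shows "ext_class R P M n (\<lambda>x\<in>carrier (res_term P n). \<zero>\<^bsub>M\<^esub>) = \<one>\<^bsub>Ext R P M n\<^esub>"
proof -
  interpret Z: comm_group "ext_cocycle_group R P M n" by (rule cocycle_group[OF M])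
  have "ext_class R P M n \<one>\<^bsub>ext_cocycle_group R P M n\<^esub> = ext_coboundaries R P M n"
    unfolding ext_class_def using coboundary_subgroup[OF M] Z.coset_mult_one subgroup.subset by blast
  then show ?thesis by (simp add: Ext_one ext_cocycle_group_def)
qed

lemma ext_class_add:
  assumes M: "left_module R M" and f: "f \<in> ext_cocycles R P M n" "g \<in> ext_cocycles R P M n"
  shows "ext_class R P M n f \<otimes>\<^bsub>Ext R P M n\<^esub> ext_class R P M n g =
    ext_class R P M n (\<lambda>x\<in>carrier (res_term P n). f x \<oplus>\<^bsub>M\<^esub> g x)"
proof -
  interpret Z: comm_group "ext_cocycle_group R P M n" by (rule cocycle_group[OF M])
  interpret N: normal "ext_coboundaries R P M n" "ext_cocycle_group R P M n"
    using coboundary_subgroup[OF M] by (rule Z.normal_iff_subgroup[THEN iffD2])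
  have "f \<in> carrier (ext_cocycle_group R P M n)" "g \<in> carrier (ext_cocycle_group R P M n)"
    using f by (simp_all add: ext_cocycle_group_def)
  from N.rcos_sum[OF this] show ?thesis
    by (simp add: ext_class_def Ext_def) (simp add: ext_cocycle_group_def)
qed

end

section \<open>Pulling cocycles back along chain maps\<close>

lemma pull_cocycle:
  assumes A: "left_module R A" and M: "left_module R M"
    and P: "free_resolution R A P" and Q: "free_resolution R A Q"
    and F: "chain_map_over R P Q n f F" and g: "g \<in> ext_cocycles R Q M q"
  shows "(\<lambda>x\<in>carrier (res_term P (n + q)). g (F q x)) \<in> ext_cocycles R P M (n + q)"
proof -
  interpret P: ext_setting R A P by (rule ext_setting.intro[OF A P])
  note QD = free_resolutionD[OF Q]
  have Fh: "mhom R (res_term P (n + i)) (res_term Q i) (F i)" for i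
    using F by (auto simp: chain_map_over_def module_hom_iff)
  show ?thesis
  proof (rule P.cocycle_restrictI[OF M])
    show "mhom R (res_term P (n + q)) M (\<lambda>x. g (F q x))"
      using mhom_comp[OF Fh, of q M g] g by (simp add: mem_ext_cocycles)
    fix x assume x: "x \<in> carrier (res_term P (Suc (n + q)))"
    then have "F q (res_diff P (n + q) x) = res_diff Q q (F (Suc q) x)" using F by (simp add: chain_map_over_def)
    moreover have "F (Suc q) x \<in> carrier (res_term Q (Suc q))" using mhom_closed[OF Fh[of "Suc q"]] x by simp
    ultimately show "g (F q (res_diff P (n + q) x)) = \<zero>\<^bsub>M\<^esub>" using g by (simp add: mem_ext_cocycles)
  qed
qed

lemma pull_coboundary:
  assumes A: "left_module R A" and M: "left_module R M"
    and P: "free_resolution R A P" and Q: "free_resolution R A Q"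
    and F: "chain_map_over R P Q n f F" and g: "g \<in> ext_coboundaries R Q M q"
  shows "(\<lambda>x\<in>carrier (res_term P (n + q)). g (F q x)) \<in> ext_coboundaries R P M (n + q)"
proof -
  interpret P: ext_setting R A P by (rule ext_setting.intro[OF A P])
  have Fh: "mhom R (res_term P (n + i)) (res_term Q i) (F i)" for i
    using F by (auto simp: chain_map_over_def module_hom_iff)
  show ?thesis
  proof (cases q)
    case 0
    then have "(\<lambda>x\<in>carrier (res_term P (n + q)). g (F q x)) = (\<lambda>x\<in>carrier (res_term P (n + q)). \<zero>\<^bsub>M\<^esub>)"
      using g mhom_closed[OF Fh[of 0]] by (intro restrict_ext) simp
    then show ?thesis using P.zero_coboundary[OF M] by simp
  next
    case (Suc i)
    then obtain h where h: "h \<in> module_hom R (res_term Q i) M" "g = (\<lambda>x\<in>carrier (res_term Q q). h (res_diff Q i x))"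
      using g by auto
    have "restrict (\<lambda>x. h (F i x)) (carrier (res_term P (n + i))) \<in> module_hom R (res_term P (n + i)) M"
      using left_module.mhom_restrict[OF P.PD(2) mhom_comp[OF Fh module_homD[OF h(1)]]] by simp
    moreover have "g (F q x) = h (F i (res_diff P (n + i) x))" if "x \<in> carrier (res_term P (Suc (n + i)))" for x
      using that F mhom_closed[OF Fh[of q]] Suc by (simp add: h(2) chain_map_over_def)
    ultimately show ?thesis
      using Suc mhom_closed[OF P.PD(3)]
      by (auto intro!: image_eqI[of _ _ "restrict (\<lambda>x. h (F i x)) (carrier (res_term P (n + i)))"] restrict_ext)
  qed
qed

text \<open>A change of \<open>g\<close> by a coboundary is pulled back to a coboundary, and a
  change of the chain map is covered by \<open>chain_map_unique\<close>. For \<open>Q = P\<close>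
  this is the independence of choices in the Yoneda product.\<close>

lemma pull_class_eq:
  assumes A: "left_module R A" and M: "left_module R M"
    and P: "free_resolution R A P" and Q: "free_resolution R A Q"
    and F: "chain_map_over R P Q n f F" "chain_map_over R P Q n f' F'"
    and f: "mhom R (res_term P n) A f" "mhom R (res_term P n) A f'"
    and ff': "(\<lambda>x\<in>carrier (res_term P n). f x \<ominus>\<^bsub>A\<^esub> f' x) \<in> ext_coboundaries R P A n"
    and g: "g \<in> ext_cocycles R Q M q" "g' \<in> ext_cocycles R Q M q"
    and gg': "(\<lambda>x\<in>carrier (res_term Q q). g x \<ominus>\<^bsub>M\<^esub> g' x) \<in> ext_coboundaries R Q M q"
  shows "ext_class R P M (n + q) (\<lambda>x\<in>carrier (res_term P (n + q)). g (F q x)) =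
    ext_class R P M (n + q) (\<lambda>x\<in>carrier (res_term P (n + q)). g' (F' q x))"
proof -
  interpret P: ext_setting R A P by (rule ext_setting.intro[OF A P])
  have Fh: "mhom R (res_term P (n + i)) (res_term Q i) (F i)" for i
    using F by (auto simp: chain_map_over_def module_hom_iff)
  have "ext_class R P M (n + q) (\<lambda>x\<in>carrier (res_term P (n + q)). g (F q x)) =
    ext_class R P M (n + q) (\<lambda>x\<in>carrier (res_term P (n + q)). g' (F q x))"
    using pull_coboundary[OF A M P Q F(1) gg'] mhom_closed[OF Fh]
    by (intro P.ext_class_eqI[OF M] pull_cocycle[OF A M P Q F(1)] g) (simp cong: restrict_cong)
  also have "\<dots> = ext_class R P M (n + q) (\<lambda>x\<in>carrier (res_term P (n + q)). g' (F' q x))"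
    using chain_map_unique[OF A M P Q F f ff' g(2)]
    by (intro P.ext_class_eqI[OF M] pull_cocycle[OF A M P Q F(1)] pull_cocycle[OF A M P Q F(2)] g) (simp cong: restrict_cong)
  finally show ?thesis .
qed

section \<open>The Yoneda product on Ext groups and on their direct sum\<close>

context ext_setting
begin

lemma yoneda_class:
  assumes M: "left_module R M" and g: "g \<in> ext_cocycles R P M q" and f: "f \<in> ext_cocycles R P A n"
    and F: "chain_lift R P n f F"
  shows "yoneda_prod R P M q n (ext_class R P M q g) (ext_class R P A n f) =
    ext_class R P M (n + q) (\<lambda>x\<in>carrier (res_term P (n + q)). g (F q x))"
proof -
  have "ext_class R P M (n + q) (\<lambda>x\<in>carrier (res_term P (n + q)). g' (F' q x)) =
    ext_class R P M (n + q) (\<lambda>x\<in>carrier (res_term P (n + q)). g (F q x))"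
    if "g' \<in> ext_class R P M q g" "f' \<in> ext_class R P A n f" "chain_lift R P n f' F'" for g' f' F'
  proof (rule pull_class_eq[OF A M P P])
    show "chain_map_over R P P n f' F'" "chain_map_over R P P n f F"
      using that(3) F by (simp_all add: chain_lift_iff)
    show "mhom R (res_term P n) A f'" "mhom R (res_term P n) A f"
      using that(2) f by (simp_all add: mem_ext_class[OF A f]) (simp_all add: mem_ext_cocycles)
  qed (use that g in \<open>simp_all add: mem_ext_class[OF A f] mem_ext_class[OF M g]\<close>)
  then show ?thesis
    unfolding yoneda_prod_def
    using ext_class_self[OF M g] ext_class_self[OF A f] F by blast
qed

lemma lift_exists:
  assumes "f \<in> ext_cocycles R P A n" obtains F where "chain_lift R P n f F"
  using chain_map_exists[OF A P P assms] by (auto simp: chain_lift_iff)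

lemma yoneda_closed:
  assumes M: "left_module R M" and "U \<in> carrier (Ext R P M q)" "V \<in> carrier (Ext R P A n)"
  shows "yoneda_prod R P M q n U V \<in> carrier (Ext R P M (n + q))"
proof -
  obtain g f where gf: "g \<in> ext_cocycles R P M q" "U = ext_class R P M q g" "f \<in> ext_cocycles R P A n" "V = ext_class R P A n f"
    using assms by (auto simp: Ext_carrier)
  obtain F where F: "chain_lift R P n f F" using lift_exists[OF gf(3)] .
  show ?thesis
    using yoneda_class[OF M gf(1,3) F] pull_cocycle[OF A M P P _ gf(1), of n f F] F gf
    by (auto simp: Ext_carrier chain_lift_iff)
qed

lemma yoneda_zero_left:
  assumes M: "left_module R M" and V: "V \<in> carrier (Ext R P A n)"
  shows "yoneda_prod R P M q n \<one>\<^bsub>Ext R P M q\<^esub> V = \<one>\<^bsub>Ext R P M (n + q)\<^esub>"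
proof -
  obtain f where f: "f \<in> ext_cocycles R P A n" "V = ext_class R P A n f"
    using assms by (auto simp: Ext_carrier)
  obtain F where F: "chain_lift R P n f F" using lift_exists[OF f(1)] .
  have "mhom R (res_term P (n + q)) (res_term P q) (F q)" 
    using F by (simp add: chain_lift_def module_hom_iff)
  then have "(\<lambda>x\<in>carrier (res_term P (n + q)). (\<lambda>x\<in>carrier (res_term P q). \<zero>\<^bsub>M\<^esub>) (F q x)) = (\<lambda>x\<in>carrier (res_term P (n + q)). \<zero>\<^bsub>M\<^esub>)"
    using mhom_closed by (intro restrict_ext) fastforce
  then show ?thesis
    using yoneda_class[OF M zero_cocycle[OF M] f(1) F] f(2) by (simp add: ext_class_zero[OF M])
qed

lemma yoneda_zero_right:
  assumes M: "left_module R M" and U: "U \<in> carrier (Ext R P M q)"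
  shows "yoneda_prod R P M q n U \<one>\<^bsub>Ext R P A n\<^esub> = \<one>\<^bsub>Ext R P M (n + q)\<^esub>"
proof -
  obtain g where g: "g \<in> ext_cocycles R P M q" "U = ext_class R P M q g"
    using assms by (auto simp: Ext_carrier)
  let ?F = "\<lambda>i. \<lambda>x\<in>carrier (res_term P (n + i)). \<zero>\<^bsub>res_term P i\<^esub>"
  have F: "chain_lift R P n (\<lambda>x\<in>carrier (res_term P n). \<zero>\<^bsub>A\<^esub>) ?F"
    unfolding chain_lift_def
  proof (intro conjI allI ballI)
    show "?F i \<in> module_hom R (res_term P (n + i)) (res_term P i)" for i
      by (rule left_module.mhom_restrict[OF PD(2) mhom_const_zero[OF PD(2)]])
  next
    fix x assume "x \<in> carrier (res_term P n)"
    then show "res_aug P (?F 0 x) = (\<lambda>x\<in>carrier (res_term P n). \<zero>\<^bsub>A\<^esub>) x"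
      using mhom_zero[OF PD(2) A PD(4)] by simp
  next
    fix i x assume "x \<in> carrier (res_term P (Suc (n + i)))"
    then show "res_diff P i (?F (Suc i) x) = ?F i (res_diff P (n + i) x)"
      using mhom_zero[OF PD(2) PD(2) PD(3)] mhom_closed[OF PD(3)] by simp
  qed
  have "(\<lambda>x\<in>carrier (res_term P (n + q)). g (?F q x)) = (\<lambda>x\<in>carrier (res_term P (n + q)). \<zero>\<^bsub>M\<^esub>)"
    using mhom_zero[OF PD(2) M] g(1) by (intro restrict_ext) (simp add: mem_ext_cocycles)
  then show ?thesis
    using yoneda_class[OF M g(1) zero_cocycle[OF A] F] g(2) by (simp add: ext_class_zero[OF M] ext_class_zero[OF A])
qed

lemma ext_sum_group:
  assumes M: "left_module R M"
  shows "comm_group \<lparr>carrier = ext_sum_carrier R P M, monoid.mult = (\<lambda>x y n. x n \<otimes>\<^bsub>Ext R P M n\<^esub> y n),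
    one = (\<lambda>n. \<one>\<^bsub>Ext R P M n\<^esub>)\<rparr>"
proof -
  interpret E: comm_group "Ext R P M n" for n by (rule Ext_comm_group[OF M])
  show ?thesis
  proof (rule comm_groupI, simp_all)
    fix x y assume "x \<in> ext_sum_carrier R P M" "y \<in> ext_sum_carrier R P M"
    then have x: "\<And>n. x n \<in> carrier (Ext R P M n)" "finite {n. x n \<noteq> \<one>\<^bsub>Ext R P M n\<^esub>}"
      and y: "\<And>n. y n \<in> carrier (Ext R P M n)" "finite {n. y n \<noteq> \<one>\<^bsub>Ext R P M n\<^esub>}"
      by (auto simp: ext_sum_carrier_def)
    have "finite {n. x n \<otimes>\<^bsub>Ext R P M n\<^esub> y n \<noteq> \<one>\<^bsub>Ext R P M n\<^esub>}"
      by (rule finite_subset[OF _ finite_UnI[OF x(2) y(2)]]) auto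
    then show "(\<lambda>n. x n \<otimes>\<^bsub>Ext R P M n\<^esub> y n) \<in> ext_sum_carrier R P M"
      using x y by (simp add: ext_sum_carrier_def)
    show "(\<lambda>n. x n \<otimes>\<^bsub>Ext R P M n\<^esub> y n) = (\<lambda>n. y n \<otimes>\<^bsub>Ext R P M n\<^esub> x n)"
      using x y by (intro ext E.m_comm)
    show "(\<lambda>n. x n \<otimes>\<^bsub>Ext R P M n\<^esub> y n \<otimes>\<^bsub>Ext R P M n\<^esub> z n) = (\<lambda>n. x n \<otimes>\<^bsub>Ext R P M n\<^esub> (y n \<otimes>\<^bsub>Ext R P M n\<^esub> z n))"
      if "z \<in> ext_sum_carrier R P M" for z
      using x y that by (intro ext E.m_assoc) (auto simp: ext_sum_carrier_def)
    show "(\<lambda>n. \<one>\<^bsub>Ext R P M n\<^esub> \<otimes>\<^bsub>Ext R P M n\<^esub> x n) = x" using x by simp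
    have "finite {n. inv\<^bsub>Ext R P M n\<^esub> x n \<noteq> \<one>\<^bsub>Ext R P M n\<^esub>}"
    proof (rule finite_subset[OF _ x(2)], rule subsetI)
      fix n assume "n \<in> {n. inv\<^bsub>Ext R P M n\<^esub> x n \<noteq> \<one>\<^bsub>Ext R P M n\<^esub>}"
      then show "n \<in> {n. x n \<noteq> \<one>\<^bsub>Ext R P M n\<^esub>}"
        using E.inv_one[of n] by (metis (mono_tags, lifting) mem_Collect_eq)
    qed
    then show "\<exists>y\<in>ext_sum_carrier R P M. (\<lambda>n. y n \<otimes>\<^bsub>Ext R P M n\<^esub> x n) = (\<lambda>n. \<one>\<^bsub>Ext R P M n\<^esub>)"
      using x by (intro bexI[of _ "\<lambda>n. inv\<^bsub>Ext R P M n\<^esub> x n"]) (auto simp: ext_sum_carrier_def)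
  qed (simp add: ext_sum_carrier_def)
qed

lemma yoneda_closed':
  assumes "left_module R M" "q \<le> m" "U \<in> carrier (Ext R P M q)" "V \<in> carrier (Ext R P A (m - q))"
  shows "yoneda_prod R P M q (m - q) U V \<in> carrier (Ext R P M m)"
  using yoneda_closed[OF assms(1,3,4)] assms(2) by simp

text \<open>Beyond the sum of degree bounds for \<open>x\<close> and \<open>y\<close>, each Yoneda
  product in the sum has a trivial factor.\<close>

lemma ext_sum_prod_closed:
  assumes M: "left_module R M" and "x \<in> ext_sum_carrier R P M" "y \<in> ext_sum_carrier R P A"
  shows "ext_sum_prod R P M x y \<in> ext_sum_carrier R P M"
proof -
  interpret E: comm_group "Ext R P M n" for n by (rule Ext_comm_group[OF M])
  have x: "\<And>n. x n \<in> carrier (Ext R P M n)" "finite {n. x n \<noteq> \<one>\<^bsub>Ext R P M n\<^esub>}"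
    and y: "\<And>n. y n \<in> carrier (Ext R P A n)" "finite {n. y n \<noteq> \<one>\<^bsub>Ext R P A n\<^esub>}"
    using assms by (auto simp: ext_sum_carrier_def)
  obtain k where k: "\<And>n. n > k \<Longrightarrow> x n = \<one>\<^bsub>Ext R P M n\<^esub>"
    using x(2) unfolding finite_nat_set_iff_bounded_le by (metis (mono_tags, lifting) mem_Collect_eq not_le)
  obtain l where l: "\<And>n. n > l \<Longrightarrow> y n = \<one>\<^bsub>Ext R P A n\<^esub>"
    using y(2) unfolding finite_nat_set_iff_bounded_le by (metis (mono_tags, lifting) mem_Collect_eq not_le)
  have cl: "yoneda_prod R P M q (m - q) (x q) (y (m - q)) \<in> carrier (Ext R P M m)" if "q \<le> m" for q m
    by (rule yoneda_closed'[OF M that x(1) y(1)])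
  have "ext_sum_prod R P M x y m = \<one>\<^bsub>Ext R P M m\<^esub>" if m: "m > k + l" for m
    unfolding ext_sum_prod_def
  proof (rule E.finprod_one_eqI)
    fix q assume q: "q \<in> {..m}"
    then consider "q > k" | "m - q > l" using m by fastforce
    then show "yoneda_prod R P M q (m - q) (x q) (y (m - q)) = \<one>\<^bsub>Ext R P M m\<^esub>"
      using yoneda_zero_left[OF M y(1), of q "m - q"] yoneda_zero_right[OF M x(1), of q "m - q"] q k l
      by cases auto
  qed
  then have "{m. ext_sum_prod R P M x y m \<noteq> \<one>\<^bsub>Ext R P M m\<^esub>} \<subseteq> {..k + l}" by (auto simp: not_less[symmetric])
  then have "finite {m. ext_sum_prod R P M x y m \<noteq> \<one>\<^bsub>Ext R P M m\<^esub>}" by (rule finite_subset) simp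
  moreover have "ext_sum_prod R P M x y m \<in> carrier (Ext R P M m)" for m
    unfolding ext_sum_prod_def using cl by (intro E.finprod_closed) auto
  ultimately show ?thesis by (simp add: ext_sum_carrier_def)
qed

text \<open>Only the term with \<open>m - q = d\<close> survives. In this form the multiplication by
  a single homogeneous class is compared with an operator on cochains.\<close>

lemma ext_sum_prod_homogeneous:
  assumes M: "left_module R M" and x: "x \<in> ext_sum_carrier R P M" and V: "V \<in> carrier (Ext R P A d)"
  shows "ext_sum_prod R P M x (\<lambda>n. if n = d then V else \<one>\<^bsub>Ext R P A n\<^esub>) m =
    (if d \<le> m then yoneda_prod R P M (m - d) d (x (m - d)) V else \<one>\<^bsub>Ext R P M m\<^esub>)"
proof -
  interpret E: comm_group "Ext R P M n" for n by (rule Ext_comm_group[OF M])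
  interpret EA: comm_group "Ext R P A n" for n by (rule Ext_comm_group[OF A])
  have x: "\<And>n. x n \<in> carrier (Ext R P M n)" using x by (auto simp: ext_sum_carrier_def)
  define t where "t q = yoneda_prod R P M q (m - q) (x q) (if m - q = d then V else \<one>\<^bsub>Ext R P A (m - q)\<^esub>)" for q
  have t: "t q \<in> carrier (Ext R P M m)" if "q \<le> m" for q
    unfolding t_def using V that by (intro yoneda_closed'[OF M] x) auto
  have t1: "t q = \<one>\<^bsub>Ext R P M m\<^esub>" if "q \<le> m" "m - q \<noteq> d" for q
    using yoneda_zero_right[OF M x, of q "m - q"] that by (simp add: t_def)
  have "(\<Otimes>\<^bsub>Ext R P M m\<^esub>q\<in>{..m}. t q) = (if d \<le> m then t (m - d) else \<one>\<^bsub>Ext R P M m\<^esub>)"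
  proof (cases "d \<le> m")
    case True
    have "(\<Otimes>\<^bsub>Ext R P M m\<^esub>q\<in>{..m}. t q) = (\<Otimes>\<^bsub>Ext R P M m\<^esub>q\<in>{..m}. if m - d = q then t q else \<one>\<^bsub>Ext R P M m\<^esub>)"
      using t t1 True by (intro E.finprod_cong') auto
    also have "\<dots> = t (m - d)" using t True by (intro E.finprod_singleton) auto
    finally show ?thesis using True by simp
  next
    case False
    then show ?thesis using t1 by (auto intro!: E.finprod_one_eqI)
  qed
  then show ?thesis by (auto simp: ext_sum_prod_def t_def)
qed

end

section \<open>The group action on the complex\<close>

definition linear_op :: "(chain \<Rightarrow> chain) \<Rightarrow> bool" where
  "linear_op L \<longleftrightarrow> (\<forall>a b f g. L (\<lambda>m c. a * f m c + b * g m c) = (\<lambda>m c. a * L f m c + b * L g m c))"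

lemma linear_opD: "linear_op L \<Longrightarrow> L (\<lambda>m c. a * f m c + b * g m c) = (\<lambda>m c. a * L f m c + b * L g m c)"
  by (simp add: linear_op_def)

lemma linear_op_add: "linear_op L \<Longrightarrow> L (\<lambda>m c. f m c + g m c) = (\<lambda>m c. L f m c + L g m c)"
  using linear_opD[of L 1 f 1 g] by simp

lemma linear_op_diff: "linear_op L \<Longrightarrow> L (\<lambda>m c. f m c - g m c) = (\<lambda>m c. L f m c - L g m c)"
  using linear_opD[of L 1 f "- 1" g] by simp

lemma linear_op_zero: "linear_op L \<Longrightarrow> L (\<lambda>m c. 0) = (\<lambda>m c. 0)"
  using linear_opD[of L 0 "\<lambda>m c. 0" 0 "\<lambda>m c. 0"] by simp

lemma linear_op_sum:
  assumes "linear_op L" "finite I"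
  shows "L (\<lambda>m c. \<Sum>i\<in>I. a i * F i m c) = (\<lambda>m c. \<Sum>i\<in>I. a i * L (F i) m c)"
  using assms(2)
proof induction
  case (insert i I)
  then show ?case using linear_opD[OF assms(1), of "a i" "F i" 1 "\<lambda>m c. \<Sum>i\<in>I. a i * F i m c"] by simp
qed (simp add: linear_op_zero[OF assms(1)])

lemma linear_op_sum':
  assumes "linear_op L" "finite I"
  shows "L (\<lambda>m c. \<Sum>i\<in>I. F i m c) = (\<lambda>m c. \<Sum>i\<in>I. L (F i) m c)"
  using linear_op_sum[OF assms, of "\<lambda>_. 1" F] by simp

text \<open>The Koszul sign of permuting by \<open>\<rho>\<close> the factors of a tensor product; \<open>S\<close> is the set of odd positions.\<close>

definition rsign :: "(nat \<Rightarrow> nat) \<Rightarrow> nat set \<Rightarrow> int" where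
  "rsign \<rho> S = (\<Prod>j\<in>S. \<Prod>i\<in>{i \<in> S. i < j}. sgn (int (\<rho> j) - int (\<rho> i)))"

text \<open>A pair of positions contributes \<open>sgn (\<rho> j - \<rho> i) * sgn (j - i)\<close>
  whichever of the two is larger, so the place of \<open>j\<close> within \<open>S\<close> does not
  matter.\<close>

lemma rsign_insert:
  assumes "finite S" "j \<notin> S"
  shows "rsign \<rho> (insert j S) = rsign \<rho> S * (\<Prod>i\<in>S. sgn (int (\<rho> j) - int (\<rho> i)) * sgn (int j - int i))"
proof -
  have 1: "(\<Prod>i\<in>{i \<in> insert j S. i < k}. sgn (int (\<rho> k) - int (\<rho> i)))
      = (\<Prod>i\<in>{i \<in> S. i < k}. sgn (int (\<rho> k) - int (\<rho> i))) * (if j < k then sgn (int (\<rho> k) - int (\<rho> j)) else 1)" for k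
  proof (cases "j < k")
    case True
    then have "{i \<in> insert j S. i < k} = insert j {i \<in> S. i < k}" by auto
    then show ?thesis using assms True by (simp add: mult.commute)
  next
    case False
    then have "{i \<in> insert j S. i < k} = {i \<in> S. i < k}" by auto
    then show ?thesis using False by simp
  qed
  have 2: "(\<Prod>i\<in>{i \<in> S. i < j}. sgn (int (\<rho> j) - int (\<rho> i))) = (\<Prod>i\<in>S. if i < j then sgn (int (\<rho> j) - int (\<rho> i)) else 1)"
    using assms(1) by (simp add: prod.If_cases Int_def)
  have 3: "(if j < i then sgn (int (\<rho> i) - int (\<rho> j)) else 1) * (if i < j then sgn (int (\<rho> j) - int (\<rho> i)) else 1)
    = sgn (int (\<rho> j) - int (\<rho> i)) * sgn (int j - int i)" if "i \<in> S" for i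
  proof -
    have "i \<noteq> j" using that assms by auto
    then show ?thesis by (auto simp: sgn_if)
  qed
  have "rsign \<rho> (insert j S) = (\<Prod>i\<in>{i \<in> S. i < j}. sgn (int (\<rho> j) - int (\<rho> i))) *
    (rsign \<rho> S * (\<Prod>k\<in>S. if j < k then sgn (int (\<rho> k) - int (\<rho> j)) else 1))"
    unfolding rsign_def using assms by (simp add: 1 prod.distrib del: insert_iff)
  also have "\<dots> = rsign \<rho> S * (\<Prod>i\<in>S. (if j < i then sgn (int (\<rho> i) - int (\<rho> j)) else 1) * (if i < j then sgn (int (\<rho> j) - int (\<rho> i)) else 1))"
    unfolding 2 by (simp add: prod.distrib mult_ac)
  finally show ?thesis using 3 by simp
qed

lemma rsign_empty [simp]: "rsign \<rho> {} = 1"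
  by (simp add: rsign_def)

lemma sgn_sq: "(x::int) \<noteq> 0 \<Longrightarrow> sgn x * sgn x = 1"
  by (auto simp: sgn_if)

text \<open>By \<open>rsign_insert\<close> the factor \<open>sgn (\<tau> j - \<tau> i)\<close>
  occurs once in each of the two signs on the right, and cancels.\<close>

lemma rsign_comp:
  assumes "finite S" "inj \<tau>"
  shows "rsign (\<lambda>j. \<sigma> (\<tau> j)) S = rsign \<sigma> (\<tau> ` S) * rsign \<tau> S"
  using assms(1)
proof induction
  case (insert j S)
  have j: "\<tau> j \<notin> \<tau> ` S" using insert assms(2) by (auto simp: inj_def)
  have "(\<Prod>i\<in>\<tau> ` S. sgn (int (\<sigma> (\<tau> j)) - int (\<sigma> i)) * sgn (int (\<tau> j) - int i)) *
      (\<Prod>i\<in>S. sgn (int (\<tau> j) - int (\<tau> i)) * sgn (int j - int i))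
    = (\<Prod>i\<in>S. (sgn (int (\<sigma> (\<tau> j)) - int (\<sigma> (\<tau> i))) * sgn (int (\<tau> j) - int (\<tau> i))) *
      (sgn (int (\<tau> j) - int (\<tau> i)) * sgn (int j - int i)))"
    using assms(2) by (subst prod.reindex) (auto simp: prod.distrib inj_on_def inj_def)
  also have "\<dots> = (\<Prod>i\<in>S. sgn (int (\<sigma> (\<tau> j)) - int (\<sigma> (\<tau> i))) * sgn (int j - int i))"
  proof (rule prod.cong)
    fix i assume "i \<in> S"
    then have "\<tau> j \<noteq> \<tau> i" using j by auto
    then have "sgn (int (\<tau> j) - int (\<tau> i)) * sgn (int (\<tau> j) - int (\<tau> i)) = 1" by (intro sgn_sq) simp
    then show "sgn (int (\<sigma> (\<tau> j)) - int (\<sigma> (\<tau> i))) * sgn (int (\<tau> j) - int (\<tau> i)) *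
      (sgn (int (\<tau> j) - int (\<tau> i)) * sgn (int j - int i)) = sgn (int (\<sigma> (\<tau> j)) - int (\<sigma> (\<tau> i))) * sgn (int j - int i)"
      by (metis (no_types, lifting) mult.assoc mult.right_neutral)
  qed simp
  finally have XYZ: "(\<Prod>i\<in>S. sgn (int (\<sigma> (\<tau> j)) - int (\<sigma> (\<tau> i))) * sgn (int j - int i)) =
    (\<Prod>i\<in>\<tau> ` S. sgn (int (\<sigma> (\<tau> j)) - int (\<sigma> i)) * sgn (int (\<tau> j) - int i)) *
      (\<Prod>i\<in>S. sgn (int (\<tau> j) - int (\<tau> i)) * sgn (int j - int i))" by (rule sym)
  show ?case
    unfolding image_insert rsign_insert[OF insert(1,2)] rsign_insert[OF finite_imageI[OF insert(1)] j] insert.IH XYZ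
    by (simp only: mult_ac)
qed simp

lemma rsign_sq: "finite S \<Longrightarrow> inj \<rho> \<Longrightarrow> rsign \<rho> S * rsign \<rho> S = 1"
proof (induction rule: finite_induct)
  case (insert j S)
  have "(\<Prod>i\<in>S. sgn (int (\<rho> j) - int (\<rho> i)) * sgn (int j - int i)) * (\<Prod>i\<in>S. sgn (int (\<rho> j) - int (\<rho> i)) * sgn (int j - int i)) = 1"
    unfolding prod.distrib[symmetric]
  proof (rule prod.neutral, rule ballI)
    fix i assume "i \<in> S"
    then have "i \<noteq> j" "\<rho> i \<noteq> \<rho> j" using insert by (auto simp: inj_def)
    then show "sgn (int (\<rho> j) - int (\<rho> i)) * sgn (int j - int i) * (sgn (int (\<rho> j) - int (\<rho> i)) * sgn (int j - int i)) = 1"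
      by (auto simp: sgn_if)
  qed
  then show ?case using insert by (simp add: rsign_insert mult_ac)
qed simp

lemma rsign_id: "finite S \<Longrightarrow> rsign (\<lambda>j. j) S = 1"
  unfolding rsign_def by (intro prod.neutral ballI) auto

lemma sum_shift_mod:
  fixes F :: "nat \<Rightarrow> int"
  assumes "q > 0"
  shows "(\<Sum>t<q. F ((t + a) mod q)) = (\<Sum>t<q. F t)"
proof -
  have "inj_on (\<lambda>t. (t + a) mod q) {..<q}"
  proof (rule inj_onI)
    fix x y assume "x \<in> {..<q}" "y \<in> {..<q}" "(x + a) mod q = (y + a) mod q"
    then have "[x + a = y + a] (mod q)" by (simp add: cong_def)
    then have "[x = y] (mod q)" by (simp add: cong_add_rcancel_nat)
    then show "x = y" using \<open>x \<in> _\<close> \<open>y \<in> _\<close> by (simp add: cong_def)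
  qed
  moreover have "(\<lambda>t. (t + a) mod q) ` {..<q} \<subseteq> {..<q}" using assms by auto
  ultimately have "bij_betw (\<lambda>t. (t + a) mod q) {..<q} {..<q}"
    by (simp add: bij_betw_def endo_inj_surj)
  then show ?thesis by (rule sum.reindex_bij_betw)
qed

text \<open>The data that \<open>cyclic_coset_data\<close> provides. Fixing the indices outside the
  range makes every \<open>\<pi> g\<close> a permutation of all natural numbers. The numbers
  \<open>\<alpha>\<close> form a cocycle only modulo \<open>q j\<close>, being arbitrary
  representatives of exponents.\<close>

locale group_complex = cyclic_complex r q + G: group G
  for r q and G :: "('g, 'z) monoid_scheme" (structure) +
  fixes \<pi> \<alpha> :: "'g \<Rightarrow> nat \<Rightarrow> nat" and p :: nat
  assumes G_finite: "finite (carrier G)" and p: "p > 1"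
    and \<pi>_less: "\<lbrakk>g \<in> carrier G; j < r\<rbrakk> \<Longrightarrow> \<pi> g j < r"
    and \<pi>_out: "\<lbrakk>g \<in> carrier G; \<not> j < r\<rbrakk> \<Longrightarrow> \<pi> g j = j"
    and \<pi>_mult: "\<lbrakk>g \<in> carrier G; h \<in> carrier G\<rbrakk> \<Longrightarrow> \<pi> (g \<otimes> h) j = \<pi> g (\<pi> h j)"
    and \<pi>_one: "\<pi> \<one> j = j"
    and q_\<pi>: "g \<in> carrier G \<Longrightarrow> q (\<pi> g j) = q j"
    and \<alpha>_mult: "\<lbrakk>g \<in> carrier G; h \<in> carrier G; j < r\<rbrakk> \<Longrightarrow> [\<alpha> (g \<otimes> h) j = \<alpha> g (\<pi> h j) + \<alpha> h j] (mod q j)"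
    and faithful: "\<lbrakk>g \<in> carrier G; g \<noteq> \<one>\<rbrakk> \<Longrightarrow> \<exists>j<r. \<pi> g j = j \<and> \<not> q j dvd \<alpha> g j"
begin

text \<open>Entries outside the range are fixed to 0, so that each cell is given by exactly one pair
  of functions.\<close>

definition cell :: "nat \<Rightarrow> (nat \<Rightarrow> nat) \<Rightarrow> (nat \<Rightarrow> nat) \<Rightarrow> bool" where
  "cell n m c \<longleftrightarrow> (\<forall>j<r. c j < q j) \<and> (\<forall>j. \<not> j < r \<longrightarrow> m j = 0 \<and> c j = 0) \<and> (\<Sum>j<r. m j) = n"

text \<open>Chains of degree \<open>n\<close> over the integers modulo \<open>p\<close> are chains
  up to this relation; \<open>cell_op\<close> below singles out the integral operators that descend
  to it.\<close>

definition eqv :: "nat \<Rightarrow> chain \<Rightarrow> chain \<Rightarrow> bool" where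
  "eqv n f g \<longleftrightarrow> (\<forall>m c. cell n m c \<longrightarrow> [f m c = g m c] (mod int p))"

definition cell_op :: "nat \<Rightarrow> nat \<Rightarrow> (chain \<Rightarrow> chain) \<Rightarrow> bool" where
  "cell_op k n L \<longleftrightarrow> linear_op L \<and> (\<forall>f g. eqv k f g \<longrightarrow> eqv n (L f) (L g))"

definition shift :: "'g \<Rightarrow> (nat \<Rightarrow> nat) \<Rightarrow> nat \<Rightarrow> nat" where
  "shift g c = (\<lambda>j. if j < r then (c (\<pi> g j) + \<alpha> g j) mod q j else 0)"

text \<open>The group acts on cells from the right, through \<open>\<pi>\<close> and
  \<open>shift\<close>; evaluating a coefficient function at the moved cell, with the Koszul sign,
  is therefore a left action.\<close>

definition act :: "'g \<Rightarrow> chain \<Rightarrow> chain" where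
  "act g f m c = rsign (\<pi> g) {j. j < r \<and> odd (m (\<pi> g j))} * f (\<lambda>j. m (\<pi> g j)) (shift g c)"

lemma eqv_refl [simp]: "eqv n f f" by (simp add: eqv_def)
lemma eqv_trans: "eqv n f g \<Longrightarrow> eqv n g h \<Longrightarrow> eqv n f h" unfolding eqv_def by (meson cong_trans)

lemma eqvI: "(\<And>m c. cell n m c \<Longrightarrow> f m c = g m c) \<Longrightarrow> eqv n f g"
  by (simp add: eqv_def)

lemma cell_opI:
  "linear_op L \<Longrightarrow> (\<And>f g m c. eqv k f g \<Longrightarrow> cell n m c \<Longrightarrow> [L f m c = L g m c] (mod int p)) \<Longrightarrow> cell_op k n L"
  by (simp add: cell_op_def eqv_def)

lemma eqvD: "eqv n f g \<Longrightarrow> cell n m c \<Longrightarrow> [f m c = g m c] (mod int p)"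
  by (simp add: eqv_def)

lemma cell_c: "cell n m c \<Longrightarrow> j < r \<Longrightarrow> c j < q j"
  by (simp add: cell_def)

lemma sum_upd: "j < r \<Longrightarrow> (\<Sum>i<r. (m(j := k)) i) + m j = (\<Sum>i<r. m i) + (k::nat)"
proof -
  assume j: "j < r"
  have "(\<Sum>i<r. f i) = f j + (\<Sum>i\<in>{..<r} - {j}. f i)" for f :: "nat \<Rightarrow> nat"
    using j by (intro sum.remove) auto
  from this[of "m(j := k)"] this[of m] show ?thesis by simp
qed

lemma cell_upd:
  "\<lbrakk>cell n m c; j < r; t < q j; n + k = n' + m j\<rbrakk> \<Longrightarrow> cell n' (m(j := k)) (c(j := t))"
  using sum_upd[of j m k] by (auto simp: cell_def)

lemma cell_upd_m:
  "\<lbrakk>cell n m c; j < r; n + k = n' + m j\<rbrakk> \<Longrightarrow> cell n' (m(j := k)) c"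
  using cell_upd[of n m c j "c j" k n'] by (simp add: cell_c)

lemma cell_upd_c: "\<lbrakk>cell n m c; j < r; t < q j\<rbrakk> \<Longrightarrow> cell n m (c(j := t))"
  using cell_upd[of n m c j t "m j" n] by simp

lemma linear_diff: "linear_op diff"
  unfolding linear_op_def
proof (intro allI ext)
  fix a b f g m c
  have "pdiff j (\<lambda>m c. a * f m c + b * g m c) m c = a * pdiff j f m c + b * pdiff j g m c" for j
    by (simp add: pdiff_def sum.distrib sum_distrib_left algebra_simps)
  then show "diff (\<lambda>m c. a * f m c + b * g m c) m c = a * diff f m c + b * diff g m c"
    by (simp add: diff_def sum.distrib sum_distrib_left algebra_simps)
qed

lemma linear_htp: "linear_op (htp j)"
  by (auto simp: linear_op_def htp_def phtp_def sum.distrib sum_distrib_left algebra_simps fun_eq_iff)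

lemma linear_act: "linear_op (act g)"
  by (auto simp: linear_op_def act_def algebra_simps fun_eq_iff)

lemma op_diff: "cell_op (Suc n) n diff"
proof (rule cell_opI[OF linear_diff])
  fix f g m c assume fg: "eqv (Suc n) f g" and c: "cell n m c"
  have "[pdiff j f m c = pdiff j g m c] (mod int p)" if j: "j < r" for j
    using q_pos[of j] cell_upd[OF c j, of _ "Suc (m j)" "Suc n"] cell_upd_m[OF c j, of "Suc (m j)" "Suc n"]
    by (auto simp: pdiff_def intro!: cong_sum cong_diff eqvD[OF fg])
  then show "[diff f m c = diff g m c] (mod int p)"
    unfolding diff_def by (intro cong_sum cong_mult) auto
qed

lemma op_htp: assumes j: "j < r" shows "cell_op n (Suc n) (htp j)"
proof (rule cell_opI[OF linear_htp])
  fix f g m c assume fg: "eqv n f g" and c: "cell (Suc n) m c"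
  have "[phtp j f m c = phtp j g m c] (mod int p)"
  proof (cases "m j = 0")
    case True
    then show ?thesis by (simp add: phtp_def)
  next
    case False
    then show ?thesis
      using q_pos[of j] cell_upd[OF c j, of _ "m j - 1" n] cell_c[OF c j]
      by (auto simp: phtp_def intro!: cong_sum cong_diff eqvD[OF fg])
  qed
  then show "[htp j f m c = htp j g m c] (mod int p)"
    unfolding htp_def by (intro cong_mult) auto
qed

lemma \<pi>_inj: assumes "g \<in> carrier G" shows "inj (\<pi> g)"
proof (rule inj_on_inverseI[of _ "\<pi> (inv g)"])
  fix j show "\<pi> (inv g) (\<pi> g j) = j" using assms \<pi>_mult[of "inv g" g j] \<pi>_one by simp
qed

lemma \<pi>_inv: "g \<in> carrier G \<Longrightarrow> \<pi> g (\<pi> (inv g) j) = j"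
  using \<pi>_mult[of g "inv g" j] \<pi>_one by simp

lemma \<pi>_bij: "g \<in> carrier G \<Longrightarrow> bij_betw (\<pi> g) {..<r} {..<r}"
proof -
  assume g: "g \<in> carrier G"
  have "inj_on (\<pi> g) {..<r}" using \<pi>_inj[OF g] by (rule inj_on_subset) simp
  moreover have "\<pi> g ` {..<r} \<subseteq> {..<r}" using \<pi>_less[OF g] by auto
  ultimately show ?thesis by (simp add: bij_betw_def endo_inj_surj)
qed

lemma cell_act:
  assumes g: "g \<in> carrier G" and c: "cell n m c"
  shows "cell n (\<lambda>j. m (\<pi> g j)) (shift g c)"
proof -
  have "(\<Sum>j<r. m (\<pi> g j)) = (\<Sum>j<r. m j)" by (rule sum.reindex_bij_betw[OF \<pi>_bij[OF g]])
  then show ?thesis using c q_pos \<pi>_out[OF g] by (auto simp: cell_def shift_def)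
qed

lemma op_act: assumes g: "g \<in> carrier G" shows "cell_op n n (act g)"
proof (rule cell_opI[OF linear_act])
  fix f h m c assume fg: "eqv n f h" and c: "cell n m c"
  show "[act g f m c = act g h m c] (mod int p)"
    unfolding act_def by (intro cong_mult cong_refl eqvD[OF fg] cell_act g c)
qed

lemma shift_mult:
  assumes "g \<in> carrier G" "h \<in> carrier G"
  shows "shift h (shift g c) = shift (g \<otimes> h) c"
proof
  fix j
  have "[c (\<pi> g (\<pi> h j)) + \<alpha> g (\<pi> h j) + \<alpha> h j = c (\<pi> (g \<otimes> h) j) + \<alpha> (g \<otimes> h) j] (mod q j)" if "j < r"
    using \<alpha>_mult[OF assms that] assms
    by (simp add: \<pi>_mult add.assoc) (metis cong_add_lcancel_nat cong_sym_eq)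
  then show "shift h (shift g c) j = shift (g \<otimes> h) c j"
    using assms \<pi>_less[OF assms(2)] q_\<pi>[OF assms(2)]
    by (auto simp: shift_def cong_def mod_simps)
qed

lemma shift_one: "cell n m c \<Longrightarrow> shift \<one> c = c"
proof
  fix j assume c: "cell n m c"
  have "[0 = \<alpha> \<one> j] (mod q j)" if "j < r"
    using \<alpha>_mult[of \<one> \<one> j] that \<pi>_one cong_add_lcancel_0_nat[of "\<alpha> \<one> j" "\<alpha> \<one> j" "q j"]
    by (simp add: cong_sym_eq)
  then have "[c j + \<alpha> \<one> j = c j] (mod q j)" if "j < r"
    using that by (metis add.right_neutral cong_add_lcancel_nat cong_sym_eq)
  then show "shift \<one> c j = c j" using c by (auto simp: shift_def cell_def \<pi>_one cong_def)
qed

text \<open>\<open>\<pi> h\<close> carries the odd positions seen through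
  \<open>g \<otimes> h\<close> to those seen through \<open>g\<close>, which is the shape that
  \<open>rsign_comp\<close> needs.\<close>

lemma act_mult:
  assumes g: "g \<in> carrier G" "h \<in> carrier G"
  shows "act g (act h f) m c = act (g \<otimes> h) f m c"
proof -
  let ?S = "{j. j < r \<and> odd (m (\<pi> g (\<pi> h j)))}"
  have "\<pi> h ` ?S = {j. j < r \<and> odd (m (\<pi> g j))}"
  proof safe
    fix j assume j: "j < r" "odd (m (\<pi> g j))"
    then show "j \<in> \<pi> h ` ?S"
      using g \<pi>_inv[OF g(2)] \<pi>_less by (intro image_eqI[of _ _ "\<pi> (inv h) j"]) auto
  qed (use \<pi>_less[OF g(2)] in auto)
  moreover have "\<pi> (g \<otimes> h) = (\<lambda>j. \<pi> g (\<pi> h j))" using \<pi>_mult[OF g] by auto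
  ultimately show ?thesis
    using rsign_comp[of ?S "\<pi> h" "\<pi> g"] \<pi>_inj[OF g(2)]
    by (simp add: act_def shift_mult[OF g] mult.assoc)
qed

lemma act_one: "cell n m c \<Longrightarrow> act \<one> f m c = f m c"
proof -
  assume c: "cell n m c"
  have "\<pi> \<one> = (\<lambda>j. j)" using \<pi>_one by auto
  then show ?thesis by (simp add: act_def shift_one[OF c] rsign_id)
qed

lemma shift_upd:
  assumes g: "g \<in> carrier G" and j: "j < r"
  shows "shift g (c(\<pi> g j := t)) = (shift g c)(j := (t + \<alpha> g j) mod q j)"
proof
  fix i
  have "\<pi> g i = \<pi> g j \<longleftrightarrow> i = j" using \<pi>_inj[OF g] by (auto simp: inj_def)
  then show "shift g (c(\<pi> g j := t)) i = ((shift g c)(j := (t + \<alpha> g j) mod q j)) i"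
    using j by (auto simp: shift_def)
qed

lemma upd_\<pi>: "g \<in> carrier G \<Longrightarrow> (\<lambda>i. (m(\<pi> g j := k)) (\<pi> g i)) = (\<lambda>i. m (\<pi> g i))(j := k)"
  using \<pi>_inj by (auto simp: inj_def)

text \<open>Changing the parity at \<open>j\<close> inserts \<open>j\<close> into the set of odd
  positions or removes it, and by \<open>rsign_insert\<close> the resulting factor is the product of
  the Koszul signs at \<open>j\<close> and at \<open>\<pi> g j\<close>. Since these square to 1,
  both cases give the same rule.\<close>

lemma rsign_ksign:
  assumes g: "g \<in> carrier G" and j: "j < r"
  shows "rsign (\<pi> g) {i. i < r \<and> odd (m (\<pi> g i))} * ksign (\<lambda>i. m (\<pi> g i)) j =
    ksign m (\<pi> g j) * rsign (\<pi> g) {i. i < r \<and> odd ((m(\<pi> g j := Suc (m (\<pi> g j)))) (\<pi> g i))}"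
proof -
  let ?m = "\<lambda>i. m (\<pi> g i)"
  define S where "S = {i. i < r \<and> odd (?m i)} - {j}"
  have S: "finite S" "j \<notin> S" by (auto simp: S_def)
  have K1: "ksign ?m j = (\<Prod>i\<in>S. sgn (int j - int i))" by (simp add: ksign_def S_def)
  have "{i. i < r \<and> odd (m i)} - {\<pi> g j} = \<pi> g ` S"
  proof safe
    fix i assume i: "i < r" "odd (m i)" "i \<notin> \<pi> g ` S"
    then show "i = \<pi> g j"
      using g \<pi>_inv[OF g, of i] \<pi>_less[of "inv g" i] by (force simp: S_def image_iff)
  qed (use \<pi>_less[OF g] \<pi>_inj[OF g] in \<open>auto simp: S_def inj_def\<close>)
  then have K2: "ksign m (\<pi> g j) = (\<Prod>i\<in>S. sgn (int (\<pi> g j) - int (\<pi> g i)))"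
    unfolding ksign_def using \<pi>_inj[OF g] by (simp add: prod.reindex inj_on_subset)
  have eq: "rsign (\<pi> g) (insert j S) = rsign (\<pi> g) S * (ksign m (\<pi> g j) * ksign ?m j)"
    using rsign_insert[OF S] by (simp add: K1 K2 prod.distrib)
  have sq: "ksign m (\<pi> g j) * ksign m (\<pi> g j) = 1" "ksign ?m j * ksign ?m j = 1" by (rule ksign_sq)+
  have up: "(m(\<pi> g j := k)) (\<pi> g i) = (if i = j then k else ?m i)" for i k
    using \<pi>_inj[OF g] by (auto simp: inj_def)
  show ?thesis
  proof (cases "odd (?m j)")
    case True
    have "{i. i < r \<and> odd (?m i)} = insert j S" using True j by (auto simp: S_def)
    moreover have "{i. i < r \<and> odd ((m(\<pi> g j := Suc (m (\<pi> g j)))) (\<pi> g i))} = S"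
      unfolding up using True by (auto simp: S_def)
    ultimately show ?thesis using eq sq by (simp add: mult_ac)
  next
    case False
    have "{i. i < r \<and> odd (?m i)} = S" using False by (auto simp: S_def)
    moreover have "{i. i < r \<and> odd ((m(\<pi> g j := Suc (m (\<pi> g j)))) (\<pi> g i))} = insert j S"
      unfolding up using False j by (auto simp: S_def)
    moreover have "K * (x * (K * k)) = (K * K) * (x * k)" for K x k :: int by simp
    ultimately show ?thesis by (simp only: eq sq mult_1)
  qed
qed

text \<open>Direction \<open>j\<close> of \<open>diff f\<close> becomes direction
  \<open>\<pi> g j\<close> of \<open>diff (act g f)\<close>. Translation by
  \<open>\<alpha> g j\<close> commutes with the cyclic difference and leaves the norm
  unchanged.\<close>

lemma act_diff:
  assumes g: "g \<in> carrier G"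
  shows "act g (diff f) m c = diff (act g f) m c"
proof -
  let ?m = "\<lambda>i. m (\<pi> g i)" and ?S = "\<lambda>m. {i. i < r \<and> odd (m (\<pi> g i))}"
  have pd: "rsign (\<pi> g) (?S m) * (ksign ?m j * pdiff j f ?m (shift g c)) = ksign m (\<pi> g j) * pdiff (\<pi> g j) (act g f) m c"
    if j: "j < r" for j
  proof -
    let ?M = "m(\<pi> g j := Suc (m (\<pi> g j)))" and ?M' = "?m(j := Suc (?m j))"
    have a: "act g f ?M d = rsign (\<pi> g) (?S ?M) * f ?M' (shift g d)" for d
      unfolding act_def upd_\<pi>[OF g] by simp
    have s: "shift g c j = (c (\<pi> g j) + \<alpha> g j) mod q j" using j by (simp add: shift_def)
    have "pdiff (\<pi> g j) (act g f) m c = rsign (\<pi> g) (?S ?M) * pdiff j f ?m (shift g c)"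
    proof (cases "even (?m j)")
      case True
      have "(Suc (c (\<pi> g j)) mod q j + \<alpha> g j) mod q j = Suc (shift g c j) mod q j"
        unfolding s by (simp add: mod_simps)
      then show ?thesis using True
        by (simp add: pdiff_def a shift_upd[OF g j] q_\<pi>[OF g] right_diff_distrib)
    next
      case False
      have "(\<Sum>t<q j. f ?M' ((shift g c)(j := (t + \<alpha> g j) mod q j))) = (\<Sum>t<q j. f ?M' ((shift g c)(j := t)))"
        by (rule sum_shift_mod[OF q_pos])
      then show ?thesis using False
        by (simp add: pdiff_def a shift_upd[OF g j] q_\<pi>[OF g] flip: sum_distrib_left)
    qed
    then show ?thesis using rsign_ksign[OF g j, of m] by (simp flip: mult.assoc)
  qed
  have "act g (diff f) m c = (\<Sum>j<r. ksign m (\<pi> g j) * pdiff (\<pi> g j) (act g f) m c)"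
    by (simp add: act_def diff_def sum_distrib_left pd)
  also have "\<dots> = diff (act g f) m c"
    unfolding diff_def by (rule sum.reindex_bij_betw[OF \<pi>_bij[OF g]])
  finally show ?thesis .
qed

section \<open>Augmentation, exactness and freeness of the action\<close>

definition base_cells :: "(nat \<Rightarrow> nat) set" where
  "base_cells = {c. (\<forall>j<r. c j < q j) \<and> (\<forall>j. \<not> j < r \<longrightarrow> c j = 0)}"

definition aug :: "chain \<Rightarrow> int" where
  "aug f = (\<Sum>c\<in>base_cells. f (\<lambda>_. 0) c)"

lemma finite_base_cells: "finite base_cells"
proof (rule finite_subset)
  show "base_cells \<subseteq> {c. \<forall>j. (j \<in> {..<r} \<longrightarrow> c j \<in> {..Max (q ` {..<r})}) \<and> (j \<notin> {..<r} \<longrightarrow> c j = 0)}"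
  proof
    fix c assume c: "c \<in> base_cells"
    have "c j \<le> Max (q ` {..<r})" if "j < r" for j
    proof -
      have "q j \<le> Max (q ` {..<r})" using that by (intro Max_ge) auto
      moreover have "c j < q j" using c that by (simp add: base_cells_def)
      ultimately show ?thesis by linarith
    qed
    then show "c \<in> {c. \<forall>j. (j \<in> {..<r} \<longrightarrow> c j \<in> {..Max (q ` {..<r})}) \<and> (j \<notin> {..<r} \<longrightarrow> c j = 0)}"
      using c by (auto simp: base_cells_def)
  qed
qed (rule finite_set_of_finite_funs; simp)

lemma cell_base: "cell n m c \<Longrightarrow> c \<in> base_cells"
  by (simp add: cell_def base_cells_def)

lemma cell_0_iff: "cell 0 m c \<longleftrightarrow> m = (\<lambda>_. 0) \<and> c \<in> base_cells"
  by (auto simp: cell_def base_cells_def fun_eq_iff)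

lemma finite_cells: "finite {(m, c). cell n m c}"
proof (rule finite_subset)
  let ?X = "{m. \<forall>j. (j \<in> {..<r} \<longrightarrow> m j \<in> {..n}) \<and> (j \<notin> {..<r} \<longrightarrow> m j = (0::nat))}"
  show "{(m, c). cell n m c} \<subseteq> ?X \<times> base_cells"
  proof (rule subsetI)
    fix x assume "x \<in> {(m, c). cell n m c}"
    then obtain m c where x: "x = (m, c)" and c: "cell n m c" by auto
    have "m j \<le> n" if "j < r" for j using c that member_le_sum[of j "{..<r}" m] by (simp add: cell_def)
    moreover have "m j = 0" if "\<not> j < r" for j using c that by (simp add: cell_def)
    ultimately show "x \<in> ?X \<times> base_cells" using cell_base[OF c] x by simp
  qed
  have "finite ?X" by (rule finite_set_of_finite_funs) auto
  then show "finite (?X \<times> base_cells)" using finite_base_cells by simp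
qed

lemma sum_base_reindex:
  fixes F :: "(nat \<Rightarrow> nat) \<Rightarrow> int"
  assumes "inj_on h base_cells" "\<And>c. c \<in> base_cells \<Longrightarrow> h c \<in> base_cells"
  shows "(\<Sum>c\<in>base_cells. F (h c)) = (\<Sum>c\<in>base_cells. F c)"
proof -
  have "h ` base_cells = base_cells" using assms finite_base_cells by (intro endo_inj_surj) auto
  then show ?thesis using assms by (metis (mono_tags, lifting) sum.reindex comp_apply sum.cong)
qed

lemma aug_diff: "aug (diff f) = 0"
proof -
  have "(\<Sum>c\<in>base_cells. pdiff j f (\<lambda>_. 0) c) = 0" if j: "j < r" for j
  proof -
    let ?h = "\<lambda>c. c(j := Suc (c j) mod q j)"
    have inj: "inj_on ?h base_cells"
    proof (rule inj_onI)
      fix c d assume cd: "c \<in> base_cells" "d \<in> base_cells" "?h c = ?h d"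
      have "Suc (c j) mod q j = Suc (d j) mod q j" using fun_cong[OF cd(3), of j] by simp
      then have "[c j + 1 = d j + 1] (mod q j)" by (simp add: cong_def)
      then have "[c j = d j] (mod q j)" by (simp only: cong_add_rcancel_nat)
      then have "c j = d j" using cd j by (simp add: cong_def base_cells_def)
      then show "c = d" using cd(3) by (metis fun_upd_triv fun_upd_upd)
    qed
    have "?h c \<in> base_cells" if "c \<in> base_cells" for c
      using that j q_pos[of j] by (auto simp: base_cells_def)
    from sum_base_reindex[OF inj this, of "f ((\<lambda>_. 0)(j := Suc 0))"]
    show ?thesis by (simp add: pdiff_def sum_subtractf)
  qed
  then show ?thesis
    unfolding aug_def diff_def by (subst sum.swap) (simp flip: sum_distrib_left)
qed

lemma aug_act:
  assumes g: "g \<in> carrier G"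
  shows "aug (act g f) = aug f"
proof -
  have inj: "inj_on (shift g) base_cells"
  proof (rule inj_on_inverseI)
    fix c assume "c \<in> base_cells"
    then have "shift \<one> c = c" using shift_one[of 0 "\<lambda>_. 0" c] by (simp add: cell_0_iff)
    then show "shift (inv g) (shift g c) = c" using g by (simp add: shift_mult)
  qed
  have "shift g c \<in> base_cells" if "c \<in> base_cells" for c
    using cell_act[OF g, of 0 "\<lambda>_. 0" c] that by (simp add: cell_0_iff)
  from sum_base_reindex[OF inj this, of "f (\<lambda>_. 0)"]
  show ?thesis by (simp add: aug_def act_def)
qed

lemma aug_cong: "eqv 0 f g \<Longrightarrow> [aug f = aug g] (mod int p)"
  unfolding aug_def by (intro cong_sum) (simp add: eqv_def cell_0_iff)

lemma eqv_diff: "eqv n f g \<Longrightarrow> eqv n f' g' \<Longrightarrow> eqv n (\<lambda>m c. f m c - f' m c) (\<lambda>m c. g m c - g' m c)"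
  by (auto simp: eqv_def intro: cong_diff)

lemma cell_opD: "cell_op k n L \<Longrightarrow> eqv k f g \<Longrightarrow> eqv n (L f) (L g)"
  by (simp add: cell_op_def)

lemma cell_op_linear: "cell_op k n L \<Longrightarrow> linear_op L"
  by (simp add: cell_op_def)

lemma diff_diff_eqv: "eqv n (diff (diff f)) (\<lambda>m c. 0)"
  by (rule eqvI) (simp add: diff_diff cell_def)

text \<open>
  Subtracting the boundaries of \<open>htp j f\<close> for \<open>j = 0, 1, \<dots>\<close> from a cycle \<open>f\<close> pushes it into
  degree \<open>0\<close> and to the point \<open>q j - 1\<close> in one coordinate after the other.
\<close>

lemma push_cycle:
  assumes z: "\<And>k. n = Suc k \<Longrightarrow> eqv k (diff z) (\<lambda>m c. 0)" and "i \<le> r"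
  shows "\<exists>w. \<forall>m c. cell n m c \<longrightarrow> (\<exists>j<i. m j \<noteq> 0 \<or> c j \<noteq> q j - 1) \<longrightarrow> [z m c = diff w m c] (mod int p)"
  using assms(2)
proof (induction i)
  case (Suc i)
  then have i: "i < r" by simp
  from Suc obtain w where w: "\<And>m c j. cell n m c \<Longrightarrow> j < i \<Longrightarrow> m j \<noteq> 0 \<or> c j \<noteq> q j - 1 \<Longrightarrow> [z m c = diff w m c] (mod int p)"
    by (meson Suc_leD)
  define y where "y m c = z m c - diff w m c" for m c
  \<comment> \<open>The remainder \<open>y\<close> is a cycle modulo \<open>p\<close>, so the
    homotopy in direction \<open>i\<close> turns it into \<open>pproj i y\<close> up to a
    boundary.\<close>
  define w' where "w' m c = w m c + htp i y m c" for m c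
  have hd: "[htp i (diff y) m c = 0] (mod int p)" if c: "cell n m c" for m c
  proof (cases n)
    case 0
    then have "m i = 0" using c by (simp add: cell_0_iff)
    then show ?thesis by (simp add: htp_def phtp_def)
  next
    case (Suc k)
    have "eqv k (diff y) (\<lambda>m c. 0)"
      using eqv_diff[OF z[OF Suc] diff_diff_eqv] linear_op_diff[OF linear_diff] by (simp add: y_def[abs_def])
    from eqvD[OF cell_opD[OF op_htp[OF i] this], of m c] show ?thesis
      using c Suc linear_op_zero[OF linear_htp, of i] by (simp add: fun_eq_iff)
  qed
  have key: "[z m c - diff w' m c = pproj i y m c] (mod int p)" if c: "cell n m c" for m c
  proof -
    have "diff w' m c = diff w m c + diff (htp i y) m c"
      using linear_op_add[OF linear_diff] by (simp add: w'_def[abs_def])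
    then have "z m c - diff w' m c = pproj i y m c + htp i (diff y) m c"
      using htp_diff[of c i y m] c i by (simp add: y_def cell_def)
    then show ?thesis using cong_add[OF cong_refl[of "pproj i y m c"] hd[OF c]] by simp
  qed
  have "[z m c = diff w' m c] (mod int p)" if c: "cell n m c" and j: "j < Suc i" "m j \<noteq> 0 \<or> c j \<noteq> q j - 1" for m c j
  proof -
    have "[pproj i y m c = 0] (mod int p)"
    proof (cases "j = i")
      case True
      then show ?thesis using j by (auto simp: pproj_def)
    next
      \<comment> \<open>\<open>pproj i\<close> sums over coordinate \<open>i\<close> alone, so an
        earlier coordinate \<open>j\<close> away from its base point makes every summand vanish
        already.\<close>
      case False
      then have "j < i" using j by simp
      then have "[y m (c(i := t)) = 0] (mod int p)" if "t < q i" for t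
        using w[OF cell_upd_c[OF c i that] \<open>j < i\<close>] j False by (simp add: y_def cong_diff_iff_cong_0)
      then have "[(\<Sum>t<q i. y m (c(i := t))) = (\<Sum>t<q i. 0)] (mod int p)" by (intro cong_sum) auto
      then show ?thesis by (simp add: pproj_def)
    qed
    then have "[z m c - diff w' m c = 0] (mod int p)" using key[OF c] cong_trans by blast
    then show ?thesis by (simp add: cong_diff_iff_cong_0)
  qed
  then show ?case by blast
qed auto

text \<open>A cell of positive degree has a coordinate of positive degree, so
  \<open>push_cycle\<close> with \<open>i = r\<close> reaches every cell.\<close>

lemma exact_pos:
  assumes "eqv n (diff z) (\<lambda>m c. 0)"
  shows "\<exists>w. eqv (Suc n) z (diff w)"
proof -
  obtain w where w: "\<And>m c. cell (Suc n) m c \<Longrightarrow> \<exists>j<r. m j \<noteq> 0 \<or> c j \<noteq> q j - 1 \<Longrightarrow> [z m c = diff w m c] (mod int p)"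
    using push_cycle[of "Suc n" z r] assms by auto
  have "\<exists>j<r. m j \<noteq> 0" if "cell (Suc n) m c" for m c
  proof (rule ccontr)
    assume "\<not> (\<exists>j<r. m j \<noteq> 0)"
    then have "(\<Sum>j<r. m j) = 0" by simp
    then show False using that by (simp add: cell_def)
  qed
  then show ?thesis using w unfolding eqv_def by blast
qed

text \<open>After pushing, the only cell left is the one with all positions \<open>q j - 1\<close>.
  Boundaries have augmentation 0, so the coefficient there is \<open>aug z\<close> modulo
  \<open>p\<close>.\<close>

lemma exact_0:
  assumes "[aug z = 0] (mod int p)"
  shows "\<exists>w. eqv 0 z (diff w)"
proof -
  obtain w where w: "\<And>m c. cell 0 m c \<Longrightarrow> \<exists>j<r. m j \<noteq> 0 \<or> c j \<noteq> q j - 1 \<Longrightarrow> [z m c = diff w m c] (mod int p)"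
    using push_cycle[of 0 z r] by auto
  define y where "y m c = z m c - diff w m c" for m c
  define t where "t j = (if j < r then q j - 1 else 0)" for j
  have t: "t \<in> base_cells" using q_pos by (auto simp: t_def base_cells_def)
  have y: "[y (\<lambda>_. 0) c = 0] (mod int p)" if c: "c \<in> base_cells" "c \<noteq> t" for c
  proof -
    have "\<exists>j<r. c j \<noteq> q j - 1"
    proof (rule ccontr)
      assume "\<not> (\<exists>j<r. c j \<noteq> q j - 1)"
      then have "c = t" using c by (auto simp: t_def base_cells_def)
      then show False using c by simp
    qed
    then show ?thesis using w[of "\<lambda>_. 0" c] c by (simp add: y_def cell_0_iff cong_diff_iff_cong_0)
  qed
  have "aug y = aug z" using aug_diff[of w] by (simp add: aug_def y_def sum_subtractf)
  then have "aug z = y (\<lambda>_. 0) t + (\<Sum>c\<in>base_cells - {t}. y (\<lambda>_. 0) c)"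
    unfolding aug_def using sum.remove[OF finite_base_cells t, of "y (\<lambda>_. 0)"] by simp
  moreover have "[(\<Sum>c\<in>base_cells - {t}. y (\<lambda>_. 0) c) = (\<Sum>c\<in>base_cells - {t}. 0)] (mod int p)"
    by (intro cong_sum) (use y in auto)
  then have "[y (\<lambda>_. 0) t + (\<Sum>c\<in>base_cells - {t}. y (\<lambda>_. 0) c) = y (\<lambda>_. 0) t] (mod int p)"
    using cong_add[OF cong_refl[of "y (\<lambda>_. 0) t"]] by fastforce
  ultimately have "[y (\<lambda>_. 0) t = 0] (mod int p)"
    using assms cong_sym cong_trans by metis
  then have "[y (\<lambda>_. 0) c = 0] (mod int p)" if "c \<in> base_cells" for c
    using y that by (cases "c = t") auto
  then have "eqv 0 z (diff w)"
    unfolding eqv_def cell_0_iff by (auto simp: y_def cong_diff_iff_cong_0)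
  then show ?thesis by (rule exI[of _ w])
qed

text \<open>By \<open>faithful\<close> a non-trivial element fixes some coordinate and translates
  the position there by an amount that is not 0 modulo \<open>q j\<close>.\<close>

lemma shift_free:
  assumes g: "g \<in> carrier G" and c: "cell n m c" and fx: "(\<lambda>j. m (\<pi> g j)) = m" "shift g c = c"
  shows "g = \<one>"
proof (rule ccontr)
  assume "g \<noteq> \<one>"
  then obtain j where j: "j < r" "\<pi> g j = j" "\<not> q j dvd \<alpha> g j" using faithful[OF g] by blast
  have "(c j + \<alpha> g j) mod q j = c j" using fun_cong[OF fx(2), of j] j by (simp add: shift_def)
  then have "[c j + \<alpha> g j = c j + 0] (mod q j)" using cell_c[OF c j(1)] by (simp add: cong_def)
  then have "[\<alpha> g j = 0] (mod q j)" by (simp only: cong_add_lcancel_nat)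
  then show False using j(3) by (simp add: cong_0_iff)
qed

end

section \<open>A free resolution over the group algebra\<close>

lemma finsum_residue_ring:
  assumes m: "m > 1" and "finite I" "f \<in> I \<rightarrow> {0..m - 1}"
  shows "(\<Oplus>\<^bsub>residue_ring m\<^esub>i\<in>I. f i) = (\<Sum>i\<in>I. f i) mod m"
proof -
  interpret residues m "residue_ring m" by unfold_locales (use m in auto)
  show ?thesis using assms(2,3)
  proof induction
    case empty
    then show ?case using m by (simp add: res_zero_eq)
  next
    case (insert i I)
    then have "f \<in> I \<rightarrow> carrier (residue_ring m)" "f i \<in> carrier (residue_ring m)"
      by (auto simp: res_carrier_eq)
    then show ?case using insert by (simp add: res_add_eq mod_simps)
  qed
qed

context group_complex
begin

definition truncate :: "nat \<Rightarrow> chain \<Rightarrow> chain" where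
  "truncate n f = (\<lambda>m c. if cell n m c then f m c mod int p else 0)"

definition algebra_act :: "('g \<Rightarrow> int) \<Rightarrow> chain \<Rightarrow> chain" where
  "algebra_act a f = (\<lambda>m c. \<Sum>g\<in>carrier G. a g * act g f m c)"

definition cell_module :: "nat \<Rightarrow> ('g \<Rightarrow> int, chain) module" where
  "cell_module n = \<lparr>carrier = {f. truncate n f = f}, monoid.mult = undefined, one = undefined, ring.zero = (\<lambda>m c. 0),
    ring.add = (\<lambda>f g. truncate n (\<lambda>m c. f m c + g m c)), module.smult = (\<lambda>a f. truncate n (algebra_act a f))\<rparr>"

abbreviation kG :: "('g \<Rightarrow> int) ring" where "kG \<equiv> group_algebra (F_p p) G"

lemma truncate_eq_iff: "truncate n f = truncate n g \<longleftrightarrow> eqv n f g"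
  by (auto simp: truncate_def eqv_def fun_eq_iff cong_def)

lemma eqv_tr [simp]: "eqv n (truncate n f) f" "eqv n f (truncate n f)"
  by (auto simp: truncate_def eqv_def)

lemma truncate_tr [simp]: "truncate n (truncate n f) = truncate n f"
  by (simp add: truncate_eq_iff)

lemma truncate_zero [simp]: "truncate n (\<lambda>m c. 0) = (\<lambda>m c. 0)"
  by (simp add: truncate_def fun_eq_iff)

lemma eqv_sum:
  assumes "\<And>i. i \<in> I \<Longrightarrow> eqv n (F i) (F' i)"
  shows "eqv n (\<lambda>m c. \<Sum>i\<in>I. F i m c) (\<lambda>m c. \<Sum>i\<in>I. F' i m c)"
  unfolding eqv_def using eqvD[OF assms] by (intro allI impI cong_sum) blast

lemma truncate_op: "cell_op k n L \<Longrightarrow> truncate n (L (truncate k f)) = truncate n (L f)"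
  by (simp add: truncate_eq_iff cell_opD)

lemma truncate_add: "truncate n (\<lambda>m c. truncate n f m c + g m c) = truncate n (\<lambda>m c. f m c + g m c)"
  "truncate n (\<lambda>m c. f m c + truncate n g m c) = truncate n (\<lambda>m c. f m c + g m c)"
  by (auto simp: truncate_def fun_eq_iff mod_simps)

lemma cell_module_simps:
  "carrier (cell_module n) = {f. truncate n f = f}" "\<zero>\<^bsub>cell_module n\<^esub> = (\<lambda>m c. 0)"
  "f \<oplus>\<^bsub>cell_module n\<^esub> g = truncate n (\<lambda>m c. f m c + g m c)" "a \<odot>\<^bsub>cell_module n\<^esub> f = truncate n (algebra_act a f)"
  by (simp_all add: cell_module_def)

lemma kG_carrier: "carrier kG = carrier G \<rightarrow>\<^sub>E {0..int p - 1}"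
  by (simp add: group_algebra_def residue_ring_def)

lemma kG_add: "a \<oplus>\<^bsub>kG\<^esub> b = (\<lambda>g\<in>carrier G. (a g + b g) mod int p)"
  by (simp add: group_algebra_def residue_ring_def)

lemma kG_one: "\<one>\<^bsub>kG\<^esub> = (\<lambda>g\<in>carrier G. if g = \<one> then 1 else 0)"
proof -
  interpret K: residues "int p" "F_p p" by unfold_locales (use p in auto)
  show ?thesis by (auto simp: group_algebra_def K.res_one_eq K.res_zero_eq intro!: restrict_ext)
qed

lemma mod_p_range: "x mod int p \<in> {0..int p - 1}"
  using pos_mod_bound[of "int p" x] pos_mod_sign[of "int p" x] p by simp

lemma kG_mult:
  assumes "a \<in> carrier kG" "b \<in> carrier kG"
  shows "a \<otimes>\<^bsub>kG\<^esub> b = (\<lambda>g\<in>carrier G. (\<Sum>h\<in>carrier G. a h * b (inv h \<otimes> g)) mod int p)"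
proof -
  have "(\<Oplus>\<^bsub>F_p p\<^esub>h\<in>carrier G. a h \<otimes>\<^bsub>F_p p\<^esub> b (inv h \<otimes> g)) = (\<Sum>h\<in>carrier G. a h * b (inv h \<otimes> g)) mod int p" for g
  proof -
    have "(\<Oplus>\<^bsub>F_p p\<^esub>h\<in>carrier G. (a h * b (inv h \<otimes> g)) mod int p) = (\<Sum>h\<in>carrier G. (a h * b (inv h \<otimes> g)) mod int p) mod int p"
      using p G_finite mod_p_range by (intro finsum_residue_ring) auto
    then show ?thesis by (simp add: residue_ring_def mod_sum_eq)
  qed
  then show ?thesis by (simp add: group_algebra_def cong: restrict_cong)
qed

lemma op_gsum: "cell_op n n (algebra_act a)"
proof (rule cell_opI)
  show "linear_op (algebra_act a)"
    using linear_opD[OF linear_act]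
    by (auto simp: linear_op_def algebra_act_def fun_eq_iff sum.distrib sum_distrib_left algebra_simps)
  show "[algebra_act a f m c = algebra_act a g m c] (mod int p)" if "eqv n f g" "cell n m c" for f g m c
    unfolding algebra_act_def using eqvD[OF cell_opD[OF op_act that(1)] that(2)] by (intro cong_sum cong_mult) auto
qed

lemma algebra_act_cong:
  assumes "\<And>g. g \<in> carrier G \<Longrightarrow> [a g = b g] (mod int p)"
  shows "eqv n (algebra_act a f) (algebra_act b f)"
  unfolding eqv_def algebra_act_def using assms by (intro allI impI cong_sum cong_mult) auto

lemma act_gsum:
  assumes "h \<in> carrier G"
  shows "act h (algebra_act b f) m c = (\<Sum>k\<in>carrier G. b k * act (h \<otimes> k) f m c)"
proof -
  have "act h (algebra_act b f) = (\<lambda>m c. \<Sum>k\<in>carrier G. b k * act h (act k f) m c)"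
    unfolding algebra_act_def by (rule linear_op_sum[OF linear_act G_finite])
  then show ?thesis using assms act_mult by simp
qed

lemma algebra_act_gsum:
  "algebra_act a (algebra_act b f) m c = algebra_act (\<lambda>g. \<Sum>h\<in>carrier G. a h * b (inv h \<otimes> g)) f m c"
proof -
  have "algebra_act a (algebra_act b f) m c = (\<Sum>h\<in>carrier G. \<Sum>k\<in>carrier G. a h * b k * act (h \<otimes> k) f m c)"
    unfolding algebra_act_def[of a "algebra_act b f"] by (simp add: act_gsum sum_distrib_left mult.assoc)
  also have "\<dots> = (\<Sum>h\<in>carrier G. \<Sum>g\<in>carrier G. a h * b (inv h \<otimes> g) * act g f m c)"
  proof (rule sum.cong)
    fix h assume h: "h \<in> carrier G"
    have "(\<Sum>k\<in>carrier G. a h * b k * act (h \<otimes> k) f m c) =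
      (\<Sum>k\<in>carrier G. a h * b (inv h \<otimes> (h \<otimes> k)) * act (h \<otimes> k) f m c)"
      using h by (intro sum.cong) (auto simp flip: G.m_assoc)
    also have "\<dots> = (\<Sum>g\<in>carrier G. a h * b (inv h \<otimes> g) * act g f m c)"
    proof (rule sum.reindex_bij_betw[of "\<lambda>k. h \<otimes> k"])
      have "inj_on (\<lambda>k. h \<otimes> k) (carrier G)" using h by (auto intro: inj_onI)
      moreover have "(\<lambda>k. h \<otimes> k) ` carrier G \<subseteq> carrier G" using h by auto
      ultimately show "bij_betw (\<lambda>k. h \<otimes> k) (carrier G) (carrier G)"
        using endo_inj_surj[OF G_finite] by (simp add: bij_betw_def)
    qed
    finally show "(\<Sum>k\<in>carrier G. a h * b k * act (h \<otimes> k) f m c) =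
      (\<Sum>g\<in>carrier G. a h * b (inv h \<otimes> g) * act g f m c)" .
  qed simp
  also have "\<dots> = algebra_act (\<lambda>g. \<Sum>h\<in>carrier G. a h * b (inv h \<otimes> g)) f m c"
    unfolding algebra_act_def by (subst sum.swap) (simp add: sum_distrib_right)
  finally show ?thesis .
qed

lemma cell_module_abelian: "abelian_group (cell_module n)"
proof (rule abelian_groupI)
  fix f g h assume fgh: "f \<in> carrier (cell_module n)" "g \<in> carrier (cell_module n)" "h \<in> carrier (cell_module n)"
  show "f \<oplus>\<^bsub>cell_module n\<^esub> g \<in> carrier (cell_module n)" by (simp add: cell_module_simps)
  show "f \<oplus>\<^bsub>cell_module n\<^esub> g \<oplus>\<^bsub>cell_module n\<^esub> h = f \<oplus>\<^bsub>cell_module n\<^esub> (g \<oplus>\<^bsub>cell_module n\<^esub> h)"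
    by (simp add: cell_module_simps truncate_add add.assoc)
  show "f \<oplus>\<^bsub>cell_module n\<^esub> g = g \<oplus>\<^bsub>cell_module n\<^esub> f" by (simp add: cell_module_simps add.commute)
  show "\<zero>\<^bsub>cell_module n\<^esub> \<oplus>\<^bsub>cell_module n\<^esub> f = f" using fgh by (simp add: cell_module_simps)
  show "\<exists>y\<in>carrier (cell_module n). y \<oplus>\<^bsub>cell_module n\<^esub> f = \<zero>\<^bsub>cell_module n\<^esub>"
    by (intro bexI[of _ "truncate n (\<lambda>m c. - f m c)"]) (simp_all add: cell_module_simps truncate_add)
qed (simp add: cell_module_simps)

lemma left_module_cell_module:
  assumes "ring kG"
  shows "left_module kG (cell_module n)"
proof -
  interpret kG: ring kG by fact
  interpret cell_module: abelian_group "cell_module n" by (rule cell_module_abelian)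
  have lin: "linear_op (algebra_act a)" for a using op_gsum cell_op_linear by blast
  show ?thesis
  proof unfold_locales
    fix a b f g assume ab: "a \<in> carrier kG" "b \<in> carrier kG" and f: "f \<in> carrier (cell_module n)" and g: "g \<in> carrier (cell_module n)"
    show "a \<odot>\<^bsub>cell_module n\<^esub> f \<in> carrier (cell_module n)" by (simp add: cell_module_simps)
    have "eqv n (algebra_act (a \<oplus>\<^bsub>kG\<^esub> b) f) (algebra_act (\<lambda>g. a g + b g) f)"
      by (rule algebra_act_cong) (simp add: kG_add)
    moreover have "algebra_act (\<lambda>g. a g + b g) f = (\<lambda>m c. algebra_act a f m c + algebra_act b f m c)"
      by (simp add: algebra_act_def fun_eq_iff sum.distrib algebra_simps)
    ultimately show "(a \<oplus>\<^bsub>kG\<^esub> b) \<odot>\<^bsub>cell_module n\<^esub> f = a \<odot>\<^bsub>cell_module n\<^esub> f \<oplus>\<^bsub>cell_module n\<^esub> b \<odot>\<^bsub>cell_module n\<^esub> f"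
      by (simp add: cell_module_simps truncate_add truncate_eq_iff)
    show "a \<odot>\<^bsub>cell_module n\<^esub> (f \<oplus>\<^bsub>cell_module n\<^esub> g) = a \<odot>\<^bsub>cell_module n\<^esub> f \<oplus>\<^bsub>cell_module n\<^esub> a \<odot>\<^bsub>cell_module n\<^esub> g"
      by (simp add: cell_module_simps truncate_add truncate_op[OF op_gsum] linear_op_add[OF lin])
    have "eqv n (algebra_act (a \<otimes>\<^bsub>kG\<^esub> b) f) (algebra_act (\<lambda>g. \<Sum>h\<in>carrier G. a h * b (inv h \<otimes> g)) f)"
      by (rule algebra_act_cong) (simp add: kG_mult[OF ab])
    then have "eqv n (algebra_act (a \<otimes>\<^bsub>kG\<^esub> b) f) (algebra_act a (algebra_act b f))"
      using algebra_act_gsum[of a b f] by (simp add: fun_eq_iff flip: algebra_act_gsum) (simp add: eqv_def algebra_act_gsum)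
    then show "(a \<otimes>\<^bsub>kG\<^esub> b) \<odot>\<^bsub>cell_module n\<^esub> f = a \<odot>\<^bsub>cell_module n\<^esub> (b \<odot>\<^bsub>cell_module n\<^esub> f)"
      by (simp add: cell_module_simps truncate_op[OF op_gsum] truncate_eq_iff)
  next
    fix f assume f: "f \<in> carrier (cell_module n)"
    have "eqv n (algebra_act \<one>\<^bsub>kG\<^esub> f) f"
    proof (rule eqvI)
      fix m c assume c: "cell n m c"
      have "algebra_act \<one>\<^bsub>kG\<^esub> f m c = (\<Sum>g\<in>carrier G. if g = \<one> then act g f m c else 0)"
        unfolding algebra_act_def kG_one by (intro sum.cong) auto
      then show "algebra_act \<one>\<^bsub>kG\<^esub> f m c = f m c" using G_finite act_one[OF c] by simp
    qed
    then show "\<one>\<^bsub>kG\<^esub> \<odot>\<^bsub>cell_module n\<^esub> f = f" using f truncate_eq_iff[of n "algebra_act \<one>\<^bsub>kG\<^esub> f" f] by (simp add: cell_module_simps)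
  qed
qed

lemma op_module_hom:
  assumes R: "ring kG" and L: "cell_op k n L" and eq: "\<And>g f. g \<in> carrier G \<Longrightarrow> eqv n (L (act g f)) (act g (L f))"
  shows "(\<lambda>f\<in>carrier (cell_module k). truncate n (L f)) \<in> module_hom kG (cell_module k) (cell_module n)"
proof (rule left_module.mhom_restrict[OF left_module_cell_module[OF R]])
  note lin = cell_op_linear[OF L]
  show "mhom kG (cell_module k) (cell_module n) (\<lambda>f. truncate n (L f))"
    unfolding mhom_def
  proof (intro conjI ballI)
    show "(\<lambda>f. truncate n (L f)) \<in> carrier (cell_module k) \<rightarrow> carrier (cell_module n)" by (simp add: cell_module_simps)
    show "truncate n (L (f \<oplus>\<^bsub>cell_module k\<^esub> g)) = truncate n (L f) \<oplus>\<^bsub>cell_module n\<^esub> truncate n (L g)" for f g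
      by (simp add: cell_module_simps truncate_op[OF L] truncate_add linear_op_add[OF lin])
    fix a f
    have "L (algebra_act a f) = (\<lambda>m c. \<Sum>g\<in>carrier G. a g * L (act g f) m c)"
      unfolding algebra_act_def by (rule linear_op_sum[OF lin G_finite])
    moreover have "eqv n (\<lambda>m c. \<Sum>g\<in>carrier G. a g * L (act g f) m c) (algebra_act a (L f))"
      unfolding algebra_act_def eqv_def using eqvD[OF eq] by (intro allI impI cong_sum cong_mult) auto
    ultimately have "eqv n (L (algebra_act a f)) (algebra_act a (L f))" by simp
    then show "truncate n (L (a \<odot>\<^bsub>cell_module k\<^esub> f)) = a \<odot>\<^bsub>cell_module n\<^esub> truncate n (L f)"
      by (simp add: cell_module_simps truncate_op[OF L] truncate_op[OF op_gsum] truncate_eq_iff)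
  qed
qed

section \<open>The free action on cells and a basis over the group algebra\<close>

definition cells :: "nat \<Rightarrow> ((nat \<Rightarrow> nat) \<times> (nat \<Rightarrow> nat)) set" where
  "cells n = {(m, c). cell n m c}"

definition cell_ract :: "(nat \<Rightarrow> nat) \<times> (nat \<Rightarrow> nat) \<Rightarrow> 'g \<Rightarrow> (nat \<Rightarrow> nat) \<times> (nat \<Rightarrow> nat)" where
  "cell_ract x g = (\<lambda>j. fst x (\<pi> g j), shift g (snd x))"

lemma cell_ract_cells: "g \<in> carrier G \<Longrightarrow> x \<in> cells n \<Longrightarrow> cell_ract x g \<in> cells n"
  using cell_act by (auto simp: cells_def cell_ract_def)

lemma cell_ract_mult: "g \<in> carrier G \<Longrightarrow> h \<in> carrier G \<Longrightarrow> cell_ract (cell_ract x g) h = cell_ract x (g \<otimes> h)"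
  by (simp add: cell_ract_def shift_mult \<pi>_mult)

lemma cell_ract_one: "x \<in> cells n \<Longrightarrow> cell_ract x \<one> = x"
  using shift_one by (auto simp: cell_ract_def cells_def \<pi>_one)

lemma cell_ract_inv: "x \<in> cells n \<Longrightarrow> g \<in> carrier G \<Longrightarrow> cell_ract (cell_ract x g) (inv g) = x"
  "x \<in> cells n \<Longrightarrow> g \<in> carrier G \<Longrightarrow> cell_ract (cell_ract x (inv g)) g = x"
  by (simp_all add: cell_ract_mult cell_ract_one)

lemma cell_ract_free:
  assumes "x \<in> cells n" "g \<in> carrier G" "h \<in> carrier G" "cell_ract x g = cell_ract x h"
  shows "g = h"
proof -
  have "cell_ract x (g \<otimes> inv h) = x" using assms cell_ract_mult[of g "inv h" x] cell_ract_mult[of h "inv h" x] cell_ract_one[OF assms(1)] by simp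
  then have "g \<otimes> inv h = \<one>"
    using assms shift_free[of "g \<otimes> inv h" n "fst x" "snd x"] by (cases x) (auto simp: cell_ract_def cells_def)
  then show ?thesis using assms by (metis G.inv_closed G.inv_equality G.inv_inv)
qed

text \<open>\<open>rp\<close> depends on the orbit alone, hence picks one cell from each; freeness
  makes the group element that moves a given cell to its representative unique.\<close>

lemma orbit_reps:
  obtains T where "T \<subseteq> cells n" "\<And>y. y \<in> cells n \<Longrightarrow> \<exists>!g. g \<in> carrier G \<and> cell_ract y g \<in> T"
proof -
  define orb where "orb y = cell_ract y ` carrier G" for y
  define rp where "rp y = (SOME x. x \<in> orb y)" for y
  have rp: "rp y \<in> orb y" for y
    unfolding rp_def by (rule someI[of _ "cell_ract y \<one>"]) (auto simp: orb_def)
  have orb: "orb (cell_ract y g) = orb y" if "y \<in> cells n" "g \<in> carrier G" for y g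
  proof
    show "orb (cell_ract y g) \<subseteq> orb y" using that by (auto simp: orb_def cell_ract_mult)
    have "cell_ract y h = cell_ract (cell_ract y g) (inv g \<otimes> h)" if "h \<in> carrier G" for h
      using that \<open>g \<in> carrier G\<close> by (simp add: cell_ract_mult G.m_assoc[symmetric])
    moreover have "inv g \<otimes> h \<in> carrier G" if "h \<in> carrier G" for h using that \<open>g \<in> carrier G\<close> by simp
    ultimately show "orb y \<subseteq> orb (cell_ract y g)"
      unfolding orb_def by (intro image_subsetI) (metis imageI)
  qed
  show thesis
  proof (rule that[of "rp ` cells n"])
    show "rp ` cells n \<subseteq> cells n"
    proof (rule image_subsetI)
      fix y assume y: "y \<in> cells n"
      obtain g where "g \<in> carrier G" "rp y = cell_ract y g" using rp[of y] unfolding orb_def by blast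
      then show "rp y \<in> cells n" using cell_ract_cells[OF _ y] by simp
    qed
    fix y assume y: "y \<in> cells n"
    obtain g where g: "g \<in> carrier G" "rp y = cell_ract y g" using rp[of y] unfolding orb_def by blast
    have rpz: "rp z = rp y" if z: "z \<in> cells n" "rp z = cell_ract y h" "h \<in> carrier G" for z h
    proof -
      obtain k where k: "k \<in> carrier G" "rp z = cell_ract z k" using rp[of z] unfolding orb_def by blast
      have "orb z = orb y" using orb[OF z(1) k(1)] orb[OF y z(3)] k z by simp
      then show ?thesis by (simp add: rp_def)
    qed
    show "\<exists>!g. g \<in> carrier G \<and> cell_ract y g \<in> rp ` cells n"
    proof (rule ex1I[of _ g])
      show "g \<in> carrier G \<and> cell_ract y g \<in> rp ` cells n" using g y by (simp add: g(2)[symmetric])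
      fix h assume h: "h \<in> carrier G \<and> cell_ract y h \<in> rp ` cells n"
      then obtain z where "z \<in> cells n" "rp z = cell_ract y h" by (metis imageE)
      then have "cell_ract y h = cell_ract y g" using rpz h g by metis
      then show "h = g" using cell_ract_free[OF y] h g by blast
    qed
  qed
qed

definition unit_chain :: "(nat \<Rightarrow> nat) \<times> (nat \<Rightarrow> nat) \<Rightarrow> chain" where
  "unit_chain x = (\<lambda>m c. if (m, c) = x then 1 else 0)"

definition gsign :: "'g \<Rightarrow> (nat \<Rightarrow> nat) \<Rightarrow> int" where
  "gsign g m = rsign (\<pi> g) {j. j < r \<and> odd (m (\<pi> g j))}"

lemma gsign_sq: "g \<in> carrier G \<Longrightarrow> gsign g m * gsign g m = 1"
  unfolding gsign_def by (rule rsign_sq[OF _ \<pi>_inj]) auto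

lemma unit_chain_inj: "unit_chain x = unit_chain y \<Longrightarrow> x = y"
proof -
  assume "unit_chain x = unit_chain y"
  then have "unit_chain x (fst x) (snd x) = unit_chain y (fst x) (snd x)" by simp
  then show ?thesis by (simp add: unit_chain_def split: if_splits)
qed

lemma cell_module_finsum:
  assumes "finite I" "F \<in> I \<rightarrow> carrier (cell_module n)"
  shows "(\<Oplus>\<^bsub>cell_module n\<^esub>i\<in>I. F i) = truncate n (\<lambda>m c. \<Sum>i\<in>I. F i m c)"
  using assms
proof induction
  interpret cell_module: abelian_group "cell_module n" by (rule cell_module_abelian)
  {
    case empty
    then show ?case by (simp add: cell_module_simps)
  next
    case (insert i I)
    then have "F \<in> I \<rightarrow> carrier (cell_module n)" "F i \<in> carrier (cell_module n)" by auto
    then show ?case using insert by (simp add: cell_module_simps(3) truncate_add)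
  }
qed

text \<open>The basis consists of the unit chains at orbit representatives. Each cell
  \<open>y\<close> is moved to a representative by exactly one group element \<open>tt y\<close>, so
  the value at \<open>y\<close> of a linear combination is, up to sign, one coefficient at one group
  element. Read backwards, this determines all coefficients.\<close>

lemma cell_module_free:
  assumes R: "ring kG"
  shows "free_module kG (cell_module n)"
proof -
  interpret cell_module: left_module kG "cell_module n" by (rule left_module_cell_module[OF R])
  obtain T where T: "T \<subseteq> cells n" "\<And>y. y \<in> cells n \<Longrightarrow> \<exists>!g. g \<in> carrier G \<and> cell_ract y g \<in> T"
    using orbit_reps by blast
  define tt where "tt y = (THE g. g \<in> carrier G \<and> cell_ract y g \<in> T)" for y
  have tt: "tt y \<in> carrier G" "cell_ract y (tt y) \<in> T" if "y \<in> cells n" for y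
    using theI'[OF T(2)[OF that]] by (auto simp: tt_def)
  have tt_eq: "tt y = g" if "y \<in> cells n" "g \<in> carrier G" "cell_ract y g \<in> T" for y g
    using T(2)[OF that(1)] tt[OF that(1)] that by blast
  define B where "B = unit_chain ` T"
  have inj: "inj_on unit_chain T" using unit_chain_inj by (rule inj_onI)
  have finT: "finite T" using T(1) finite_cells[of n] by (auto simp: cells_def intro: finite_subset)
  have finB: "finite B" using finT by (simp add: B_def)
  have Bc: "B \<subseteq> carrier (cell_module n)"
  proof
    fix b assume "b \<in> B"
    then obtain m c where b: "b = unit_chain (m, c)" and c: "cell n m c"
      using T(1) by (auto simp: B_def cells_def)
    have "truncate n b m' c' = b m' c'" for m' c'
      using c p by (auto simp: b truncate_def unit_chain_def)
    then show "b \<in> carrier (cell_module n)" by (simp add: cell_module_simps fun_eq_iff)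
  qed
  have gs: "algebra_act a (unit_chain x) m c = (if cell_ract (m, c) (tt (m, c)) = x then gsign (tt (m, c)) m * a (tt (m, c)) else 0)"
    if x: "x \<in> T" and c: "cell n m c" for a x m c
  proof -
    have y: "(m, c) \<in> cells n" using c by (simp add: cells_def)
    have "algebra_act a (unit_chain x) m c = (\<Sum>g\<in>carrier G. if g = tt (m, c) then (if cell_ract (m, c) (tt (m, c)) = x then gsign g m * a g else 0) else 0)"
      unfolding algebra_act_def
    proof (rule sum.cong)
      fix g assume g: "g \<in> carrier G"
      have "cell_ract (m, c) g = x \<longleftrightarrow> g = tt (m, c) \<and> cell_ract (m, c) (tt (m, c)) = x"
        using tt_eq[OF y g] x by auto
      then show "a g * act g (unit_chain x) m c = (if g = tt (m, c) then (if cell_ract (m, c) (tt (m, c)) = x then gsign g m * a g else 0) else 0)"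
        by (auto simp: act_def gsign_def unit_chain_def cell_ract_def)
    qed simp
    then show ?thesis using tt(1)[OF y] G_finite by simp
  qed
  have comb: "cell_module.lin_comb B (\<lambda>b. b) d = truncate n (\<lambda>m c. gsign (tt (m, c)) m * d (unit_chain (cell_ract (m, c) (tt (m, c)))) (tt (m, c)))"
    if d: "d \<in> B \<rightarrow>\<^sub>E carrier kG" for d
  proof -
    have "cell_module.lin_comb B (\<lambda>b. b) d = (\<Oplus>\<^bsub>cell_module n\<^esub>b\<in>B. d b \<odot>\<^bsub>cell_module n\<^esub> b)"
      by (rule cell_module.lin_comb_superset) (use d finB Bc in auto)
    also have "\<dots> = truncate n (\<lambda>m c. \<Sum>b\<in>B. truncate n (algebra_act (d b) b) m c)"
      using cell_module_finsum[OF finB, of "\<lambda>b. d b \<odot>\<^bsub>cell_module n\<^esub> b"] by (simp add: cell_module_simps)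
    also have "\<dots> = truncate n (\<lambda>m c. \<Sum>b\<in>B. algebra_act (d b) b m c)"
      unfolding truncate_eq_iff by (rule eqv_sum) simp
    also have "\<dots> = truncate n (\<lambda>m c. gsign (tt (m, c)) m * d (unit_chain (cell_ract (m, c) (tt (m, c)))) (tt (m, c)))"
      unfolding truncate_eq_iff
    proof (rule eqvI)
      fix m c assume c: "cell n m c"
      then have y: "(m, c) \<in> cells n" by (simp add: cells_def)
      have "(\<Sum>b\<in>B. algebra_act (d b) b m c) = (\<Sum>x\<in>T. algebra_act (d (unit_chain x)) (unit_chain x) m c)"
        unfolding B_def by (simp only: sum.reindex[OF inj] comp_def)
      also have "\<dots> = (\<Sum>x\<in>T. if cell_ract (m, c) (tt (m, c)) = x then gsign (tt (m, c)) m * d (unit_chain x) (tt (m, c)) else 0)"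
        by (intro sum.cong refl gs c)
      also have "\<dots> = gsign (tt (m, c)) m * d (unit_chain (cell_ract (m, c) (tt (m, c)))) (tt (m, c))"
        using finT tt(2)[OF y] by simp
      finally show "(\<Sum>b\<in>B. algebra_act (d b) b m c) = \<dots>" .
    qed
    finally show ?thesis .
  qed
  have ex1: "\<exists>!d. d \<in> B \<rightarrow>\<^sub>E carrier kG \<and> f = cell_module.lin_comb B (\<lambda>b. b) d" if f: "f \<in> carrier (cell_module n)" for f
  proof (rule ex_ex1I)
    \<comment> \<open>The inverse of the formula \<open>comb\<close>: the coefficient of the
      representative \<open>x\<close> at \<open>g\<close> is the signed value of \<open>f\<close> at
      the cell that \<open>g\<close> moves to \<open>x\<close>.\<close>
    define d where "d = (\<lambda>b\<in>B. \<lambda>g\<in>carrier G. let x = the_inv_into T unit_chain b; y = cell_ract x (inv g) in (gsign g (fst y) * f (fst y) (snd y)) mod int p)"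
    have d: "d \<in> B \<rightarrow>\<^sub>E carrier kG" using mod_p_range by (auto simp: d_def kG_carrier Let_def)
    have "f = truncate n f" using f by (simp add: cell_module_simps)
    also have "\<dots> = cell_module.lin_comb B (\<lambda>b. b) d"
      unfolding comb[OF d] truncate_eq_iff eqv_def
    proof (intro allI impI)
      fix m c assume c: "cell n m c"
      let ?y = "(m, c)"
      have y: "?y \<in> cells n" using c by (simp add: cells_def)
      have "d (unit_chain (cell_ract ?y (tt ?y))) (tt ?y) = (gsign (tt ?y) m * f m c) mod int p"
        using tt[OF y] cell_ract_inv(1)[OF y tt(1)[OF y]] inj by (simp add: d_def B_def Let_def the_inv_into_f_f)
      moreover have "[f m c = gsign (tt ?y) m * ((gsign (tt ?y) m * f m c) mod int p)] (mod int p)"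
        using gsign_sq[OF tt(1)[OF y], of m] by (simp add: cong_def mod_simps flip: mult.assoc)
      ultimately show "[f m c = gsign (tt ?y) m * d (unit_chain (cell_ract ?y (tt ?y))) (tt ?y)] (mod int p)" by simp
    qed
    finally show "\<exists>d. d \<in> B \<rightarrow>\<^sub>E carrier kG \<and> f = cell_module.lin_comb B (\<lambda>b. b) d" using d by blast
  next
    fix d d' assume d: "d \<in> B \<rightarrow>\<^sub>E carrier kG \<and> f = cell_module.lin_comb B (\<lambda>b. b) d" and d': "d' \<in> B \<rightarrow>\<^sub>E carrier kG \<and> f = cell_module.lin_comb B (\<lambda>b. b) d'"
    have eq: "eqv n (\<lambda>m c. gsign (tt (m, c)) m * d (unit_chain (cell_ract (m, c) (tt (m, c)))) (tt (m, c)))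
      (\<lambda>m c. gsign (tt (m, c)) m * d' (unit_chain (cell_ract (m, c) (tt (m, c)))) (tt (m, c)))"
      using d d' comb by (simp flip: truncate_eq_iff)
    have "d (unit_chain x) g = d' (unit_chain x) g" if x: "x \<in> T" and g: "g \<in> carrier G" for x g
    proof -
      have xc: "x \<in> cells n" using x T(1) by auto
      let ?y = "cell_ract x (inv g)"
      have y: "?y \<in> cells n" using xc g cell_ract_cells by simp
      have r: "cell_ract ?y g = x" using cell_ract_inv(2)[OF xc g] .
      have t: "tt ?y = g" using tt_eq[OF y g] r x by simp
      have "[gsign g (fst ?y) * d (unit_chain x) g = gsign g (fst ?y) * d' (unit_chain x) g] (mod int p)"
        using eqvD[OF eq, of "fst ?y" "snd ?y"] y t r by (cases ?y) (auto simp: cells_def)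
      then have "[gsign g (fst ?y) * (gsign g (fst ?y) * d (unit_chain x) g) = gsign g (fst ?y) * (gsign g (fst ?y) * d' (unit_chain x) g)] (mod int p)"
        by (rule cong_mult[OF cong_refl])
      moreover have "gsign g (fst ?y) * (gsign g (fst ?y) * k) = k" for k
        using gsign_sq[OF g, of "fst ?y"] by (simp flip: mult.assoc)
      ultimately have "[d (unit_chain x) g = d' (unit_chain x) g] (mod int p)" by (simp only:)
      moreover have "d (unit_chain x) \<in> carrier kG" "d' (unit_chain x) \<in> carrier kG"
        using d d' x by (auto simp: B_def)
      then have "d (unit_chain x) g \<in> {0..int p - 1}" "d' (unit_chain x) g \<in> {0..int p - 1}"
        using g by (auto simp: kG_carrier)
      ultimately show ?thesis by (simp add: cong_def)
    qed
    then have "d b = d' b" if "b \<in> B" for b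
      using d d' that by (auto simp: B_def kG_carrier PiE_def Pi_def intro!: extensionalityI[of _ "carrier G"])
    then show "d = d'" by (rule PiE_ext[OF conjunct1[OF d] conjunct1[OF d']])
  qed
  have fin: "finite {b \<in> B. c b \<noteq> \<zero>\<^bsub>kG\<^esub>}" for c using finB by simp
  have "module_basis kG (cell_module n) B"
    unfolding module_basis_def
  proof (intro conjI ballI Bc)
    fix f assume "f \<in> carrier (cell_module n)"
    from ex1[OF this] show "\<exists>!c. c \<in> B \<rightarrow>\<^sub>E carrier kG \<and> finite {b \<in> B. c b \<noteq> \<zero>\<^bsub>kG\<^esub>} \<and>
      f = (\<Oplus>\<^bsub>cell_module n\<^esub>b\<in>{b \<in> B. c b \<noteq> \<zero>\<^bsub>kG\<^esub>}. c b \<odot>\<^bsub>cell_module n\<^esub> b)"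
      unfolding cell_module.lin_comb_def by (simp only: fin simp_thms)
  qed
  then show ?thesis using cell_module.left_module_axioms by (auto simp: free_module_def)
qed

end

text \<open>Identities between scalars and elements pass to a homomorphic image. Applied to the
  augmentation, this yields the axioms for the trivial module.\<close>

lemma left_module_image:
  assumes "left_module R M" "abelian_group N" "mhom R M N f" "f ` carrier M = carrier N"
  shows "left_module R N"
proof -
  interpret M: left_module R M by fact
  interpret N: abelian_group N by fact
  note f = mhom_closed[OF assms(3)] mhom_add[OF assms(3), symmetric] mhom_smult[OF assms(3), symmetric]
  have pre: "\<exists>x\<in>carrier M. y = f x" if "y \<in> carrier N" for y using that assms(4) by auto
  show ?thesis
  proof unfold_locales
    fix a b y z assume a: "a \<in> carrier R" and b: "b \<in> carrier R" and "y \<in> carrier N" "z \<in> carrier N"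
    then obtain x w where x: "x \<in> carrier M" "y = f x" and w: "w \<in> carrier M" "z = f w" using pre by blast
    show "a \<odot>\<^bsub>N\<^esub> y \<in> carrier N" using a x f by simp
    show "(a \<oplus>\<^bsub>R\<^esub> b) \<odot>\<^bsub>N\<^esub> y = a \<odot>\<^bsub>N\<^esub> y \<oplus>\<^bsub>N\<^esub> b \<odot>\<^bsub>N\<^esub> y" using a b x f by (simp add: M.smult_l_distr)
    show "a \<odot>\<^bsub>N\<^esub> (y \<oplus>\<^bsub>N\<^esub> z) = a \<odot>\<^bsub>N\<^esub> y \<oplus>\<^bsub>N\<^esub> a \<odot>\<^bsub>N\<^esub> z" using a x w f by (simp add: M.smult_r_distr)
    show "(a \<otimes>\<^bsub>R\<^esub> b) \<odot>\<^bsub>N\<^esub> y = a \<odot>\<^bsub>N\<^esub> (b \<odot>\<^bsub>N\<^esub> y)" using a b x f by (simp add: M.smult_assoc1)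
  next
    fix y assume "y \<in> carrier N"
    then obtain x where "x \<in> carrier M" "y = f x" using pre by blast
    then show "\<one>\<^bsub>R\<^esub> \<odot>\<^bsub>N\<^esub> y = y" using f by simp
  qed
qed

section \<open>The cells as a free resolution of the trivial module\<close>

context group_complex
begin

abbreviation triv :: "('g \<Rightarrow> int, int) module" where "triv \<equiv> trivial_module (F_p p) G"

definition cell_resolution :: "('g \<Rightarrow> int, chain, int) resolution" where
  "cell_resolution = \<lparr>res_term = cell_module, res_diff = (\<lambda>n. \<lambda>f\<in>carrier (cell_module (Suc n)). truncate n (diff f)),
    res_aug = (\<lambda>f\<in>carrier (cell_module 0). aug f mod int p)\<rparr>"

lemma triv_simps:
  "carrier triv = {0..int p - 1}" "x \<oplus>\<^bsub>triv\<^esub> y = (x + y) mod int p" "\<zero>\<^bsub>triv\<^esub> = 0"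
  by (simp_all add: trivial_module_def residue_ring_def)

lemma triv_smult:
  assumes "a \<in> carrier kG"
  shows "a \<odot>\<^bsub>triv\<^esub> x = (\<Sum>g\<in>carrier G. a g) * x mod int p"
proof -
  have "(\<Oplus>\<^bsub>F_p p\<^esub>g\<in>carrier G. a g) = (\<Sum>g\<in>carrier G. a g) mod int p"
    using assms p by (intro finsum_residue_ring G_finite) (auto simp: kG_carrier)
  moreover have "y \<otimes>\<^bsub>F_p p\<^esub> x = y * x mod int p" for y by (simp add: residue_ring_def)
  ultimately show ?thesis by (simp add: trivial_module_def mod_simps)
qed

lemma aug_hom:
  "mhom kG (cell_module 0) triv (\<lambda>f. aug f mod int p)"
  unfolding mhom_def
proof (intro conjI ballI)
  show "(\<lambda>f. aug f mod int p) \<in> carrier (cell_module 0) \<rightarrow> carrier triv"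
    using mod_p_range by (simp add: triv_simps(1))
  have aug_tr: "aug (truncate 0 f) mod int p = aug f mod int p" for f
    using aug_cong[OF eqv_tr(1)] by (simp add: cong_def)
  show "aug (f \<oplus>\<^bsub>cell_module 0\<^esub> g) mod int p = aug f mod int p \<oplus>\<^bsub>triv\<^esub> aug g mod int p" for f g
    unfolding cell_module_simps aug_tr triv_simps by (simp add: aug_def sum.distrib mod_simps)
  fix a f assume a: "a \<in> carrier kG"
  have "aug (algebra_act a f) = (\<Sum>g\<in>carrier G. a g * aug (act g f))"
    unfolding aug_def algebra_act_def by (subst sum.swap) (simp add: sum_distrib_left)
  then have "aug (algebra_act a f) = (\<Sum>g\<in>carrier G. a g) * aug f"
    by (simp add: aug_act sum_distrib_right)
  then show "aug (a \<odot>\<^bsub>cell_module 0\<^esub> f) mod int p = a \<odot>\<^bsub>triv\<^esub> (aug f mod int p)"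
    unfolding cell_module_simps aug_tr triv_smult[OF a] by (simp add: mod_simps)
qed

lemma aug_surj: "(\<lambda>f. aug f mod int p) ` carrier (cell_module 0) = carrier triv"
proof
  show "(\<lambda>f. aug f mod int p) ` carrier (cell_module 0) \<subseteq> carrier triv"
    using mhom_closed[OF aug_hom] by auto
  show "carrier triv \<subseteq> (\<lambda>f. aug f mod int p) ` carrier (cell_module 0)"
  proof
    fix k assume k: "k \<in> carrier triv"
    define t where "t j = (if j < r then q j - 1 else 0)" for j
    have t: "t \<in> base_cells" using q_pos by (auto simp: t_def base_cells_def)
    define f :: chain where "f = (\<lambda>m c. if m = (\<lambda>_. 0) \<and> c = t then k else 0)"
    have "truncate 0 f m c = f m c" for m c
      using t k by (auto simp: truncate_def f_def cell_0_iff triv_simps)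
    then have "f \<in> carrier (cell_module 0)" by (simp add: cell_module_simps fun_eq_iff)
    moreover have "aug f = k"
      using t finite_base_cells by (simp add: aug_def f_def)
    then have "k = aug f mod int p" using k by (simp add: triv_simps)
    ultimately show "k \<in> (\<lambda>f. aug f mod int p) ` carrier (cell_module 0)" by blast
  qed
qed

lemma triv_module:
  assumes "ring kG"
  shows "left_module kG triv"
proof (rule left_module_image[OF left_module_cell_module[OF assms] _ aug_hom aug_surj])
  show "abelian_group triv"
  proof (rule abelian_groupI)
    fix x assume "x \<in> carrier triv"
    show "\<exists>y\<in>carrier triv. y \<oplus>\<^bsub>triv\<^esub> x = \<zero>\<^bsub>triv\<^esub>"
      using mod_p_range by (intro bexI[of _ "(- x) mod int p"]) (simp_all add: triv_simps mod_simps)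
  qed (use p mod_p_range in \<open>auto simp: triv_simps mod_simps ac_simps\<close>)
qed

lemma diff_hom:
  assumes "ring kG"
  shows "(\<lambda>f\<in>carrier (cell_module (Suc n)). truncate n (diff f)) \<in> module_hom kG (cell_module (Suc n)) (cell_module n)"
  by (rule op_module_hom[OF assms op_diff]) (auto intro!: eqvI simp: act_diff)

lemma free_resolution_cells:
  assumes R: "ring kG"
  shows "free_resolution kG triv cell_resolution"
proof -
  \<comment> \<open>With images of differentials described by \<open>eqv\<close>, exactness is a
    matter of \<open>exact_0\<close> and \<open>exact_pos\<close>.\<close>
  have d: "(\<lambda>f\<in>carrier (cell_module (Suc n)). truncate n (diff f)) ` carrier (cell_module (Suc n)) = {f \<in> carrier (cell_module n). \<exists>w. eqv n f (diff w)}" for n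
  proof safe
    fix f assume f: "f \<in> carrier (cell_module (Suc n))"
    then show "(\<lambda>f\<in>carrier (cell_module (Suc n)). truncate n (diff f)) f \<in> carrier (cell_module n)" by (simp add: cell_module_simps)
    show "\<exists>w. eqv n ((\<lambda>f\<in>carrier (cell_module (Suc n)). truncate n (diff f)) f) (diff w)"
      using f by (intro exI[of _ f]) simp
  next
    fix f w assume f: "f \<in> carrier (cell_module n)" "eqv n f (diff w)"
    have "f = truncate n f" using f by (simp add: cell_module_simps)
    also have "\<dots> = truncate n (diff w)" using f by (simp add: truncate_eq_iff)
    also have "\<dots> = (\<lambda>f\<in>carrier (cell_module (Suc n)). truncate n (diff f)) (truncate (Suc n) w)"
      by (simp add: cell_module_simps truncate_op[OF op_diff])
    finally have fw: "f = (\<lambda>f\<in>carrier (cell_module (Suc n)). truncate n (diff f)) (truncate (Suc n) w)" .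
    have "truncate (Suc n) w \<in> carrier (cell_module (Suc n))" by (simp add: cell_module_simps(1))
    with fw show "f \<in> (\<lambda>f\<in>carrier (cell_module (Suc n)). truncate n (diff f)) ` carrier (cell_module (Suc n))"
      by (rule image_eqI)
  qed
  have z: "truncate n f = (\<lambda>m c. 0) \<longleftrightarrow> eqv n f (\<lambda>m c. 0)" for n f
    unfolding truncate_eq_iff[symmetric] truncate_zero by (rule refl)
  have cell_resolution: "res_term cell_resolution = cell_module" "res_diff cell_resolution = (\<lambda>n. \<lambda>f\<in>carrier (cell_module (Suc n)). truncate n (diff f))"
    "res_aug cell_resolution = (\<lambda>f\<in>carrier (cell_module 0). aug f mod int p)"
    by (simp_all add: cell_resolution_def)
  show ?thesis
    unfolding free_resolution_def cell_resolution
  proof (intro conjI allI cell_module_free[OF R] diff_hom[OF R])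
    show "(\<lambda>f\<in>carrier (cell_module 0). aug f mod int p) \<in> module_hom kG (cell_module 0) triv"
      by (rule left_module.mhom_restrict[OF left_module_cell_module[OF R] aug_hom])
    show "(\<lambda>f\<in>carrier (cell_module 0). aug f mod int p) ` carrier (cell_module 0) = carrier triv"
      using aug_surj by simp
    have "aug f mod int p = 0" if "eqv 0 f (diff w)" for f w
      using aug_cong[OF that] by (simp add: aug_diff cong_def)
    moreover have "\<exists>w. eqv 0 f (diff w)" if "aug f mod int p = 0" for f
      using exact_0[of f] that by (simp add: cong_def)
    ultimately show "{x \<in> carrier (cell_module 0). (\<lambda>f\<in>carrier (cell_module 0). aug f mod int p) x = \<zero>\<^bsub>triv\<^esub>} =
      (\<lambda>f\<in>carrier (cell_module (Suc 0)). truncate 0 (diff f)) ` carrier (cell_module 1)"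
      using d[of 0] by (auto simp: triv_simps(3))
    fix n
    have "eqv n (diff f) (\<lambda>m c. 0)" if "eqv (Suc n) f (diff w)" for f w
      using eqv_trans[OF cell_opD[OF op_diff that] diff_diff_eqv] .
    moreover have "\<exists>w. eqv (Suc n) f (diff w)" if "eqv n (diff f) (\<lambda>m c. 0)" for f
      by (rule exact_pos[OF that])
    ultimately show "{x \<in> carrier (cell_module (Suc n)). (\<lambda>f\<in>carrier (cell_module (Suc n)). truncate n (diff f)) x = \<zero>\<^bsub>cell_module n\<^esub>} =
      (\<lambda>f\<in>carrier (cell_module (Suc (Suc n))). truncate (Suc n) (diff f)) ` carrier (cell_module (Suc (Suc n)))"
      unfolding d by (auto simp: cell_module_simps(2) z)
  qed
qed

end

section \<open>Elementary symmetric operators\<close>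

context group_complex
begin

definition bump :: "nat set \<Rightarrow> nat \<Rightarrow> (nat \<Rightarrow> nat) \<Rightarrow> nat \<Rightarrow> nat" where
  "bump S k m = (\<lambda>j. if j \<in> S then m j + 2 * k else m j)"

text \<open>On chains this lowers the degree by \<open>2 * k * card S\<close>; precomposition with
  it raises the degree of cochains by that amount.\<close>

definition pshift :: "nat set \<Rightarrow> nat \<Rightarrow> chain \<Rightarrow> chain" where
  "pshift S k f = (\<lambda>m c. f (bump S k m) c)"

text \<open>
  The shifts \<open>pshift {j} 1\<close> by one period are commuting chain maps. Their elementary
  symmetric polynomials are moreover equivariant; on \<open>Hom(cell_module, M)\<close> they act as multiplication by
  cohomology classes.
\<close>

definition esym :: "nat set \<Rightarrow> nat \<Rightarrow> chain \<Rightarrow> chain" where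
  "esym B i f = (\<lambda>m c. \<Sum>S\<in>{S. S \<subseteq> B \<and> card S = i}. pshift S 1 f m c)"

lemma finite_subs: "finite B \<Longrightarrow> finite {S. S \<subseteq> B \<and> card S = i}"
  by (rule finite_subset[of _ "Pow B"]) auto

lemma linear_pshift: "linear_op (pshift S k)"
  by (simp add: linear_op_def pshift_def)

lemma linear_esym: "linear_op (esym B i)"
  by (auto simp: linear_op_def esym_def pshift_def fun_eq_iff sum.distrib sum_distrib_left)

lemma sum_bump:
  assumes "S \<subseteq> {..<r}"
  shows "(\<Sum>j<r. bump S k m j) = (\<Sum>j<r. m j) + 2 * k * card S"
proof -
  have "(\<Sum>j<r. bump S k m j) = (\<Sum>j<r. m j) + (\<Sum>j<r. if j \<in> S then 2 * k else 0)"
    unfolding sum.distrib[symmetric] by (intro sum.cong) (auto simp: bump_def)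
  also have "(\<Sum>j<r. if j \<in> S then 2 * k else 0) = (\<Sum>j\<in>S. 2 * k)"
    using assms by (intro sum.mono_neutral_cong_right) auto
  finally show ?thesis by simp
qed

lemma cell_bump: "S \<subseteq> {..<r} \<Longrightarrow> cell n m c \<Longrightarrow> cell (n + 2 * k * card S) (bump S k m) c"
  unfolding cell_def sum_bump by (auto simp: bump_def)

lemma op_pshift: "S \<subseteq> {..<r} \<Longrightarrow> cell_op (n + 2 * k * card S) n (pshift S k)"
  by (rule cell_opI[OF linear_pshift]) (simp add: pshift_def eqvD cell_bump)

lemma op_esym:
  assumes "B \<subseteq> {..<r}"
  shows "cell_op (n + 2 * i) n (esym B i)"
proof (rule cell_opI[OF linear_esym])
  fix f g m c assume fg: "eqv (n + 2 * i) f g" "cell n m c"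
  show "[esym B i f m c = esym B i g m c] (mod int p)"
    unfolding esym_def
  proof (rule cong_sum)
    fix S assume "S \<in> {S. S \<subseteq> B \<and> card S = i}"
    then have "S \<subseteq> {..<r}" "card S = i" using assms by auto
    from cell_opD[OF op_pshift[OF this(1), of n 1], of f g] this(2) fg(1)
    have "eqv n (pshift S 1 f) (pshift S 1 g)" by simp
    then show "[pshift S 1 f m c = pshift S 1 g m c] (mod int p)" using fg(2) by (rule eqvD)
  qed
qed

text \<open>Raising degrees by even amounts preserves all parities, hence every Koszul sign and the
  choice between difference and norm in \<open>pdiff\<close>.\<close>

lemma pshift_diff: "pshift S k (diff f) = diff (pshift S k f)"
proof (intro ext)
  fix m c
  have up: "bump S k (m(j := Suc (m j))) = (bump S k m)(j := Suc (bump S k m j))" for j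
    by (auto simp: bump_def)
  have par: "odd (bump S k m j) \<longleftrightarrow> odd (m j)" for j by (simp add: bump_def)
  have "ksign (bump S k m) j = ksign m j" for j by (simp add: ksign_def par)
  moreover have "pdiff j f (bump S k m) c = pdiff j (pshift S k f) m c" for j
    using par[of j] by (simp add: pdiff_def pshift_def up)
  ultimately show "pshift S k (diff f) m c = diff (pshift S k f) m c"
    by (simp add: diff_def pshift_def)
qed

lemma esym_diff: "finite B \<Longrightarrow> esym B i (diff f) = diff (esym B i f)"
  using linear_op_sum'[OF linear_diff finite_subs, of B "\<lambda>S. pshift S 1 f" i]
  by (simp add: esym_def pshift_diff)

text \<open>The action carries the shift along \<open>S\<close> to the shift along the image of
  \<open>S\<close> under \<open>\<pi> g\<close>, and the subsets of a given size are permuted.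
  Parities are unchanged, so no sign appears.\<close>

lemma esym_act:
  assumes g: "g \<in> carrier G"
  shows "esym {..<r} i (act g f) = act g (esym {..<r} i f)"
proof (intro ext)
  fix m c
  have inj: "inj (\<pi> g)" by (rule \<pi>_inj[OF g])
  have bij: "bij_betw ((`) (\<pi> g)) {S. S \<subseteq> {..<r} \<and> card S = i} {S. S \<subseteq> {..<r} \<and> card S = i}"
  proof (rule bij_betw_byWitness[where f' = "(`) (\<pi> (inv g))"])
    have "\<pi> (inv g) (\<pi> g j) = j" for j using g \<pi>_mult[of "inv g" g j] \<pi>_one by simp
    then show "\<forall>S\<in>{S. S \<subseteq> {..<r} \<and> card S = i}. \<pi> (inv g) ` \<pi> g ` S = S" by (simp add: image_image)
    show "\<forall>S\<in>{S. S \<subseteq> {..<r} \<and> card S = i}. \<pi> g ` \<pi> (inv g) ` S = S" using \<pi>_inv[OF g] by (simp add: image_image)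
    have "\<pi> h ` S \<in> {S. S \<subseteq> {..<r} \<and> card S = i}" if "S \<in> {S. S \<subseteq> {..<r} \<and> card S = i}" "h \<in> carrier G" for h S
      using that \<pi>_less[OF that(2)] card_image[OF inj_on_subset[OF \<pi>_inj[OF that(2)]], of S] by auto
    then show "(`) (\<pi> g) ` {S. S \<subseteq> {..<r} \<and> card S = i} \<subseteq> {S. S \<subseteq> {..<r} \<and> card S = i}"
      "(`) (\<pi> (inv g)) ` {S. S \<subseteq> {..<r} \<and> card S = i} \<subseteq> {S. S \<subseteq> {..<r} \<and> card S = i}" using g by blast+
  qed
  have sh: "pshift (\<pi> g ` S) 1 (act g f) m c = act g (pshift S 1 f) m c" for S
  proof -
    have "(\<lambda>j. bump (\<pi> g ` S) 1 m (\<pi> g j)) = bump S 1 (\<lambda>j. m (\<pi> g j))"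
      using inj by (auto simp: bump_def inj_image_mem_iff)
    moreover have "odd (bump (\<pi> g ` S) 1 m j) \<longleftrightarrow> odd (m j)" for j by (simp add: bump_def)
    ultimately show ?thesis by (simp add: pshift_def act_def)
  qed
  have "esym {..<r} i (act g f) m c = (\<Sum>S\<in>{S. S \<subseteq> {..<r} \<and> card S = i}. act g (pshift S 1 f) m c)"
    using sum.reindex_bij_betw[OF bij, of "\<lambda>S. pshift S 1 (act g f) m c"] by (simp only: esym_def sh)
  then show "esym {..<r} i (act g f) m c = act g (esym {..<r} i f) m c"
    using linear_op_sum'[OF linear_act finite_subs[of "{..<r}" i], of g "\<lambda>S. pshift S 1 f"] by (simp add: esym_def)
qed

lemma pshift_pshift: "pshift S k (pshift T l f) = pshift T l (pshift S k f)"
proof -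
  have "bump T l (bump S k m) = bump S k (bump T l m)" for m by (auto simp: bump_def)
  then show ?thesis by (simp add: pshift_def)
qed

lemma pshift_esym: "finite B \<Longrightarrow> pshift S k (esym B i f) = esym B i (pshift S k f)"
  using linear_op_sum'[OF linear_pshift finite_subs, of B S k "\<lambda>T. pshift T 1 f" i]
  by (simp add: esym_def pshift_pshift[of S])

lemma esym_esym: "finite B \<Longrightarrow> finite B' \<Longrightarrow> esym B i (esym B' j f) = esym B' j (esym B i f)"
  using linear_op_sum'[OF linear_esym finite_subs, of B' B i "\<lambda>T. pshift T 1 f" j]
  by (simp add: esym_def[of B' j] pshift_esym)

text \<open>The subsets are split according to whether they contain \<open>j\<close>.\<close>

lemma esym_insert:
  assumes "finite B" "j \<notin> B"
  shows "esym (insert j B) (Suc i) f = (\<lambda>m c. esym B (Suc i) f m c + esym B i (pshift {j} 1 f) m c)"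
proof (intro ext)
  fix m c
  let ?X = "\<lambda>i. {S. S \<subseteq> B \<and> card S = i}"
  have fin: "finite S" if "S \<subseteq> B" for S using assms that finite_subset by blast
  have "{S. S \<subseteq> insert j B \<and> card S = Suc i} = ?X (Suc i) \<union> insert j ` ?X i"
  proof (intro equalityI subsetI)
    fix S assume S: "S \<in> {S. S \<subseteq> insert j B \<and> card S = Suc i}"
    show "S \<in> ?X (Suc i) \<union> insert j ` ?X i"
    proof (cases "j \<in> S")
      case True
      then have "S = insert j (S - {j})" "S - {j} \<subseteq> B" using S by auto
      moreover from this have "card (S - {j}) = i" using S True fin by (simp add: card_Diff_singleton)
      ultimately show ?thesis by blast
    qed (use S in auto)
  next
    fix S assume "S \<in> ?X (Suc i) \<union> insert j ` ?X i"
    then show "S \<in> {S. S \<subseteq> insert j B \<and> card S = Suc i}"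
      using fin assms(2) by (auto simp: subset_iff card_insert_if)
  qed
  moreover have "?X (Suc i) \<inter> insert j ` ?X i = {}" using assms(2) by auto
  moreover have "inj_on (insert j) (?X i)" using assms(2) by (auto intro!: inj_onI)
  moreover have "pshift (insert j S) 1 f m c = pshift S 1 (pshift {j} 1 f) m c" if "S \<in> ?X i" for S
  proof -
    have "bump (insert j S) 1 m = bump {j} 1 (bump S 1 m)" using that assms(2) by (auto simp: bump_def fun_eq_iff)
    then show ?thesis by (simp add: pshift_def)
  qed
  ultimately show "esym (insert j B) (Suc i) f m c = esym B (Suc i) f m c + esym B i (pshift {j} 1 f) m c"
    unfolding esym_def using finite_subs[OF assms(1)]
    by (simp add: sum.union_disjoint sum.reindex)
qed

lemma esym_large: assumes "finite B" "i > card B" shows "esym B i f = (\<lambda>m c. 0)"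
proof -
  have "False" if "S \<subseteq> B" "card S = i" for S using card_mono[OF assms(1) that(1)] that(2) assms(2) by simp
  then have "{S. S \<subseteq> B \<and> card S = i} = {}" by blast
  then show ?thesis by (simp only: esym_def sum.empty)
qed

lemma esym_0: assumes "finite B" shows "esym B 0 f = f"
proof -
  have "{S. S \<subseteq> B \<and> card S = 0} = {{}}" using assms by (auto dest: finite_subset)
  then show ?thesis by (simp add: esym_def pshift_def bump_def)
qed

lemma pshift_add: "pshift {j} (a + b) f = pshift {j} a (pshift {j} b f)"
proof -
  have "bump {j} (a + b) m = bump {j} b (bump {j} a m)" for m by (auto simp: bump_def)
  then show ?thesis by (simp add: pshift_def)
qed

text \<open>A partial inverse of the \<open>r\<close>-fold shift in direction \<open>j\<close>, on
  the cells where \<open>j\<close> is the first coordinate of degree at least \<open>2 * r\<close>.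
  Taking the first such coordinate partitions the cells of large degree, so that the composites with
  the shifts add up to the identity. Equivariance is given up here, as is possible for additive
  cochains.\<close>

definition unshift :: "nat \<Rightarrow> chain \<Rightarrow> chain" where
  "unshift j f = (\<lambda>m c. if m j \<ge> 2 * r \<and> (\<forall>i<j. m i < 2 * r) then f (m(j := m j - 2 * r)) c else 0)"

lemma op_unshift: "j < r \<Longrightarrow> cell_op n (n + 2 * r) (unshift j)"
proof (rule cell_opI)
  show "linear_op (unshift j)" by (auto simp: linear_op_def unshift_def fun_eq_iff)
  fix f g m c assume j: "j < r" and fg: "eqv n f g" and c: "cell (n + 2 * r) m c"
  have "[f (m(j := m j - 2 * r)) c = g (m(j := m j - 2 * r)) c] (mod int p)" if "2 * r \<le> m j"
    by (rule eqvD[OF fg cell_upd_m[OF c j]]) (use that in simp)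
  note e = this
  show "[unshift j f m c = unshift j g m c] (mod int p)"
  proof (cases "2 * r \<le> m j \<and> (\<forall>i<j. m i < 2 * r)")
    case True
    show ?thesis unfolding unshift_def if_P[OF True] by (rule e) (use True in blast)
  next
    case False
    show ?thesis unfolding unshift_def if_not_P[OF False] by (rule cong_refl)
  qed
qed

text \<open>With all coordinates below \<open>2 * r\<close> the degree would be at most
  \<open>2 * r * r\<close>; this is the origin of the bound.\<close>

lemma unshift_pshift:
  assumes n: "n > 2 * r * r" and c: "cell n m c"
  shows "(\<Sum>j<r. unshift j (pshift {j} r f) m c) = f m c"
proof -
  have "\<exists>j<r. m j \<ge> 2 * r"
  proof (rule ccontr)
    assume "\<not> ?thesis"
    then have "(\<Sum>j<r. m j) \<le> (\<Sum>j<r. 2 * r)" by (intro sum_mono) (auto simp: not_le)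
    then show False using c n by (simp add: cell_def mult.commute mult.left_commute)
  qed
  then obtain j where j: "j < r" "m j \<ge> 2 * r" "\<forall>i<j. m i < 2 * r"
    using exists_least_iff[of "\<lambda>j. j < r \<and> m j \<ge> 2 * r"] by (auto simp: not_le)
  have "unshift i (pshift {i} r f) m c = (if i = j then f m c else 0)" if "i < r" for i
  proof (cases "i = j")
    case True
    have "bump {j} r (m(j := m j - 2 * r)) = m" using j by (auto simp: bump_def)
    then show ?thesis using True j by (simp add: unshift_def pshift_def)
  next
    case False
    then have "i < j \<or> j < i" by linarith
    then have "\<not> (m i \<ge> 2 * r \<and> (\<forall>k<i. m k < 2 * r))" using j(2,3) by (meson not_le)
    then show ?thesis using False by (auto simp: unshift_def)
  qed
  then show ?thesis using j(1) by simp
qed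

end

section \<open>Additive cochains with values in a finite abelian group\<close>

locale cochain_group = group_complex r q G \<pi> \<alpha> p + M: abelian_group M
  for r q and G :: "('g, 'z) monoid_scheme" (structure) and \<pi> \<alpha> p and M :: "('m, 'e) ring_scheme" +
  assumes M_finite: "finite (carrier M)"
begin

text \<open>No equivariance is demanded, so that single shifts and \<open>unshift\<close> act.
  Equivariant cocycles reappear later as a subset stable under the symmetric operators.\<close>

definition additive_cochains :: "nat \<Rightarrow> (chain \<Rightarrow> 'm) set" where
  "additive_cochains n = {u \<in> carrier (cell_module n) \<rightarrow>\<^sub>E carrier M.
    \<forall>f\<in>carrier (cell_module n). \<forall>g\<in>carrier (cell_module n). u (f \<oplus>\<^bsub>cell_module n\<^esub> g) = u f \<oplus>\<^bsub>M\<^esub> u g}"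

definition zero_cochain :: "nat \<Rightarrow> chain \<Rightarrow> 'm" where
  "zero_cochain n = (\<lambda>f\<in>carrier (cell_module n). \<zero>\<^bsub>M\<^esub>)"

definition cochain_add :: "nat \<Rightarrow> (chain \<Rightarrow> 'm) \<Rightarrow> (chain \<Rightarrow> 'm) \<Rightarrow> chain \<Rightarrow> 'm" where
  "cochain_add n u v = (\<lambda>f\<in>carrier (cell_module n). u f \<oplus>\<^bsub>M\<^esub> v f)"

definition pullback :: "nat \<Rightarrow> nat \<Rightarrow> (chain \<Rightarrow> chain) \<Rightarrow> (chain \<Rightarrow> 'm) \<Rightarrow> chain \<Rightarrow> 'm" where
  "pullback n k L u = (\<lambda>f\<in>carrier (cell_module n). u (truncate k (L f)))"

text \<open>The direct sum of the cochain groups of all degrees, in multiplicative notation so as to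
  become an \<open>operator_group\<close>.\<close>

definition \<Phi> :: "(nat \<Rightarrow> chain \<Rightarrow> 'm) monoid" where
  "\<Phi> = \<lparr>carrier = {u. (\<forall>n. u n \<in> additive_cochains n) \<and> finite {n. u n \<noteq> zero_cochain n}},
    monoid.mult = (\<lambda>u v n. cochain_add n (u n) (v n)), one = zero_cochain\<rparr>"

text \<open>Precomposition with the elementary symmetric polynomial of index \<open>Suc i\<close>:
  the numbering of the \<open>r\<close> operators starts from 0, whereas index 0 of
  \<open>esym\<close> is the identity. The degree rises by \<open>2 * Suc i\<close>, so the lowest
  components are zero.\<close>

definition cochain_op :: "nat \<Rightarrow> (nat \<Rightarrow> chain \<Rightarrow> 'm) \<Rightarrow> nat \<Rightarrow> chain \<Rightarrow> 'm" where
  "cochain_op i u n = (if 2 * Suc i \<le> n then pullback n (n - 2 * Suc i) (esym {..<r} (Suc i)) (u (n - 2 * Suc i)) else zero_cochain n)"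

lemma truncate_CM [simp]: "truncate n f \<in> carrier (cell_module n)"
  by (simp add: cell_module_simps)

lemma additive_cochains_closed: "u \<in> additive_cochains n \<Longrightarrow> f \<in> carrier (cell_module n) \<Longrightarrow> u f \<in> carrier M"
  by (auto simp: additive_cochains_def)

lemma additive_cochains_add:
  "u \<in> additive_cochains n \<Longrightarrow> u (truncate n (\<lambda>m c. f m c + g m c)) = u (truncate n f) \<oplus>\<^bsub>M\<^esub> u (truncate n g)"
proof -
  assume "u \<in> additive_cochains n"
  then have "u (truncate n f \<oplus>\<^bsub>cell_module n\<^esub> truncate n g) = u (truncate n f) \<oplus>\<^bsub>M\<^esub> u (truncate n g)"
    unfolding additive_cochains_def using truncate_CM by blast
  then show ?thesis by (simp add: cell_module_simps truncate_add)
qed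

lemma additive_cochains_zero: "u \<in> additive_cochains n \<Longrightarrow> u (\<lambda>m c. 0) = \<zero>\<^bsub>M\<^esub>"
  using additive_cochains_add[of u n "\<lambda>m c. 0" "\<lambda>m c. 0"] additive_cochains_closed[of u n "\<lambda>m c. 0"] M.add.l_cancel_one
  by (auto simp: cell_module_simps)

lemma CaddI:
  assumes "\<And>f. f \<in> carrier (cell_module n) \<Longrightarrow> u f \<in> carrier M"
    and "\<And>f g. u (truncate n (\<lambda>m c. f m c + g m c)) = u (truncate n f) \<oplus>\<^bsub>M\<^esub> u (truncate n g)"
  shows "restrict u (carrier (cell_module n)) \<in> additive_cochains n"
proof -
  have "u (f \<oplus>\<^bsub>cell_module n\<^esub> g) = u f \<oplus>\<^bsub>M\<^esub> u g" if "f \<in> carrier (cell_module n)" "g \<in> carrier (cell_module n)" for f g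
    using assms(2)[of f g] that by (simp add: cell_module_simps)
  moreover have "f \<oplus>\<^bsub>cell_module n\<^esub> g \<in> carrier (cell_module n)" for f g by (simp add: cell_module_simps)
  ultimately show ?thesis using assms(1) by (auto simp: additive_cochains_def)
qed

lemma zero_cochain_Cadd [simp]: "zero_cochain n \<in> additive_cochains n"
  unfolding zero_cochain_def by (rule CaddI) auto

lemma cochain_add_Cadd [simp]: "u \<in> additive_cochains n \<Longrightarrow> v \<in> additive_cochains n \<Longrightarrow> cochain_add n u v \<in> additive_cochains n"
  unfolding cochain_add_def by (rule CaddI) (auto simp: additive_cochains_closed additive_cochains_add M.a_ac)

lemma pullback_Cadd:
  assumes L: "cell_op n k L" and u: "u \<in> additive_cochains k"
  shows "pullback n k L u \<in> additive_cochains n"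
  unfolding pullback_def
  by (rule CaddI) (simp_all add: additive_cochains_closed[OF u] truncate_op[OF L] linear_op_add[OF cell_op_linear[OF L]] additive_cochains_add[OF u])

lemma additive_cochains_eqI:
  assumes "u \<in> additive_cochains n" "\<And>f. f \<in> carrier (cell_module n) \<Longrightarrow> u f = v f" shows "u = restrict v (carrier (cell_module n))"
  using assms by (intro extensionalityI[of _ "carrier (cell_module n)"]) (auto simp: additive_cochains_def PiE_def)

lemma cochain_add_zc: "u \<in> additive_cochains n \<Longrightarrow> cochain_add n (zero_cochain n) u = u"
proof -
  assume u: "u \<in> additive_cochains n"
  show ?thesis
    unfolding cochain_add_def zero_cochain_def by (rule additive_cochains_eqI[OF u, symmetric]) (simp add: additive_cochains_closed[OF u])
qed

lemma cochain_add_comm: "u \<in> additive_cochains n \<Longrightarrow> v \<in> additive_cochains n \<Longrightarrow> cochain_add n u v = cochain_add n v u"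
  unfolding cochain_add_def by (rule restrict_ext) (simp add: M.a_comm additive_cochains_closed)

lemma cochain_add_assoc: "u \<in> additive_cochains n \<Longrightarrow> v \<in> additive_cochains n \<Longrightarrow> w \<in> additive_cochains n \<Longrightarrow> cochain_add n (cochain_add n u v) w = cochain_add n u (cochain_add n v w)"
  unfolding cochain_add_def by (intro restrict_ext) (simp add: M.a_assoc additive_cochains_closed)

lemma cochain_add_inverse:
  assumes u: "u \<in> additive_cochains n"
  shows "\<exists>v\<in>additive_cochains n. cochain_add n v u = zero_cochain n"
proof
  show "(\<lambda>f\<in>carrier (cell_module n). \<ominus>\<^bsub>M\<^esub> u f) \<in> additive_cochains n"
    by (rule CaddI) (auto simp: additive_cochains_closed[OF u] additive_cochains_add[OF u] M.minus_add)
  show "cochain_add n (\<lambda>f\<in>carrier (cell_module n). \<ominus>\<^bsub>M\<^esub> u f) u = zero_cochain n"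
    unfolding cochain_add_def zero_cochain_def by (intro restrict_ext) (simp add: additive_cochains_closed[OF u] M.l_neg)
qed

lemma pullback_zc: "pullback n k L (zero_cochain k) = zero_cochain n"
  by (simp add: pullback_def zero_cochain_def)

lemma pullback_addc: "pullback n k L (cochain_add k u v) = cochain_add n (pullback n k L u) (pullback n k L v)"
  by (auto simp: pullback_def cochain_add_def intro!: restrict_ext)

lemma pullback_pb:
  assumes "cell_op k l L'"
  shows "pullback n k L (pullback k l L' u) = pullback n l (\<lambda>f. L' (L f)) u"
  by (auto simp: pullback_def truncate_op[OF assms] intro!: restrict_ext)

lemma pullback_plus:
  assumes "u \<in> additive_cochains k"
  shows "pullback n k (\<lambda>f m c. L f m c + L' f m c) u = cochain_add n (pullback n k L u) (pullback n k L' u)"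
  by (auto simp: pullback_def cochain_add_def additive_cochains_add[OF assms] intro!: restrict_ext)

lemma finite_CM: "finite (carrier (cell_module n))"
proof (rule finite_subset)
  let ?F = "{F. \<forall>x. (x \<in> {(m, c). cell n m c} \<longrightarrow> F x \<in> {0..int p}) \<and> (x \<notin> {(m, c). cell n m c} \<longrightarrow> F x = 0)}"
  show "carrier (cell_module n) \<subseteq> curry ` ?F"
  proof
    fix f assume "f \<in> carrier (cell_module n)"
    then have f: "truncate n f = f" by (simp add: cell_module_simps)
    have "f m c = (if cell n m c then f m c mod int p else 0)" for m c
      using fun_cong[OF fun_cong[OF f, of m], of c] by (simp add: truncate_def)
    then have "f m c \<in> {0..int p}" "\<not> cell n m c \<Longrightarrow> f m c = 0" for m c
      using mod_p_range[of "f m c"] by (smt (verit, best) atLeastAtMost_iff of_nat_0_le_iff, metis)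
    then have "case_prod f \<in> ?F" by auto
    then show "f \<in> curry ` ?F" by (intro image_eqI[of _ _ "case_prod f"]) auto
  qed
  show "finite (curry ` ?F)"
    by (intro finite_imageI finite_set_of_finite_funs finite_cells) auto
qed

lemma finite_Cadd: "finite (additive_cochains n)"
  by (rule finite_subset[of _ "carrier (cell_module n) \<rightarrow>\<^sub>E carrier M"])
    (auto simp: additive_cochains_def intro!: finite_PiE finite_CM M_finite)

lemma \<Phi>_simps: "carrier \<Phi> = {u. (\<forall>n. u n \<in> additive_cochains n) \<and> finite {n. u n \<noteq> zero_cochain n}}"
  "u \<otimes>\<^bsub>\<Phi>\<^esub> v = (\<lambda>n. cochain_add n (u n) (v n))" "\<one>\<^bsub>\<Phi>\<^esub> = zero_cochain"
  by (simp_all add: \<Phi>_def)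

lemma \<Phi>_group: "comm_group \<Phi>"
proof (rule comm_groupI)
  fix u v assume uv: "u \<in> carrier \<Phi>" "v \<in> carrier \<Phi>"
  then have fin: "finite ({n. u n \<noteq> zero_cochain n} \<union> {n. v n \<noteq> zero_cochain n})" by (simp add: \<Phi>_simps)
  have "cochain_add n (u n) (v n) = zero_cochain n" if "u n = zero_cochain n" "v n = zero_cochain n" for n
    using that by (simp add: cochain_add_zc)
  then have "finite {n. cochain_add n (u n) (v n) \<noteq> zero_cochain n}" by (intro finite_subset[OF _ fin]) blast
  then show "u \<otimes>\<^bsub>\<Phi>\<^esub> v \<in> carrier \<Phi>" using uv by (simp add: \<Phi>_simps)
  show "u \<otimes>\<^bsub>\<Phi>\<^esub> v = v \<otimes>\<^bsub>\<Phi>\<^esub> u" using uv by (simp add: \<Phi>_simps cochain_add_comm)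
next
  fix u v w assume "u \<in> carrier \<Phi>" "v \<in> carrier \<Phi>" "w \<in> carrier \<Phi>"
  then show "u \<otimes>\<^bsub>\<Phi>\<^esub> v \<otimes>\<^bsub>\<Phi>\<^esub> w = u \<otimes>\<^bsub>\<Phi>\<^esub> (v \<otimes>\<^bsub>\<Phi>\<^esub> w)" by (simp add: \<Phi>_simps cochain_add_assoc)
next
  fix u assume u: "u \<in> carrier \<Phi>"
  then show "\<one>\<^bsub>\<Phi>\<^esub> \<otimes>\<^bsub>\<Phi>\<^esub> u = u" by (simp add: \<Phi>_simps cochain_add_zc)
  have "\<forall>n. \<exists>v. v \<in> additive_cochains n \<and> cochain_add n v (u n) = zero_cochain n \<and> (u n = zero_cochain n \<longrightarrow> v = zero_cochain n)"
    using u cochain_add_inverse cochain_add_zc[OF zero_cochain_Cadd] by (simp add: \<Phi>_simps) (metis zero_cochain_Cadd)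
  then obtain v where v: "\<And>n. v n \<in> additive_cochains n" "\<And>n. cochain_add n (v n) (u n) = zero_cochain n" "\<And>n. u n = zero_cochain n \<Longrightarrow> v n = zero_cochain n" by metis
  have "finite {n. u n \<noteq> zero_cochain n}" using u by (simp add: \<Phi>_simps)
  then have "finite {n. v n \<noteq> zero_cochain n}" by (rule finite_subset[rotated]) (use v(3) in blast)
  then show "\<exists>v\<in>carrier \<Phi>. v \<otimes>\<^bsub>\<Phi>\<^esub> u = \<one>\<^bsub>\<Phi>\<^esub>"
    using v by (intro bexI[of _ v]) (simp_all add: \<Phi>_simps)
qed (simp add: \<Phi>_simps)

lemma op_esym_at: "2 * i \<le> n \<Longrightarrow> cell_op n (n - 2 * i) (esym {..<r} i)"
  using op_esym[of "{..<r}" "n - 2 * i" i] by simp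

lemma cochain_op_Cadd: "(\<And>n. u n \<in> additive_cochains n) \<Longrightarrow> cochain_op i u n \<in> additive_cochains n"
proof (cases "2 * Suc i \<le> n")
  case True
  assume "\<And>n. u n \<in> additive_cochains n"
  then show ?thesis unfolding cochain_op_def if_P[OF True] by (intro pullback_Cadd[OF op_esym_at[OF True]])
next
  case False
  then show ?thesis unfolding cochain_op_def by simp
qed

lemma cochain_op_closed:
  assumes "u \<in> carrier \<Phi>" shows "cochain_op i u \<in> carrier \<Phi>"
proof -
  have u: "\<And>n. u n \<in> additive_cochains n" "finite {n. u n \<noteq> zero_cochain n}" using assms by (auto simp: \<Phi>_simps)
  have "{n. cochain_op i u n \<noteq> zero_cochain n} \<subseteq> (\<lambda>n. n + 2 * Suc i) ` {n. u n \<noteq> zero_cochain n}"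
  proof
    fix n assume "n \<in> {n. cochain_op i u n \<noteq> zero_cochain n}"
    then have n: "cochain_op i u n \<noteq> zero_cochain n" by simp
    then have "2 * Suc i \<le> n" unfolding cochain_op_def by presburger
    moreover from this n have "u (n - 2 * Suc i) \<noteq> zero_cochain (n - 2 * Suc i)"
      unfolding cochain_op_def using pullback_zc by metis
    ultimately show "n \<in> (\<lambda>n. n + 2 * Suc i) ` {n. u n \<noteq> zero_cochain n}"
      by (intro image_eqI[of _ _ "n - 2 * Suc i"]) auto
  qed
  then have "finite {n. cochain_op i u n \<noteq> zero_cochain n}" using u(2) finite_subset by blast
  then show ?thesis using cochain_op_Cadd[OF u(1)] by (simp add: \<Phi>_simps)
qed

lemma cochain_op_comm: "cochain_op i (cochain_op j u) = cochain_op j (cochain_op i u)"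
proof
  have EE2: "cochain_op i (cochain_op j u) n = (if 2 * Suc i + 2 * Suc j \<le> n
    then pullback n (n - (2 * Suc i + 2 * Suc j)) (\<lambda>f. esym {..<r} (Suc j) (esym {..<r} (Suc i) f)) (u (n - (2 * Suc i + 2 * Suc j)))
    else zero_cochain n)" for i j n
  proof (cases "2 * Suc i + 2 * Suc j \<le> n")
    case True
    then have "2 * Suc i \<le> n" "2 * Suc j \<le> n - 2 * Suc i" "n - 2 * Suc i - 2 * Suc j = n - (2 * Suc i + 2 * Suc j)" by linarith+
    then show ?thesis
      using True pullback_pb[OF op_esym_at[of "Suc j" "n - 2 * Suc i"], of n]
      unfolding cochain_op_def by simp
  next
    case False
    then have "\<not> 2 * Suc j \<le> n - 2 * Suc i" if "2 * Suc i \<le> n" using that by linarith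
    then show ?thesis using False unfolding cochain_op_def by (auto simp: pullback_zc)
  qed
  show "cochain_op i (cochain_op j u) n = cochain_op j (cochain_op i u) n" for n
    unfolding EE2 by (simp add: esym_esym[of "{..<r}" "{..<r}" "Suc i" "Suc j"] add.commute)
qed

lemma \<Phi>_pow:
  assumes u: "u \<in> carrier \<Phi>"
  shows "(u [^]\<^bsub>\<Phi>\<^esub> (k::nat)) n = (\<lambda>f\<in>carrier (cell_module n). [k] \<cdot>\<^bsub>M\<^esub> u n f)"
proof (induction k)
  case 0
  then show ?case by (simp add: \<Phi>_simps zero_cochain_def nat_pow_def)
next
  case (Suc k)
  interpret \<Phi>: comm_group \<Phi> by (rule \<Phi>_group)
  have "u n f \<in> carrier M" if "f \<in> carrier (cell_module n)" for f using u that additive_cochains_closed by (auto simp: \<Phi>_simps)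
  then show ?case by (auto simp: \<Phi>_simps(2) Suc cochain_add_def M.add.nat_pow_Suc intro!: restrict_ext)
qed

lemma ops: "operator_group \<Phi> cochain_op r (card (carrier M))"
proof -
  interpret \<Phi>: comm_group \<Phi> by (rule \<Phi>_group)
  show ?thesis
  proof unfold_locales
    show "cochain_op i \<in> hom \<Phi> \<Phi>" for i
    proof (rule homI)
      show "cochain_op i u \<in> carrier \<Phi>" if "u \<in> carrier \<Phi>" for u using that by (rule cochain_op_closed)
      show "cochain_op i (u \<otimes>\<^bsub>\<Phi>\<^esub> v) = cochain_op i u \<otimes>\<^bsub>\<Phi>\<^esub> cochain_op i v" for u v
        by (rule ext) (simp add: \<Phi>_simps cochain_op_def pullback_addc cochain_add_zc)
    qed
    show "cochain_op i (cochain_op j u) = cochain_op j (cochain_op i u)" for i j u by (rule cochain_op_comm)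
    show "0 < card (carrier M)" using M_finite by (auto simp: card_gt_0_iff)
    show "u [^]\<^bsub>\<Phi>\<^esub> card (carrier M) = \<one>\<^bsub>\<Phi>\<^esub>" if u: "u \<in> carrier \<Phi>" for u
    proof
      fix n
      \<comment> \<open>Lagrange's theorem: the order of a finite group annihilates it, which
        supplies \<open>torsion\<close>.\<close>
      have "[card (carrier M)] \<cdot>\<^bsub>M\<^esub> x = \<zero>\<^bsub>M\<^esub>" if "x \<in> carrier M" for x
        using M.add.pow_order_eq_1[OF that] by (simp add: order_def)
      moreover have "u n f \<in> carrier M" if "f \<in> carrier (cell_module n)" for f using u that additive_cochains_closed by (auto simp: \<Phi>_simps)
      ultimately show "(u [^]\<^bsub>\<Phi>\<^esub> card (carrier M)) n = \<one>\<^bsub>\<Phi>\<^esub> n"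
        unfolding \<Phi>_pow[OF u] by (auto simp: \<Phi>_simps zero_cochain_def intro!: restrict_ext)
    qed
  qed
qed

sublocale ops: operator_group \<Phi> cochain_op r "card (carrier M)" by (rule ops)

definition single :: "nat \<Rightarrow> (chain \<Rightarrow> 'm) \<Rightarrow> nat \<Rightarrow> chain \<Rightarrow> 'm" where
  "single n u = (\<lambda>k. if k = n then u else zero_cochain k)"

text \<open>The finite group from which \<open>hilbert_basis\<close> starts. Its degree bound is
  that of \<open>unshift_pshift\<close>, above which a cochain decomposes into \<open>r\<close>-fold
  shifts.\<close>

definition low_cochains :: "(nat \<Rightarrow> chain \<Rightarrow> 'm) set" where
  "low_cochains = {u \<in> carrier \<Phi>. \<forall>n>2 * r * r. u n = zero_cochain n}"

lemma sg_\<Phi>: "u \<in> additive_cochains n \<Longrightarrow> single n u \<in> carrier \<Phi>"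
  unfolding \<Phi>_simps by (auto simp: single_def intro!: finite_subset[of _ "{n}"])

lemma single_mult: "single n (cochain_add n u v) = single n u \<otimes>\<^bsub>\<Phi>\<^esub> single n v"
  by (auto simp: \<Phi>_simps single_def fun_eq_iff cochain_add_zc)

lemma single_zc: "single n (zero_cochain n) = \<one>\<^bsub>\<Phi>\<^esub>"
  by (auto simp: \<Phi>_simps single_def)

lemma cochain_op_sg: "u \<in> additive_cochains n \<Longrightarrow> cochain_op i (single n u) = single (n + 2 * Suc i) (pullback (n + 2 * Suc i) n (esym {..<r} (Suc i)) u)"
proof
  fix k
  show "cochain_op i (single n u) k = single (n + 2 * Suc i) (pullback (n + 2 * Suc i) n (esym {..<r} (Suc i)) u) k"
  proof (cases "k = n + 2 * Suc i")
    case True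
    then show ?thesis by (simp add: cochain_op_def single_def)
  next
    case False
    then have "k - 2 * Suc i \<noteq> n" if "2 * Suc i \<le> k" using that by linarith
    then show ?thesis using False unfolding cochain_op_def single_def by (simp add: pullback_zc)
  qed
qed

lemma low_cochains_finite_stable: "finite low_cochains" "ops.op_stable 0 low_cochains"
proof -
  have "low_cochains \<subseteq> (\<lambda>F n. if n \<le> 2 * r * r then F n else zero_cochain n) ` (Pi\<^sub>E {..2 * r * r} additive_cochains)"
  proof
    fix u assume u: "u \<in> low_cochains"
    then have "u = (\<lambda>n. if n \<le> 2 * r * r then restrict u {..2 * r * r} n else zero_cochain n)"
      by (auto simp: low_cochains_def)
    moreover have "restrict u {..2 * r * r} \<in> Pi\<^sub>E {..2 * r * r} additive_cochains" using u by (auto simp: low_cochains_def \<Phi>_simps)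
    ultimately show "u \<in> (\<lambda>F n. if n \<le> 2 * r * r then F n else zero_cochain n) ` (Pi\<^sub>E {..2 * r * r} additive_cochains)" by (rule image_eqI)
  qed
  moreover have "finite (Pi\<^sub>E {..2 * r * r} additive_cochains)" by (intro finite_PiE finite_Cadd) simp
  ultimately show "finite low_cochains" by (meson finite_imageI finite_subset)
  show "ops.op_stable 0 low_cochains"
    unfolding ops.op_stable_def low_cochains_def
  proof (intro conjI ballI)
    fix u v assume u: "u \<in> {u \<in> carrier \<Phi>. \<forall>n>2 * r * r. u n = zero_cochain n}" and v: "v \<in> {u \<in> carrier \<Phi>. \<forall>n>2 * r * r. u n = zero_cochain n}"
    then show "u \<otimes>\<^bsub>\<Phi>\<^esub> v \<in> {u \<in> carrier \<Phi>. \<forall>n>2 * r * r. u n = zero_cochain n}"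
      using ops.m_closed[of u v] by (simp add: \<Phi>_simps(2) cochain_add_zc)
  next
    show "\<one>\<^bsub>\<Phi>\<^esub> \<in> {u \<in> carrier \<Phi>. \<forall>n>2 * r * r. u n = zero_cochain n}" using ops.one_closed by (simp add: \<Phi>_simps(3))
  qed auto
qed

abbreviation "low_closure \<equiv> ops.op_closure r low_cochains"

lemma low_cochains_carrier: "low_cochains \<subseteq> carrier \<Phi>"
  by (auto simp: low_cochains_def)

lemma low_closure_inv: "u \<in> low_closure \<Longrightarrow> inv\<^bsub>\<Phi>\<^esub> u \<in> low_closure"
  by (rule ops.stable_inv[OF ops.stable_op_closure[OF low_cochains_carrier order_refl]])

lemma op_comp: "cell_op n k L \<Longrightarrow> cell_op k l L' \<Longrightarrow> cell_op n l (\<lambda>f. L' (L f))"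
  by (simp add: cell_op_def linear_op_def)

text \<open>
  With \<open>x = s\<^sub>j\<close> and \<open>e'\<close> the elementary symmetric polynomials in the other shifts,
  \<open>e\<^sub>i\<^sub>+\<^sub>1 = e'\<^sub>i\<^sub>+\<^sub>1 + x e'\<^sub>i\<close> turns \<open>x\<^sup>r\<^sup>-\<^sup>i e'\<^sub>i\<close> into \<open>x\<^sup>r\<^sup>-\<^sup>i\<^sup>-\<^sup>1 e\<^sub>i\<^sub>+\<^sub>1 - x\<^sup>r\<^sup>-\<^sup>i\<^sup>-\<^sup>1 e'\<^sub>i\<^sub>+\<^sub>1\<close>, and \<open>e'\<^sub>r = 0\<close>. Hence \<open>x\<^sup>r\<close> is a
  combination of the \<open>e\<^sub>i\<close>.
\<close>

lemma power_in_closure: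
  assumes j: "j < r" and v: "v \<in> additive_cochains k"
    and IH: "\<And>l w. l < k + 2 * r \<Longrightarrow> w \<in> additive_cochains l \<Longrightarrow> single l w \<in> low_closure"
  shows "single (k + 2 * r) (pullback (k + 2 * r) k (pshift {j} r) v) \<in> low_closure"
proof -
  let ?n = "k + 2 * r" and ?B = "{..<r} - {j}"
  define L where "L i f = pshift {j} (r - i) (esym ?B i f)" for i f
  have opp: "cell_op (l + 2 * i) l (pshift {j} i)" for i l using op_pshift[of "{j}" l i] j by simp
  have opL: "cell_op ?n k (L i)" if "i \<le> r" for i
  proof -
    have "cell_op (k + 2 * (r - i) + 2 * i) (k + 2 * (r - i)) (esym ?B i)" by (rule op_esym) auto
    moreover have "k + 2 * (r - i) + 2 * i = ?n" using that by simp
    ultimately show ?thesis unfolding L_def using op_comp[OF _ opp] by metis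
  qed
  have "single ?n (pullback ?n k (L i) v) \<in> low_closure" if "i \<le> r" for i
    using that
  \<comment> \<open>The induction descends from \<open>i = r\<close> to \<open>i = 0\<close>, where
    \<open>L 0\<close> is the \<open>r\<close>-fold shift.\<close>
  proof (induction i rule: inc_induct)
    case base
    have "L r f = (\<lambda>m c. 0)" for f
      unfolding L_def using esym_large[of ?B r f] j linear_op_zero[OF linear_pshift] by simp
    then have "pullback ?n k (L r) v = zero_cochain ?n" unfolding pullback_def zero_cochain_def by (simp add: additive_cochains_zero[OF v])
    then show ?case by (simp add: single_zc ops.op_closure.one)
  next
    case (step i)
    let ?l = "k + 2 * (r - Suc i)"
    \<comment> \<open>\<open>w\<close> has degree below \<open>k + 2 * r\<close>, so
      \<open>IH\<close> applies to it; the operator of index \<open>i\<close> brings it back to that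
      degree.\<close>
    define w where "w = pullback ?l k (pshift {j} (r - Suc i)) v"
    have w: "w \<in> additive_cochains ?l" unfolding w_def by (rule pullback_Cadd[OF opp v])
    have n: "?l + 2 * Suc i = ?n" using step by simp
    have E: "single ?n (pullback ?n ?l (esym {..<r} (Suc i)) w) \<in> low_closure"
    proof -
      have "single ?l w \<in> low_closure" by (rule IH[OF _ w]) (use step in simp)
      then have "cochain_op i (single ?l w) \<in> low_closure" using step by (intro ops.op_closure.op) auto
      then show ?thesis by (simp only: cochain_op_sg[OF w] n)
    qed
    have "pshift {j} (r - Suc i) (esym {..<r} (Suc i) f) = (\<lambda>m c. L (Suc i) f m c + L i f m c)" for f
    proof -
      have ins: "insert j ?B = {..<r}" using j by auto
      have "esym {..<r} (Suc i) f = (\<lambda>m c. esym ?B (Suc i) f m c + esym ?B i (pshift {j} 1 f) m c)"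
        using esym_insert[of ?B j i f] ins by simp
      moreover have "pshift {j} (r - Suc i) (esym ?B i (pshift {j} 1 f)) = L i f"
      proof -
        have "r - i = r - Suc i + 1" using step by simp
        then show ?thesis unfolding L_def using pshift_add[of j "r - Suc i" 1] by (simp add: pshift_esym)
      qed
      ultimately show ?thesis using linear_op_add[OF linear_pshift] by (simp add: L_def)
    qed
    then have "pullback ?n ?l (esym {..<r} (Suc i)) w = pullback ?n k (\<lambda>f m c. L (Suc i) f m c + L i f m c) v"
      unfolding w_def using pullback_pb[OF opp] by simp
    also have "\<dots> = cochain_add ?n (pullback ?n k (L (Suc i)) v) (pullback ?n k (L i) v)" by (rule pullback_plus[OF v])
    finally have eq: "single ?n (pullback ?n ?l (esym {..<r} (Suc i)) w) = single ?n (pullback ?n k (L (Suc i)) v) \<otimes>\<^bsub>\<Phi>\<^esub> single ?n (pullback ?n k (L i) v)"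
      by (simp add: single_mult)
    \<comment> \<open>\<open>E\<close> places the product of \<open>?a\<close> and \<open>?b\<close>
      in the closure, and \<open>?a\<close> is there by induction; dividing leaves
      \<open>?b\<close>.\<close>
    let ?a = "single ?n (pullback ?n k (L (Suc i)) v)" and ?b = "single ?n (pullback ?n k (L i) v)"
    have c: "?a \<in> carrier \<Phi>" "?b \<in> carrier \<Phi>" using sg_\<Phi>[OF pullback_Cadd[OF opL v]] step by auto
    have "inv\<^bsub>\<Phi>\<^esub> ?a \<otimes>\<^bsub>\<Phi>\<^esub> (?a \<otimes>\<^bsub>\<Phi>\<^esub> ?b) \<in> low_closure"
      using E unfolding eq by (intro ops.op_closure.mult[OF low_closure_inv[OF step.IH]])
    moreover have "inv\<^bsub>\<Phi>\<^esub> ?a \<otimes>\<^bsub>\<Phi>\<^esub> (?a \<otimes>\<^bsub>\<Phi>\<^esub> ?b) = ?b"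
    proof -
      have "inv\<^bsub>\<Phi>\<^esub> ?a \<otimes>\<^bsub>\<Phi>\<^esub> (?a \<otimes>\<^bsub>\<Phi>\<^esub> ?b) = (inv\<^bsub>\<Phi>\<^esub> ?a \<otimes>\<^bsub>\<Phi>\<^esub> ?a) \<otimes>\<^bsub>\<Phi>\<^esub> ?b"
        by (rule ops.m_assoc[OF ops.inv_closed[OF c(1)] c, symmetric])
      also have "\<dots> = ?b" unfolding ops.l_inv[OF c(1)] by (rule ops.l_one[OF c(2)])
      finally show ?thesis .
    qed
    ultimately show ?case by (simp only:)
  qed
  moreover have "L 0 = pshift {j} r" unfolding L_def by (rule ext) (simp add: esym_0)
  ultimately show ?thesis by (metis le0)
qed

text \<open>Above the bound, \<open>u\<close> is the sum over \<open>j\<close> of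
  \<open>r\<close>-fold shifts of cochains \<open>v j\<close> whose degree is lower by
  \<open>2 * r\<close>. Each summand is covered by \<open>power_in_closure\<close>, which uses the
  induction hypothesis in all smaller degrees.\<close>

lemma single_in_closure: "u \<in> additive_cochains n \<Longrightarrow> single n u \<in> low_closure"
proof (induction n arbitrary: u rule: less_induct)
  case (less n)
  show ?case
  proof (cases "n > 2 * r * r")
    case False
    then have "single n u \<in> low_cochains" using sg_\<Phi>[OF less.prems] by (auto simp: low_cochains_def single_def)
    then show ?thesis by (rule ops.op_closure.incl)
  next
    case True
    \<comment> \<open>This holds for \<open>r = 0\<close> too, and makes \<open>n - 2 * r\<close> a
      genuine difference.\<close>
    have "2 * r \<le> 2 * r * r" by (cases r) auto
    then have n: "n - 2 * r + 2 * r = n" using True by linarith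
    let ?k = "n - 2 * r"
    define F where "F j f = unshift j (pshift {j} r f)" for j f
    define v where "v j = pullback ?k n (unshift j) u" for j
    have opp: "cell_op n ?k (pshift {j} r)" if "j < r" for j using op_pshift[of "{j}" ?k r] that n by simp
    have opu: "cell_op ?k n (unshift j)" if "j < r" for j using op_unshift[OF that, of ?k] n by simp
    have opF: "cell_op n n (F j)" if "j < r" for j unfolding F_def by (rule op_comp[OF opp[OF that] opu[OF that]])
    have vF: "pullback n ?k (pshift {j} r) (v j) = pullback n n (F j) u" if "j < r" for j
      unfolding v_def F_def by (rule pullback_pb[OF opu[OF that]])
    have "single n (pullback n n (F j) u) \<in> low_closure" if "j < r" for j
      using power_in_closure[OF that, of "v j" ?k] pullback_Cadd[OF opu[OF that] less.prems] less.IH vF[OF that] n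
      unfolding v_def by simp
    moreover have "single n (pullback n n (\<lambda>f m c. \<Sum>j<i. F j f m c) u) \<in> low_closure" if "i \<le> r" "\<And>j. j < r \<Longrightarrow> single n (pullback n n (F j) u) \<in> low_closure" for i
      using that(1)
    proof (induction i)
      case 0
      have "pullback n n (\<lambda>f m c. 0) u = zero_cochain n" unfolding pullback_def zero_cochain_def by (simp add: additive_cochains_zero[OF less.prems])
      then show ?case by (simp add: single_zc ops.op_closure.one)
    next
      case (Suc i)
      have "single n (pullback n n (\<lambda>f m c. \<Sum>j<Suc i. F j f m c) u) = single n (pullback n n (\<lambda>f m c. \<Sum>j<i. F j f m c) u) \<otimes>\<^bsub>\<Phi>\<^esub> single n (pullback n n (F i) u)"
        using pullback_plus[OF less.prems, of n "\<lambda>f m c. \<Sum>j<i. F j f m c" "F i"] by (simp add: single_mult)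
      then show ?case using Suc that(2)[of i] by (simp add: ops.op_closure.mult)
    qed
    ultimately have "single n (pullback n n (\<lambda>f m c. \<Sum>j<r. F j f m c) u) \<in> low_closure" by blast
    moreover have "pullback n n (\<lambda>f m c. \<Sum>j<r. F j f m c) u = u"
    proof -
      have "truncate n (\<lambda>m c. \<Sum>j<r. F j f m c) = f" if "f \<in> carrier (cell_module n)" for f
      proof -
        have "truncate n (\<lambda>m c. \<Sum>j<r. F j f m c) = truncate n f"
          unfolding truncate_eq_iff F_def by (rule eqvI) (rule unshift_pshift[OF True])
        then show ?thesis using that by (simp add: cell_module_simps)
      qed
      then show ?thesis
        unfolding pullback_def by (intro additive_cochains_eqI[OF less.prems, symmetric]) simp
    qed
    ultimately show ?thesis by simp
  qed
qed

lemma \<Phi>_closure: "carrier \<Phi> \<subseteq> low_closure"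
proof
  fix u assume u: "u \<in> carrier \<Phi>"
  then have "finite {n. u n \<noteq> zero_cochain n}" by (simp add: \<Phi>_simps)
  then obtain K where "{n. u n \<noteq> zero_cochain n} \<subseteq> {..<K}" using finite_nat_iff_bounded by blast
  then have "\<forall>n\<ge>K. u n = zero_cochain n" by (metis (mono_tags, lifting) lessThan_iff linorder_not_le mem_Collect_eq subsetD)
  with u show "u \<in> low_closure"
  proof (induction K arbitrary: u)
    case 0
    then have "u = \<one>\<^bsub>\<Phi>\<^esub>" by (auto simp: \<Phi>_simps)
    then show ?case by (simp add: ops.op_closure.one)
  next
    case (Suc K)
    define v where "v = u(K := zero_cochain K)"
    have uC: "\<And>n. u n \<in> additive_cochains n" "finite {n. u n \<noteq> zero_cochain n}" using Suc by (auto simp: \<Phi>_simps)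
    have "finite {n. v n \<noteq> zero_cochain n}" by (rule finite_subset[OF _ uC(2)]) (auto simp: v_def)
    then have v: "v \<in> carrier \<Phi>" using uC(1) by (simp add: \<Phi>_simps v_def)
    have "u = v \<otimes>\<^bsub>\<Phi>\<^esub> single K (u K)"
    proof
      fix n show "u n = (v \<otimes>\<^bsub>\<Phi>\<^esub> single K (u K)) n"
        using cochain_add_zc[OF uC(1)] cochain_add_comm[OF uC(1) zero_cochain_Cadd] by (simp add: \<Phi>_simps v_def single_def)
    qed
    moreover have "v \<in> low_closure"
    proof (rule Suc.IH[OF v], intro allI impI)
      fix n assume "K \<le> n"
      then show "v n = zero_cochain n" using Suc.prems(2) by (cases "n = K") (auto simp: v_def)
    qed
    ultimately show ?case using single_in_closure[OF uC(1)] ops.op_closure.mult by metis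
  qed
qed

theorem finitely_generated_cochains:
  assumes "ops.op_stable r U"
  shows "\<exists>S. finite S \<and> S \<subseteq> U \<and> U \<subseteq> ops.op_closure r S"
proof (rule ops.hilbert_basis[OF low_cochains_finite_stable order_refl assms])
  show "U \<subseteq> low_closure" using assms \<Phi>_closure by (auto simp: ops.op_stable_def)
qed

end

section \<open>Generation of the cohomology\<close>

lemma chain_map_comp:
  assumes P: "free_resolution R A P"
    and F: "chain_map_over R P Q n f F" and H: "chain_map_over R Q S k h H"
  shows "chain_map_over R P S (n + k) (\<lambda>x. h (F k x)) (\<lambda>i. \<lambda>x\<in>carrier (res_term P (n + k + i)). H i (F (k + i) x))"
proof -
  note PD = free_resolutionD[OF P]
  have Fh: "mhom R (res_term P (n + i)) (res_term Q i) (F i)" for i using F by (simp add: chain_map_over_def module_hom_iff)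
  have Hh: "mhom R (res_term Q (k + i)) (res_term S i) (H i)" for i using H by (simp add: chain_map_over_def module_hom_iff)
  show ?thesis
    unfolding chain_map_over_def
  proof (intro conjI allI ballI)
    fix i
    have "mhom R (res_term P (n + k + i)) (res_term S i) (\<lambda>x. H i (F (k + i) x))"
      using mhom_comp[OF Fh[of "k + i"] Hh[of i]] by (simp add: add.assoc)
    then show "(\<lambda>x\<in>carrier (res_term P (n + k + i)). H i (F (k + i) x)) \<in> module_hom R (res_term P (n + k + i)) (res_term S i)"
      by (rule left_module.mhom_restrict[OF PD(2)])
    fix x assume x: "x \<in> carrier (res_term P (Suc (n + k + i)))"
    have "F (Suc (k + i)) x \<in> carrier (res_term Q (Suc (k + i)))"
      using mhom_closed[OF Fh[of "Suc (k + i)"]] x by (simp add: add.assoc)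
    then have "res_diff S i (H (Suc i) (F (Suc (k + i)) x)) = H i (res_diff Q (k + i) (F (Suc (k + i)) x))"
      using H by (simp add: chain_map_over_def)
    also have "res_diff Q (k + i) (F (Suc (k + i)) x) = F (k + i) (res_diff P (n + k + i) x)"
      using F x by (simp add: chain_map_over_def add.assoc)
    finally show "res_diff S i ((\<lambda>x\<in>carrier (res_term P (n + k + Suc i)). H (Suc i) (F (k + Suc i) x)) x) =
      (\<lambda>x\<in>carrier (res_term P (n + k + i)). H i (F (k + i) x)) (res_diff P (n + k + i) x)"
      using x mhom_closed[OF PD(3) x] by simp
  next
    fix x assume x: "x \<in> carrier (res_term P (n + k))"
    then have "F k x \<in> carrier (res_term Q k)" by (rule mhom_closed[OF Fh])
    then show "res_aug S ((\<lambda>x\<in>carrier (res_term P (n + k + 0)). H 0 (F (k + 0) x)) x) = h (F k x)"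
      using H x by (simp add: chain_map_over_def)
  qed
qed

lemma aug_cocycle:
  assumes "free_resolution R A P"
  shows "res_aug P \<in> ext_cocycles R P A 0"
  using assms free_resolutionD(7)[OF assms] by (simp add: ext_cocycles_def free_resolution_def)

lemma chain_map_id:
  assumes P: "free_resolution R A P"
  shows "chain_map_over R P P 0 (res_aug P) (\<lambda>i. \<lambda>x\<in>carrier (res_term P i). x)"
proof -
  note PD = free_resolutionD[OF P]
  have "mhom R (res_term P i) (res_term P i) (\<lambda>x. x)" for i by (simp add: mhom_def)
  then have "(\<lambda>x\<in>carrier (res_term P i). x) \<in> module_hom R (res_term P i) (res_term P i)" for i
    by (rule left_module.mhom_restrict[OF PD(2)])
  then show ?thesis
    using mhom_closed[OF PD(3)] by (simp add: chain_map_over_def)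
qed

text \<open>\<open>f\<close> agrees on the carrier with the augmentation of \<open>Q\<close>
  composed with \<open>F 0\<close>, so it is the pullback of the cocycle
  \<open>res_aug Q\<close>.\<close>

lemma chain_map_cocycle:
  assumes A: "left_module R A" and P: "free_resolution R A P" and Q: "free_resolution R A Q"
    and F: "chain_map_over R P Q n f F"
  shows "restrict f (carrier (res_term P n)) \<in> ext_cocycles R P A n"
proof -
  have "restrict f (carrier (res_term P n)) = (\<lambda>x\<in>carrier (res_term P (n + 0)). res_aug Q (F 0 x))"
    using F by (auto simp: chain_map_over_def intro!: restrict_ext)
  then show ?thesis using pull_cocycle[OF A A P Q F aug_cocycle[OF Q]] by simp
qed

lemma chain_map_cong:
  "chain_map_over R P Q n f F \<Longrightarrow> (\<And>x. x \<in> carrier (res_term P n) \<Longrightarrow> f x = f' x) \<Longrightarrow> chain_map_over R P Q n f' F"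
  by (simp add: chain_map_over_def)

text \<open>Here \<open>f\<close> may have arbitrary values off the carrier; cut off there it
  becomes a cocycle by \<open>chain_map_cocycle\<close>, and \<open>pull_class_eq\<close> applies
  with equal cocycles on both sides.\<close>

lemma pull_class_unique:
  assumes A: "left_module R A" and M: "left_module R M"
    and P: "free_resolution R A P" and Q: "free_resolution R A Q"
    and F: "chain_map_over R P Q n f F" "chain_map_over R P Q n f F'"
    and g: "g \<in> ext_cocycles R Q M q"
  shows "ext_class R P M (n + q) (\<lambda>x\<in>carrier (res_term P (n + q)). g (F q x)) =
    ext_class R P M (n + q) (\<lambda>x\<in>carrier (res_term P (n + q)). g (F' q x))"
proof -
  interpret A: left_module R A by fact
  interpret M: left_module R M by fact
  interpret P: ext_setting R A P by (rule ext_setting.intro[OF A P])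
  interpret Q: ext_setting R A Q by (rule ext_setting.intro[OF A Q])
  let ?f = "restrict f (carrier (res_term P n))"
  have f: "?f \<in> ext_cocycles R P A n" by (rule chain_map_cocycle[OF A P Q F(1)])
  have F': "chain_map_over R P Q n ?f F" "chain_map_over R P Q n ?f F'" by (auto intro: chain_map_cong[OF F(1)] chain_map_cong[OF F(2)])
  have fh: "mhom R (res_term P n) A ?f" using f by (simp add: mem_ext_cocycles)
  have "(\<lambda>x\<in>carrier (res_term P n). ?f x \<ominus>\<^bsub>A\<^esub> ?f x) = (\<lambda>x\<in>carrier (res_term P n). \<zero>\<^bsub>A\<^esub>)"
    using cocycle_closed[OF f] by (intro restrict_ext A.minus_self)
  moreover have "(\<lambda>x\<in>carrier (res_term Q q). g x \<ominus>\<^bsub>M\<^esub> g x) = (\<lambda>x\<in>carrier (res_term Q q). \<zero>\<^bsub>M\<^esub>)"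
    using cocycle_closed[OF g] by (intro restrict_ext M.minus_self)
  ultimately show ?thesis
    using pull_class_eq[OF A M P Q F' fh fh _ g g] P.zero_coboundary[OF A] Q.zero_coboundary[OF M] by simp
qed

section \<open>Subrings and submodules generated inside Ext\<close>

lemma add_monoid_Ext:
  "add_monoid (Ext_ring R P A) = \<lparr>carrier = ext_sum_carrier R P A,
    monoid.mult = (\<lambda>x y n. x n \<otimes>\<^bsub>Ext R P A n\<^esub> y n), one = (\<lambda>n. \<one>\<^bsub>Ext R P A n\<^esub>)\<rparr>"
  by (simp add: Ext_ring_def)

context ext_setting
begin

lemma Ext_ring_add_group: "comm_group (add_monoid (Ext_ring R P A))"
  unfolding add_monoid_Ext by (rule ext_sum_group[OF A])

lemma Ext_ring_one_closed:
  "(\<lambda>n. if n = 0 then ext_class R P A 0 (res_aug P) else \<one>\<^bsub>Ext R P A n\<^esub>) \<in> ext_sum_carrier R P A"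
proof -
  interpret E: comm_group "Ext R P A n" for n by (rule Ext_comm_group[OF A])
  have "ext_class R P A 0 (res_aug P) \<in> carrier (Ext R P A 0)"
    using aug_cocycle[OF P] by (simp add: Ext_carrier)
  then show ?thesis by (auto simp: ext_sum_carrier_def intro: finite_subset[of _ "{0}"])
qed

lemma generate_ring_Ext_closed:
  assumes "S \<subseteq> ext_sum_carrier R P A"
  shows "generate_ring (Ext_ring R P A) S \<subseteq> ext_sum_carrier R P A"
proof
  interpret G: comm_group "add_monoid (Ext_ring R P A)" by (rule Ext_ring_add_group)
  have car: "carrier (Ext_ring R P A) = ext_sum_carrier R P A" by (simp add: Ext_ring_def)
  fix x assume "x \<in> generate_ring (Ext_ring R P A) S"
  then show "x \<in> ext_sum_carrier R P A"
  proof induction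
    case one
    then show ?case using Ext_ring_one_closed by (simp add: Ext_ring_def)
  next
    case (incl h)
    then show ?case using assms by blast
  next
    case (a_inv h)
    then show ?case using G.inv_closed[of h] by (simp add: a_inv_def car)
  next
    case (eng_add x y)
    then show ?case using G.m_closed[of x y] by (simp add: car)
  next
    case (eng_mult x y)
    then show ?case using ext_sum_prod_closed[OF A] by (simp add: Ext_ring_def)
  qed
qed

text \<open>\<open>generate_ring\<close> has no clause for zero, which is obtained as the sum of the
  unit and its negative.\<close>

lemma zero_in_generate_ring:
  assumes "S \<subseteq> ext_sum_carrier R P A"
  shows "(\<lambda>n. \<one>\<^bsub>Ext R P A n\<^esub>) \<in> generate_ring (Ext_ring R P A) S"
proof -
  interpret G: comm_group "add_monoid (Ext_ring R P A)" by (rule Ext_ring_add_group)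
  have "\<one>\<^bsub>Ext_ring R P A\<^esub> \<in> carrier (add_monoid (Ext_ring R P A))"
    using Ext_ring_one_closed by (simp add: Ext_ring_def)
  then have "\<one>\<^bsub>Ext_ring R P A\<^esub> \<oplus>\<^bsub>Ext_ring R P A\<^esub> \<ominus>\<^bsub>Ext_ring R P A\<^esub> \<one>\<^bsub>Ext_ring R P A\<^esub> = \<zero>\<^bsub>Ext_ring R P A\<^esub>"
    using G.r_inv by (simp add: a_inv_def)
  moreover have "\<one>\<^bsub>Ext_ring R P A\<^esub> \<oplus>\<^bsub>Ext_ring R P A\<^esub> \<ominus>\<^bsub>Ext_ring R P A\<^esub> \<one>\<^bsub>Ext_ring R P A\<^esub> \<in> generate_ring (Ext_ring R P A) S"
    by (intro generate_ring.eng_add generate_ring.a_inv generate_ring.one)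
  ultimately show ?thesis by (simp add: Ext_ring_def)
qed

lemma generate_module_Ext_closed:
  assumes M: "left_module R M" and "S \<subseteq> ext_sum_carrier R P M"
  shows "generate_module (Ext_ring R P A) (Ext_module R P M) S \<subseteq> ext_sum_carrier R P M"
proof
  interpret G: comm_group "\<lparr>carrier = ext_sum_carrier R P M, monoid.mult = (\<lambda>x y n. x n \<otimes>\<^bsub>Ext R P M n\<^esub> y n),
    one = (\<lambda>n. \<one>\<^bsub>Ext R P M n\<^esub>)\<rparr>" by (rule ext_sum_group[OF M])
  fix x assume "x \<in> generate_module (Ext_ring R P A) (Ext_module R P M) S"
  then show "x \<in> ext_sum_carrier R P M"
  proof induction
    case zero
    then show ?case using G.one_closed by (simp add: Ext_module_def)
  next
    case (incl h)
    then show ?case using assms by blast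
  next
    case (add x y)
    then show ?case using G.m_closed[of x y] by (simp add: Ext_module_def)
  next
    case (smult a x)
    then show ?case using ext_sum_prod_closed[OF M] by (simp add: Ext_module_def Ext_ring_def)
  qed
qed

end

text \<open>Adjoining a generator \<open>s\<close> to a finite submodule gives an image of the
  product of the scalars with that submodule.\<close>

lemma finite_module:
  assumes M: "left_module R M" and R: "finite (carrier R)" and fg: "finitely_generated_module R M"
  shows "finite (carrier M)"
proof -
  interpret M: left_module R M by fact
  have "finite (generate_module R M S) \<and> generate_module R M S \<subseteq> carrier M" if "finite S" "S \<subseteq> carrier M" for S
    using that
  proof induction
    case empty
    have "x = \<zero>\<^bsub>M\<^esub>" if "x \<in> generate_module R M {}" for x
      using that by induction auto
    then have "generate_module R M {} \<subseteq> {\<zero>\<^bsub>M\<^esub>}" by blast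
    then show ?case using finite_subset by fastforce
  next
    case (insert s S)
    let ?g = "\<lambda>(a, y). a \<odot>\<^bsub>M\<^esub> s \<oplus>\<^bsub>M\<^esub> y"
    have s: "s \<in> carrier M" and S: "generate_module R M S \<subseteq> carrier M" "finite (generate_module R M S)" using insert by auto
    have mem: "a \<odot>\<^bsub>M\<^esub> s \<oplus>\<^bsub>M\<^esub> y \<in> ?g ` (carrier R \<times> generate_module R M S)"
      if "a \<in> carrier R" "y \<in> generate_module R M S" for a y
      using that by (intro image_eqI[of _ _ "(a, y)"]) auto
    have "x \<in> ?g ` (carrier R \<times> generate_module R M S)" if "x \<in> generate_module R M (insert s S)" for x
      using that
    proof induction
      case zero
      show ?case using mem[OF M.R.zero_closed generate_module.zero] s by simp
    next
      case (incl x)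
      show ?case
      proof (cases "x = s")
        case True
        then show ?thesis using mem[OF M.R.one_closed generate_module.zero] s by simp
      next
        case False
        then have x: "x \<in> generate_module R M S" using incl by (simp add: generate_module.incl)
        then have "x \<in> carrier M" using S by auto
        then show ?thesis using mem[OF M.R.zero_closed x] s by simp
      qed
    next
      case (add x y)
      then obtain a b v w where *: "a \<in> carrier R" "b \<in> carrier R" "v \<in> generate_module R M S" "w \<in> generate_module R M S"
        "x = a \<odot>\<^bsub>M\<^esub> s \<oplus>\<^bsub>M\<^esub> v" "y = b \<odot>\<^bsub>M\<^esub> s \<oplus>\<^bsub>M\<^esub> w" by auto
      then have vw: "v \<in> carrier M" "w \<in> carrier M" using S by auto
      have "x \<oplus>\<^bsub>M\<^esub> y = (a \<oplus>\<^bsub>R\<^esub> b) \<odot>\<^bsub>M\<^esub> s \<oplus>\<^bsub>M\<^esub> (v \<oplus>\<^bsub>M\<^esub> w)"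
        using * vw s by (simp add: M.smult_l_distr M.M.a_ac)
      then show ?case using mem[of "a \<oplus>\<^bsub>R\<^esub> b" "v \<oplus>\<^bsub>M\<^esub> w"] * by (simp add: generate_module.add)
    next
      case (smult b x)
      then obtain a v where *: "a \<in> carrier R" "v \<in> generate_module R M S" "x = a \<odot>\<^bsub>M\<^esub> s \<oplus>\<^bsub>M\<^esub> v" by auto
      then have v: "v \<in> carrier M" using S by auto
      have "b \<odot>\<^bsub>M\<^esub> x = (b \<otimes>\<^bsub>R\<^esub> a) \<odot>\<^bsub>M\<^esub> s \<oplus>\<^bsub>M\<^esub> b \<odot>\<^bsub>M\<^esub> v"
        using * v s smult by (simp add: M.smult_r_distr M.smult_assoc1)
      then show ?case using mem[of "b \<otimes>\<^bsub>R\<^esub> a" "b \<odot>\<^bsub>M\<^esub> v"] * smult by (simp add: generate_module.smult)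
    qed
    then have sub: "generate_module R M (insert s S) \<subseteq> ?g ` (carrier R \<times> generate_module R M S)" by blast
    have cl: "?g ` (carrier R \<times> generate_module R M S) \<subseteq> carrier M" using s S by auto
    have fin: "finite (?g ` (carrier R \<times> generate_module R M S))" using R S by simp
    show ?case using finite_subset[OF sub fin] subset_trans[OF sub cl] by (rule conjI)
  qed
  moreover obtain S where "finite S" "S \<subseteq> carrier M" "generate_module R M S = carrier M"
    using fg by (auto simp: finitely_generated_module_def)
  ultimately show ?thesis by metis
qed

section \<open>The classes \<open>\<zeta>\<close> and the passage to an arbitrary resolution\<close>

context group_complex
begin

lemma cell_resolution_simps: "res_term cell_resolution = cell_module" "res_diff cell_resolution n = (\<lambda>f\<in>carrier (cell_module (Suc n)). truncate n (diff f))"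
  by (simp_all add: cell_resolution_def)

definition chain_op :: "nat \<Rightarrow> nat \<Rightarrow> chain \<Rightarrow> chain" where
  "chain_op i k = (\<lambda>f\<in>carrier (cell_module (2 * Suc i + k)). truncate k (esym {..<r} (Suc i) f))"

text \<open>The augmentation of \<open>chain_op i\<close>. An equivariant chain map lifts its own
  augmentation, so precomposition with the elementary symmetric polynomial of index
  \<open>Suc i\<close> is the Yoneda product with the class of this cocycle.\<close>

definition zeta :: "nat \<Rightarrow> chain \<Rightarrow> int" where
  "zeta i = (\<lambda>f. res_aug cell_resolution (chain_op i 0 f))"

lemma op_esym': "cell_op (2 * i + k) k (esym {..<r} i)"
  using op_esym[of "{..<r}" k i] by (simp add: add.commute)

lemma chain_op_chain_map:
  assumes R: "ring kG"
  shows "chain_map_over kG cell_resolution cell_resolution (2 * Suc i) (zeta i) (chain_op i)"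
  unfolding chain_map_over_def cell_resolution_simps
proof (intro conjI allI ballI)
  show "chain_op i k \<in> module_hom kG (cell_module (2 * Suc i + k)) (cell_module k)" for k
    unfolding chain_op_def by (rule op_module_hom[OF R op_esym']) (simp add: esym_act)
  fix k f assume f: "f \<in> carrier (cell_module (Suc (2 * Suc i + k)))"
  have "truncate k (diff (esym {..<r} (Suc i) f)) = truncate k (esym {..<r} (Suc i) (diff f))"
    by (simp add: esym_diff)
  then have "truncate k (diff (truncate (Suc k) (esym {..<r} (Suc i) f))) = truncate k (esym {..<r} (Suc i) (truncate (2 * Suc i + k) (diff f)))"
    by (simp only: truncate_op[OF op_diff] truncate_op[OF op_esym'])
  then show "(\<lambda>f\<in>carrier (cell_module (Suc k)). truncate k (diff f)) (chain_op i (Suc k) f) =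
    chain_op i k ((\<lambda>f\<in>carrier (cell_module (Suc (2 * Suc i + k))). truncate (2 * Suc i + k) (diff f)) f)"
    using f by (simp add: chain_op_def cell_module_simps(1))
qed (simp add: zeta_def)

text \<open>Generation is phrased as an induction principle over sets \<open>T\<close>, because it
  serves both for the submodule generated by \<open>S\<close> and, with the trivial module for
  \<open>M\<close>, for the subring generated by \<open>S\<close> and the \<open>\<zeta> i\<close>.
  The elements of \<open>S\<close> are the classes of finitely many cocycles that generate all
  cocycles on the cell resolution under the symmetric operators.\<close>

lemma cohomology_generation:
  assumes P: "free_resolution kG triv P" and M: "left_module kG M" and fin: "finite (carrier M)"
  obtains S \<zeta> where "finite S" "S \<subseteq> ext_sum_carrier kG P M" "\<And>i. \<zeta> i \<in> ext_sum_carrier kG P triv"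
    and "\<And>T. \<lbrakk>T \<subseteq> ext_sum_carrier kG P M; (\<lambda>n. \<one>\<^bsub>Ext kG P M n\<^esub>) \<in> T; S \<subseteq> T;
      \<And>x y. x \<in> T \<Longrightarrow> y \<in> T \<Longrightarrow> (\<lambda>n. x n \<otimes>\<^bsub>Ext kG P M n\<^esub> y n) \<in> T;
      \<And>i x. i < r \<Longrightarrow> x \<in> T \<Longrightarrow> ext_sum_prod kG P M x (\<zeta> i) \<in> T\<rbrakk> \<Longrightarrow> ext_sum_carrier kG P M \<subseteq> T"
proof -
  \<comment> \<open>\<open>left_module\<close> contains the ring axioms of its scalars, so the given
    resolution supplies them for \<open>kG\<close>.\<close>
  have R: "ring kG" using free_resolutionD(2)[OF P] by (simp add: left_module_def)
  note A = triv_module[OF R] and Q = free_resolution_cells[OF R]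
  interpret M: left_module kG M by fact
  interpret P: ext_setting kG triv P by (rule ext_setting.intro[OF A P])
  interpret Q: ext_setting kG triv cell_resolution by (rule ext_setting.intro[OF A Q])
  interpret E: comm_group "Ext kG P M n" for n by (rule P.Ext_comm_group[OF M])
  interpret EA: comm_group "Ext kG P triv n" for n by (rule P.Ext_comm_group[OF A])
  interpret C: cochain_group r q G \<pi> \<alpha> p M by unfold_locales (rule fin)
  obtain \<phi> where \<phi>: "chain_map_over kG P cell_resolution 0 (res_aug P) \<phi>"
    using chain_map_exists[OF A P Q aug_cocycle[OF P]] by blast
  obtain \<psi> where \<psi>: "chain_map_over kG cell_resolution P 0 (res_aug cell_resolution) \<psi>"
    using chain_map_exists[OF A Q P aug_cocycle[OF Q]] by blast
  note chain_op = chain_op_chain_map[OF R]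
  have \<phi>c: "\<phi> n x \<in> carrier (cell_module n)" if "x \<in> carrier (res_term P n)" for n x
    using \<phi> that mhom_closed[of kG "res_term P n" "cell_module n" "\<phi> n" x] by (simp add: chain_map_over_def module_hom_iff cell_resolution_simps)
  have \<psi>c: "\<psi> n f \<in> carrier (res_term P n)" if "f \<in> carrier (cell_module n)" for n f
    using \<psi> that mhom_closed[of kG "cell_module n" "res_term P n" "\<psi> n" f] by (simp add: chain_map_over_def module_hom_iff cell_resolution_simps)
  define U where "U = {u \<in> carrier C.\<Phi>. \<forall>n. u n \<in> ext_cocycles kG cell_resolution M n}"
  define cl where "cl u n = ext_class kG P M n (\<lambda>x\<in>carrier (res_term P n). u n (\<phi> n x))" for u n
  define f where "f i = (\<lambda>x\<in>carrier (res_term P (2 * Suc i)). zeta i (\<phi> (2 * Suc i) x))" for i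
  define z where "z i = ext_class kG P triv (2 * Suc i) (f i)" for i
  define \<zeta> where "\<zeta> i = (\<lambda>n. if n = 2 * Suc i then z i else \<one>\<^bsub>Ext kG P triv n\<^esub>)" for i
  have pull: "(\<lambda>x\<in>carrier (res_term P n). g (\<phi> n x)) \<in> ext_cocycles kG P M n" if "g \<in> ext_cocycles kG cell_resolution M n" for g n
    using pull_cocycle[OF A M P Q \<phi> that] by simp
  have zero_cochain: "C.zero_cochain n \<in> ext_cocycles kG cell_resolution M n" for n
    using Q.zero_cocycle[OF M, of n] by (simp add: C.zero_cochain_def cell_resolution_simps)
  have pull_zc: "ext_class kG P M n (\<lambda>x\<in>carrier (res_term P n). C.zero_cochain n (\<phi> n x)) = \<one>\<^bsub>Ext kG P M n\<^esub>" for n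
  proof -
    have "(\<lambda>x\<in>carrier (res_term P n). C.zero_cochain n (\<phi> n x)) = (\<lambda>x\<in>carrier (res_term P n). \<zero>\<^bsub>M\<^esub>)"
      using \<phi>c by (intro restrict_ext) (simp add: C.zero_cochain_def)
    then show ?thesis using P.ext_class_zero[OF M, of n] by simp
  qed
  have Ucoc: "u n \<in> ext_cocycles kG cell_resolution M n" "u n \<in> C.additive_cochains n" if "u \<in> U" for u n
    using that by (auto simp: U_def C.\<Phi>_simps)
  have cl_closed: "cl u \<in> ext_sum_carrier kG P M" if u: "u \<in> U" for u
  proof -
    have "{n. cl u n \<noteq> \<one>\<^bsub>Ext kG P M n\<^esub>} \<subseteq> {n. u n \<noteq> C.zero_cochain n}" using pull_zc unfolding cl_def by force
    moreover have "finite {n. u n \<noteq> C.zero_cochain n}" using u by (simp add: U_def C.\<Phi>_simps)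
    ultimately have "finite {n. cl u n \<noteq> \<one>\<^bsub>Ext kG P M n\<^esub>}" by (rule finite_subset)
    moreover have "cl u n \<in> carrier (Ext kG P M n)" for n
      unfolding cl_def P.Ext_carrier using pull[OF Ucoc(1)[OF u]] by (rule imageI)
    ultimately show ?thesis by (simp add: ext_sum_carrier_def)
  qed
  have cl_mult: "cl (u \<otimes>\<^bsub>C.\<Phi>\<^esub> v) = (\<lambda>n. cl u n \<otimes>\<^bsub>Ext kG P M n\<^esub> cl v n)" if u: "u \<in> U" and v: "v \<in> U" for u v
  proof
    fix n
    have "cl u n \<otimes>\<^bsub>Ext kG P M n\<^esub> cl v n = ext_class kG P M n (\<lambda>x\<in>carrier (res_term P n).
      (\<lambda>x\<in>carrier (res_term P n). u n (\<phi> n x)) x \<oplus>\<^bsub>M\<^esub> (\<lambda>x\<in>carrier (res_term P n). v n (\<phi> n x)) x)"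
      unfolding cl_def by (rule P.ext_class_add[OF M pull[OF Ucoc(1)[OF u]] pull[OF Ucoc(1)[OF v]]])
    also have "(\<lambda>x\<in>carrier (res_term P n).
      (\<lambda>x\<in>carrier (res_term P n). u n (\<phi> n x)) x \<oplus>\<^bsub>M\<^esub> (\<lambda>x\<in>carrier (res_term P n). v n (\<phi> n x)) x) =
      (\<lambda>x\<in>carrier (res_term P n). (u \<otimes>\<^bsub>C.\<Phi>\<^esub> v) n (\<phi> n x))"
      using \<phi>c by (intro restrict_ext) (simp add: C.\<Phi>_simps(2) C.cochain_add_def)
    finally show "cl (u \<otimes>\<^bsub>C.\<Phi>\<^esub> v) n = cl u n \<otimes>\<^bsub>Ext kG P M n\<^esub> cl v n" unfolding cl_def by (rule sym)
  qed
  have cochain_op_pull: "C.cochain_op i u (2 * Suc i + k) = (\<lambda>f\<in>carrier (cell_module (2 * Suc i + k)). u k (chain_op i k f))" for i u k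
    by (auto simp: C.cochain_op_def C.pullback_def chain_op_def intro!: restrict_ext)
  have cochain_op_coc: "C.cochain_op i u n \<in> ext_cocycles kG cell_resolution M n" if u: "u \<in> U" for i u n
  proof (cases "2 * Suc i \<le> n")
    case True
    then obtain k where k: "n = 2 * Suc i + k" using le_Suc_ex by blast
    show ?thesis
      unfolding k cochain_op_pull using pull_cocycle[OF A M Q Q chain_op Ucoc(1)[OF u], of k i] by (simp only: cell_resolution_simps)
  next
    case False
    show ?thesis unfolding C.cochain_op_def if_not_P[OF False] by (rule zero_cochain)
  qed
  \<comment> \<open>The maps \<open>chain_op\<close> are equivariant chain maps, so precomposition
    with them preserves equivariant cocycles; here the symmetric polynomials are
    indispensable.\<close>
  have stable: "C.ops.op_stable r U"
    unfolding C.ops.op_stable_def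
  proof (intro conjI ballI allI impI)
    show "U \<subseteq> carrier C.\<Phi>" by (auto simp: U_def)
    show "\<one>\<^bsub>C.\<Phi>\<^esub> \<in> U" using zero_cochain C.ops.one_closed by (simp add: U_def C.\<Phi>_simps(3))
  next
    fix u v assume u: "u \<in> U" and v: "v \<in> U"
    have "(u \<otimes>\<^bsub>C.\<Phi>\<^esub> v) n \<in> ext_cocycles kG cell_resolution M n" for n
    proof -
      have "(\<lambda>x\<in>carrier (res_term cell_resolution n). u n x \<oplus>\<^bsub>M\<^esub> v n x) \<in> ext_cocycles kG cell_resolution M n"
        by (rule Q.cocycle_restrictI[OF M mhom_plus[OF Q.PD(2) M]])
          (use Ucoc(1)[OF u, of n] Ucoc(1)[OF v, of n] in \<open>auto simp: mem_ext_cocycles\<close>)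
      then show ?thesis by (simp add: C.\<Phi>_simps(2) C.cochain_add_def cell_resolution_simps)
    qed
    moreover have "u \<otimes>\<^bsub>C.\<Phi>\<^esub> v \<in> carrier C.\<Phi>" using u v by (intro C.ops.m_closed) (auto simp: U_def)
    ultimately show "u \<otimes>\<^bsub>C.\<Phi>\<^esub> v \<in> U" by (simp add: U_def)
  next
    fix i u assume u: "u \<in> U"
    have "u \<in> carrier C.\<Phi>" using u by (simp add: U_def)
    then show "C.cochain_op i u \<in> U" using cochain_op_coc[OF u] C.cochain_op_closed by (simp add: U_def)
  qed
  have zt: "chain_map_over kG P cell_resolution (2 * Suc i) (zeta i \<circ> \<phi> (2 * Suc i))
    (\<lambda>k. \<lambda>x\<in>carrier (res_term P (2 * Suc i + k)). chain_op i k (\<phi> (2 * Suc i + k) x))" for i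
    using chain_map_comp[OF P \<phi> chain_op[of i]] by (simp add: comp_def)
  have f: "f i \<in> ext_cocycles kG P triv (2 * Suc i)" for i
    using chain_map_cocycle[OF A P Q zt[of i]] by (simp add: f_def comp_def)
  have z: "z i \<in> carrier (Ext kG P triv (2 * Suc i))" for i
    unfolding z_def P.Ext_carrier using f by (rule imageI)
  have \<zeta>: "\<zeta> i \<in> ext_sum_carrier kG P triv" for i
    using z by (auto simp: ext_sum_carrier_def \<zeta>_def intro: finite_subset[of _ "{2 * Suc i}"])
  \<comment> \<open>Two lifts of \<open>f i\<close> from \<open>P\<close> to the cell resolution are
    compared: a lift \<open>F\<close> within \<open>P\<close> followed by \<open>\<phi>\<close>, and
    \<open>\<phi>\<close> followed by \<open>chain_op i\<close>. They pull \<open>u\<close> back to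
    the same class; the first gives the Yoneda product, the second the class of
    \<open>C.cochain_op i u\<close>.\<close>
  have cl_EE: "cl (C.cochain_op i u) = ext_sum_prod kG P M (cl u) (\<zeta> i)" if u: "u \<in> U" for i u
  proof
    fix m
    let ?d = "2 * Suc i"
    have hom: "ext_sum_prod kG P M (cl u) (\<zeta> i) m =
      (if ?d \<le> m then yoneda_prod kG P M (m - ?d) ?d (cl u (m - ?d)) (z i) else \<one>\<^bsub>Ext kG P M m\<^esub>)"
      unfolding \<zeta>_def by (rule P.ext_sum_prod_homogeneous[OF M cl_closed[OF u] z])
    show "cl (C.cochain_op i u) m = ext_sum_prod kG P M (cl u) (\<zeta> i) m"
    proof (cases "?d \<le> m")
      case False
      have "C.cochain_op i u m = C.zero_cochain m" unfolding C.cochain_op_def if_not_P[OF False] by (rule refl)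
      then show ?thesis unfolding hom if_not_P[OF False] cl_def using pull_zc by simp
    next
      case True
      then obtain k where k: "m = ?d + k" using le_Suc_ex by blast
      obtain F where F: "chain_lift kG P ?d (f i) F" using P.lift_exists[OF f] .
      have Fc: "F k x \<in> carrier (res_term P k)" if "x \<in> carrier (res_term P (?d + k))" for x
        using F that mhom_closed[of kG "res_term P (?d + k)" "res_term P k" "F k" x]
        by (simp add: chain_lift_def module_hom_iff)
      have F1: "chain_map_over kG P P ?d (f i) F" using F by (simp add: chain_lift_iff)
      have F2: "chain_map_over kG P cell_resolution ?d (\<lambda>x. res_aug P (F 0 x)) (\<lambda>k. \<lambda>x\<in>carrier (res_term P (?d + k)). \<phi> k (F k x))"
        using chain_map_comp[OF P F1 \<phi>] by simp
      have F3: "chain_map_over kG P cell_resolution ?d (f i) (\<lambda>k. \<lambda>x\<in>carrier (res_term P (?d + k)). \<phi> k (F k x))"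
        by (rule chain_map_cong[OF F2]) (use F1 in \<open>simp add: chain_map_over_def\<close>)
      have F4: "chain_map_over kG P cell_resolution ?d (f i) (\<lambda>k. \<lambda>x\<in>carrier (res_term P (?d + k)). chain_op i k (\<phi> (?d + k) x))"
        by (rule chain_map_cong[OF zt]) (simp add: f_def)
      have "yoneda_prod kG P M k ?d (cl u k) (z i) =
        ext_class kG P M (?d + k) (\<lambda>x\<in>carrier (res_term P (?d + k)). (\<lambda>x\<in>carrier (res_term P k). u k (\<phi> k x)) (F k x))"
        unfolding cl_def z_def by (rule P.yoneda_class[OF M pull[OF Ucoc(1)[OF u]] f F])
      also have "(\<lambda>x\<in>carrier (res_term P (?d + k)). (\<lambda>x\<in>carrier (res_term P k). u k (\<phi> k x)) (F k x)) =
        (\<lambda>x\<in>carrier (res_term P (?d + k)). u k ((\<lambda>x\<in>carrier (res_term P (?d + k)). \<phi> k (F k x)) x))"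
        using Fc by (intro restrict_ext) simp
      also have "ext_class kG P M (?d + k) \<dots> = ext_class kG P M (?d + k)
        (\<lambda>x\<in>carrier (res_term P (?d + k)). u k ((\<lambda>x\<in>carrier (res_term P (?d + k)). chain_op i k (\<phi> (?d + k) x)) x))"
        by (rule pull_class_unique[OF A M P Q F3 F4 Ucoc(1)[OF u]])
      also have "(\<lambda>x\<in>carrier (res_term P (?d + k)). u k ((\<lambda>x\<in>carrier (res_term P (?d + k)). chain_op i k (\<phi> (?d + k) x)) x)) =
        (\<lambda>x\<in>carrier (res_term P (?d + k)). C.cochain_op i u (?d + k) (\<phi> (?d + k) x))"
        unfolding cochain_op_pull using \<phi>c by (intro restrict_ext) (simp only: restrict_apply')
      finally have "yoneda_prod kG P M k ?d (cl u k) (z i) = cl (C.cochain_op i u) (?d + k)" unfolding cl_def .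
      then show ?thesis unfolding hom if_P[OF True] by (simp only: k add_diff_cancel_left')
    qed
  qed
  have surj: "\<exists>u\<in>U. cl u = x" if x: "x \<in> ext_sum_carrier kG P M" for x
  proof -
    have "\<forall>n. \<exists>g. g \<in> ext_cocycles kG P M n \<and> x n = ext_class kG P M n g"
      using x by (auto simp: ext_sum_carrier_def P.Ext_carrier image_iff)
    then obtain g where g: "\<And>n. g n \<in> ext_cocycles kG P M n" "\<And>n. x n = ext_class kG P M n (g n)" by metis
    \<comment> \<open>Where \<open>x n\<close> is trivial the zero cochain replaces the chosen
      representative, which might be a non-zero coboundary; this keeps the support of
      \<open>u\<close> finite.\<close>
    define u where "u n = (if x n = \<one>\<^bsub>Ext kG P M n\<^esub> then C.zero_cochain n else (\<lambda>f\<in>carrier (cell_module n). g n (\<psi> n f)))" for n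
    have gc: "(\<lambda>f\<in>carrier (cell_module n). g n (\<psi> n f)) \<in> ext_cocycles kG cell_resolution M n" for n
      using pull_cocycle[OF A M Q P \<psi> g(1), of n] by (simp add: cell_resolution_simps)
    have uc: "u n \<in> ext_cocycles kG cell_resolution M n" for n using gc zero_cochain by (simp add: u_def)
    have "h \<in> C.additive_cochains n" if "h \<in> ext_cocycles kG cell_resolution M n" for h n
      using that by (auto simp: mem_ext_cocycles C.additive_cochains_def mhom_def cell_resolution_simps PiE_def)
    then have "u n \<in> C.additive_cochains n" for n using uc by blast
    moreover have "finite {n. u n \<noteq> C.zero_cochain n}"
    proof (rule finite_subset)
      show "{n. u n \<noteq> C.zero_cochain n} \<subseteq> {n. x n \<noteq> \<one>\<^bsub>Ext kG P M n\<^esub>}" by (auto simp: u_def)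
      show "finite {n. x n \<noteq> \<one>\<^bsub>Ext kG P M n\<^esub>}" using x by (simp add: ext_sum_carrier_def)
    qed
    ultimately have "u \<in> U" using uc by (simp add: U_def C.\<Phi>_simps)
    moreover have "cl u n = x n" for n
    proof (cases "x n = \<one>\<^bsub>Ext kG P M n\<^esub>")
      case True
      then show ?thesis using pull_zc by (simp add: cl_def u_def)
    next
      case False
      \<comment> \<open>\<open>\<phi>\<close> followed by \<open>\<psi>\<close> and the identity of
        \<open>P\<close> both cover the augmentation of \<open>P\<close>, so pulling back along the
        composite does not change classes.\<close>
      have c1: "chain_map_over kG P P 0 (res_aug P) (\<lambda>k. \<lambda>x\<in>carrier (res_term P k). \<psi> k (\<phi> k x))"
      proof (rule chain_map_cong)
        show "chain_map_over kG P P 0 (\<lambda>x. res_aug cell_resolution (\<phi> 0 x)) (\<lambda>k. \<lambda>x\<in>carrier (res_term P k). \<psi> k (\<phi> k x))"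
          using chain_map_comp[OF P \<phi> \<psi>] by simp
      qed (use \<phi> in \<open>simp add: chain_map_over_def\<close>)
      have "ext_class kG P M n (\<lambda>x\<in>carrier (res_term P n). u n (\<phi> n x)) =
        ext_class kG P M n (\<lambda>x\<in>carrier (res_term P n). g n ((\<lambda>x\<in>carrier (res_term P n). \<psi> n (\<phi> n x)) x))"
        using \<phi>c False by (intro arg_cong[where f = "ext_class kG P M n"] restrict_ext) (simp add: u_def)
      also have "\<dots> = ext_class kG P M n (\<lambda>x\<in>carrier (res_term P n). g n ((\<lambda>x\<in>carrier (res_term P n). x) x))"
        using pull_class_unique[OF A M P P c1 chain_map_id[OF P] g(1), of n] by simp
      also have "(\<lambda>x\<in>carrier (res_term P n). g n ((\<lambda>x\<in>carrier (res_term P n). x) x)) = g n"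
        using g(1)[of n] by (intro extensionalityI[of _ "carrier (res_term P n)"]) (auto simp: mem_ext_cocycles)
      finally show ?thesis unfolding cl_def g(2) .
    qed
    ultimately show ?thesis by blast
  qed
  obtain S where S: "finite S" "S \<subseteq> U" "U \<subseteq> C.ops.op_closure r S"
    using C.finitely_generated_cochains[OF stable] by blast
  show thesis
  proof (rule that[of "cl ` S" \<zeta>])
    show "finite (cl ` S)" using S(1) by simp
    show "cl ` S \<subseteq> ext_sum_carrier kG P M" using S(2) cl_closed by blast
    show "\<zeta> i \<in> ext_sum_carrier kG P triv" for i by (rule \<zeta>)
    fix T assume T: "(\<lambda>n. \<one>\<^bsub>Ext kG P M n\<^esub>) \<in> T" "cl ` S \<subseteq> T"
      "\<And>x y. x \<in> T \<Longrightarrow> y \<in> T \<Longrightarrow> (\<lambda>n. x n \<otimes>\<^bsub>Ext kG P M n\<^esub> y n) \<in> T"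
      "\<And>i x. i < r \<Longrightarrow> x \<in> T \<Longrightarrow> ext_sum_prod kG P M x (\<zeta> i) \<in> T"
    have "u \<in> U \<and> cl u \<in> T" if "u \<in> C.ops.op_closure r S" for u
      using that
    proof induction
      case one
      have "cl \<one>\<^bsub>C.\<Phi>\<^esub> = (\<lambda>n. \<one>\<^bsub>Ext kG P M n\<^esub>)" unfolding cl_def C.\<Phi>_simps(3) using pull_zc by (rule ext)
      then show ?case using stable T(1) by (simp add: C.ops.op_stable_def)
    next
      case (incl u)
      then show ?case using S(2) T(2) by blast
    next
      case (mult u v)
      then have "u \<otimes>\<^bsub>C.\<Phi>\<^esub> v \<in> U" using stable by (simp add: C.ops.op_stable_def)
      then show ?case using mult cl_mult T(3) by simp
    next
      case (op i u)
      then have "C.cochain_op i u \<in> U" using stable by (simp add: C.ops.op_stable_def)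
      then show ?case using op cl_EE T(4) by simp
    qed
    then show "ext_sum_carrier kG P M \<subseteq> T" using surj S(3) by blast
  qed
qed

theorem cohomology_finitely_generated:
  assumes P: "free_resolution kG triv P"
  shows "finitely_generated_ring (cohomology_ring (F_p p) G P)"
    and "left_module kG M \<Longrightarrow> finitely_generated_module kG M \<Longrightarrow>
      finitely_generated_module (cohomology_ring (F_p p) G P) (cohomology_module (F_p p) G P M)"
proof -
  have R: "ring kG" using free_resolutionD(2)[OF P] by (simp add: left_module_def)
  note A = triv_module[OF R]
  interpret P: ext_setting kG triv P by (rule ext_setting.intro[OF A P])
  have "finite (carrier triv)" by (simp add: triv_simps)
  from cohomology_generation[OF P A this]
  obtain S \<zeta> where S: "finite S" "S \<subseteq> ext_sum_carrier kG P triv" "\<And>i. \<zeta> i \<in> ext_sum_carrier kG P triv"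
    and gen: "\<And>T. \<lbrakk>T \<subseteq> ext_sum_carrier kG P triv; (\<lambda>n. \<one>\<^bsub>Ext kG P triv n\<^esub>) \<in> T; S \<subseteq> T;
      \<And>x y. x \<in> T \<Longrightarrow> y \<in> T \<Longrightarrow> (\<lambda>n. x n \<otimes>\<^bsub>Ext kG P triv n\<^esub> y n) \<in> T;
      \<And>i x. i < r \<Longrightarrow> x \<in> T \<Longrightarrow> ext_sum_prod kG P triv x (\<zeta> i) \<in> T\<rbrakk> \<Longrightarrow> ext_sum_carrier kG P triv \<subseteq> T"
    by blast
  \<comment> \<open>Module generators over the polynomials in the \<open>\<zeta> i\<close>, together
    with the \<open>\<zeta> i\<close> themselves, generate the ring.\<close>
  define S' where "S' = S \<union> \<zeta> ` {..<r}"
  have S': "finite S'" "S' \<subseteq> ext_sum_carrier kG P triv" using S by (auto simp: S'_def)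
  let ?T = "generate_ring (Ext_ring kG P triv) S'"
  have sub: "?T \<subseteq> ext_sum_carrier kG P triv" by (rule P.generate_ring_Ext_closed[OF S'(2)])
  have "ext_sum_carrier kG P triv \<subseteq> ?T"
  proof (rule gen[OF sub P.zero_in_generate_ring[OF S'(2)]])
    show "S \<subseteq> ?T" by (auto simp: S'_def intro: generate_ring.incl)
    show "(\<lambda>n. x n \<otimes>\<^bsub>Ext kG P triv n\<^esub> y n) \<in> ?T" if "x \<in> ?T" "y \<in> ?T" for x y
      using generate_ring.eng_add[OF that] by (simp add: Ext_ring_def)
    show "ext_sum_prod kG P triv x (\<zeta> i) \<in> ?T" if "i < r" "x \<in> ?T" for i x
    proof -
      have "\<zeta> i \<in> ?T" using that(1) by (intro generate_ring.incl) (simp add: S'_def)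
      from generate_ring.eng_mult[OF that(2) this] show ?thesis by (simp add: Ext_ring_def)
    qed
  qed
  with sub have "?T = ext_sum_carrier kG P triv" by (rule equalityI)
  then show "finitely_generated_ring (cohomology_ring (F_p p) G P)"
    unfolding finitely_generated_ring_def cohomology_ring_def
    using S' by (intro exI[of _ S']) (simp add: Ext_ring_def)
next
  assume M: "left_module kG M" and fg: "finitely_generated_module kG M"
  have R: "ring kG" using free_resolutionD(2)[OF P] by (simp add: left_module_def)
  note A = triv_module[OF R]
  interpret P: ext_setting kG triv P by (rule ext_setting.intro[OF A P])
  \<comment> \<open>Finiteness of \<open>kG\<close> turns finite generation of \<open>M\<close> into
    finiteness, as the cochain groups require.\<close>
  have "finite (carrier kG)" unfolding kG_carrier by (intro finite_PiE G_finite) simp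
  then have "finite (carrier M)" using finite_module[OF M _ fg] by blast
  from cohomology_generation[OF P M this]
  obtain S \<zeta> where S: "finite S" "S \<subseteq> ext_sum_carrier kG P M" "\<And>i. \<zeta> i \<in> ext_sum_carrier kG P triv"
    and gen: "\<And>T. \<lbrakk>T \<subseteq> ext_sum_carrier kG P M; (\<lambda>n. \<one>\<^bsub>Ext kG P M n\<^esub>) \<in> T; S \<subseteq> T;
      \<And>x y. x \<in> T \<Longrightarrow> y \<in> T \<Longrightarrow> (\<lambda>n. x n \<otimes>\<^bsub>Ext kG P M n\<^esub> y n) \<in> T;
      \<And>i x. i < r \<Longrightarrow> x \<in> T \<Longrightarrow> ext_sum_prod kG P M x (\<zeta> i) \<in> T\<rbrakk> \<Longrightarrow> ext_sum_carrier kG P M \<subseteq> T"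
    by blast
  let ?T = "generate_module (Ext_ring kG P triv) (Ext_module kG P M) S"
  have sub: "?T \<subseteq> ext_sum_carrier kG P M" by (rule P.generate_module_Ext_closed[OF M S(2)])
  have "ext_sum_carrier kG P M \<subseteq> ?T"
  proof (rule gen[OF sub])
    show "(\<lambda>n. \<one>\<^bsub>Ext kG P M n\<^esub>) \<in> ?T"
      using generate_module.zero[of "Ext_module kG P M" "Ext_ring kG P triv" S] by (simp add: Ext_module_def)
    show "S \<subseteq> ?T" by (auto intro: generate_module.incl)
    show "(\<lambda>n. x n \<otimes>\<^bsub>Ext kG P M n\<^esub> y n) \<in> ?T" if "x \<in> ?T" "y \<in> ?T" for x y
      using generate_module.add[OF that] by (simp add: Ext_module_def)
    show "ext_sum_prod kG P M x (\<zeta> i) \<in> ?T" if "i < r" "x \<in> ?T" for i x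
    proof -
      have "\<zeta> i \<in> carrier (Ext_ring kG P triv)" using S(3) by (simp add: Ext_ring_def)
      from generate_module.smult[OF this that(2)] show ?thesis by (simp add: Ext_module_def)
    qed
  qed
  with sub have "?T = ext_sum_carrier kG P M" by (rule equalityI)
  then show "finitely_generated_module (cohomology_ring (F_p p) G P) (cohomology_module (F_p p) G P M)"
    unfolding finitely_generated_module_def cohomology_ring_def cohomology_module_def
    using S by (intro exI[of _ S]) (simp add: Ext_module_def)
qed

end

theorem theorem2p5:
  fixes p :: nat
    and G :: "'g monoid"
    and P :: "('g \<Rightarrow> int, 'b, int) resolution"
  assumes "Factorial_Ring.prime p"
    and "group G" and "finite (carrier G)" and "\<exists>n. order G = p ^ n"
    and "free_resolution (group_algebra (F_p p) G) (trivial_module (F_p p) G) P"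
  shows "finitely_generated_ring (cohomology_ring (F_p p) G P) \<and>
    (\<forall>M :: ('g \<Rightarrow> int, 'm) module.
      left_module (group_algebra (F_p p) G) M \<and>
      finitely_generated_module (group_algebra (F_p p) G) M \<longrightarrow>
      finitely_generated_module (cohomology_ring (F_p p) G P) (cohomology_module (F_p p) G P M))"
proof -
  interpret group G by fact
  show ?thesis
  proof (rule cyclic_coset_data[OF assms(3)])
    fix r :: nat and q :: "nat \<Rightarrow> nat" and \<pi> \<alpha> :: "'g \<Rightarrow> nat \<Rightarrow> nat"
    assume data: "\<And>j. q j > 0"
      "\<And>g j. g \<in> carrier G \<Longrightarrow> j < r \<Longrightarrow> \<pi> g j < r"
      "\<And>g j. g \<in> carrier G \<Longrightarrow> \<not> j < r \<Longrightarrow> \<pi> g j = j"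
      "\<And>g h j. g \<in> carrier G \<Longrightarrow> h \<in> carrier G \<Longrightarrow> \<pi> (g \<otimes>\<^bsub>G\<^esub> h) j = \<pi> g (\<pi> h j)"
      "\<And>j. \<pi> \<one>\<^bsub>G\<^esub> j = j"
      "\<And>g j. g \<in> carrier G \<Longrightarrow> q (\<pi> g j) = q j"
      "\<And>g h j. g \<in> carrier G \<Longrightarrow> h \<in> carrier G \<Longrightarrow> j < r \<Longrightarrow> [\<alpha> (g \<otimes>\<^bsub>G\<^esub> h) j = \<alpha> g (\<pi> h j) + \<alpha> h j] (mod q j)"
      "\<And>g. g \<in> carrier G \<Longrightarrow> g \<noteq> \<one>\<^bsub>G\<^esub> \<Longrightarrow> \<exists>j<r. \<pi> g j = j \<and> \<not> q j dvd \<alpha> g j"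
    interpret group_complex r q G \<pi> \<alpha> p
    proof unfold_locales
      show "finite (carrier G)" by (rule assms(3))
      show "1 < p" by (rule prime_gt_1_nat[OF assms(1)])
    qed (fact data)+
    show ?thesis using cohomology_finitely_generated[OF assms(5)] by blast
  qed
qed

end
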